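(* Consider a graph $G=(V,E)$ with $n=|V|$, and a skeleton graph $S_x=(M,E_S)$ of $G$, for some constant $2/3<x<1$. Let $ALG_{AC}$ be an algorithm that runs in the Anonymous Capacitated model $\mathsf{AC}(c)$ with capacity $c=\tilde\Theta(n^{2-2x})$ over $S_x$ in $t$ rounds. Then there exists an algorithm that simulates $ALG_{AC}$ within $\tilde\Theta(t\cdot n^{1-x})$ rounds of the Hybrid model over $G$, with high probability. Further, it is ensured that at the start of the simulation every node in $M$ knows the communication tokens of all its neighbors in $S_x$.
   Context: Hybrid model over $G=(V,E)$: a synchronous network of $n=|V|$ nodes with identifiers in $[n]$. In each round every node can exchange an unbounded number of $O(\log n)$-bit messages with each neighbor in $G$ (local edges), and can additionally send and receive in total $\gamma=\log n$ messages of $O(\log n)$ bits to/from arbitrary nodes (global edges); if more than $\gamma$ global messages are sent to/from a node in a round, only $\gamma$ adversarially chosen ones are delivered. Local computation is free and randomness is allowed. $\mathsf{AC}(c)$ model over a graph $H$ on $N$ nodes: a synchronous model in which each node can send and receive $c$ messages per round, each of $O(\log N)$ bits, to and from any nodes. Nodes have identifiers in $[N]$; in addition every node has a unique $O(\log N)$-bit communication token, initially known only to itself. A node can send each message either to a node whose communication token it already knows, or to a node selected uniformly and independently at random from all nodes. Skeleton graph: given $G=(V,E)$ and $0<x<1$, a (weighted) graph $S_x=(M,E_S)$ with $M\subseteq V$ is a skeleton graph in $G$ if, for some $h=\tilde\Theta(n^{1-x})$: (1) $\{v,u\}\in E_S$ iff there is a path of at most $h$ edges between $v,u$ in $G$;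 (2) every $v\in M$ knows all its incident edges in $E_S$; (3) $S_x$ is connected; (4) $d_{S_x}(v,v')=d_G(v,v')$ for all $v,v'\in M$; (5) for any $u,v\in V$ at hop distance at least $h$ there is a shortest path $P$ from $u$ to $v$ in $G$ such that any sub-path of $P$ with at least $h$ nodes contains a node of $M$; (6) $|M|=\tilde\Theta(n^x)$; (7) each $v\in M$ has a helper set $H_v\subseteq V$ with $|H_v|=n^{1-x}$, all of whose nodes are within $\tilde O(n^{1-x})$ hops of $v$ in $G$, such that each $u\in V$ belongs to $H_w$ for at most $\tilde O(1)$ nodes $w\in M$, and $|\bigcup_{v\in M}H_v|=\tilde\Omega(n)$. Graphs are connected. $\tilde O,\tilde\Theta,\tilde\Omega$ hide factors polylogarithmic in $n$. "With high probability" means with probability at least $1-n^{-c'}$ for a constant $c'>1$. *)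

theory Defs
  imports "HOL-Probability.Probability" "HOL-Library.Sublist"
begin

type_synonym bits = "bool list"

section \<open>Bounds up to polylogarithmic factors\<close>

text \<open>A single constant \<open>K\<close> serves as hidden factor and as hidden exponent. This loses nothing
  because \<open>log 2 n \<ge> 1\<close> for \<open>n \<ge> 2\<close>. The bounds have their asymptotic meaning once \<open>K\<close> is
  quantified outside of \<open>n\<close>.\<close>

definition tilde_O :: "nat \<Rightarrow> nat \<Rightarrow> real \<Rightarrow> real \<Rightarrow> bool" where
  "tilde_O K n a b \<longleftrightarrow> a \<le> real K * log 2 (real n) ^ K * b"

definition tilde_Omega :: "nat \<Rightarrow> nat \<Rightarrow> real \<Rightarrow> real \<Rightarrow> bool" where
  "tilde_Omega K n a b \<longleftrightarrow> tilde_O K n b a"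

definition tilde_Theta :: "nat \<Rightarrow> nat \<Rightarrow> real \<Rightarrow> real \<Rightarrow> bool" where
  "tilde_Theta K n a b \<longleftrightarrow> tilde_O K n a b \<and> tilde_Omega K n a b"

section \<open>Weighted graphs\<close>

text \<open>An unweighted graph is the case of constant weight 1.\<close>

record wgraph =
  verts :: "nat set"
  edges :: "nat set set"
  wt :: "nat set \<Rightarrow> nat"

definition is_path :: "wgraph \<Rightarrow> nat \<Rightarrow> nat \<Rightarrow> nat list \<Rightarrow> bool" where
  "is_path G u v p \<longleftrightarrow> p \<noteq> [] \<and> hd p = u \<and> last p = v \<and> set p \<subseteq> verts G \<and> distinct p \<and>
     successively (\<lambda>a b. {a, b} \<in> edges G) p"

definition path_hops :: "nat list \<Rightarrow> nat" where
  "path_hops p = length p - 1"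

definition path_weight :: "wgraph \<Rightarrow> nat list \<Rightarrow> nat" where
  "path_weight G p = (\<Sum>(a, b) \<leftarrow> zip p (tl p). wt G {a, b})"

definition connected_graph :: "wgraph \<Rightarrow> bool" where
  "connected_graph G \<longleftrightarrow> (\<forall>u\<in>verts G. \<forall>v\<in>verts G. \<exists>p. is_path G u v p)"

definition graph :: "wgraph \<Rightarrow> bool" where
  "graph G \<longleftrightarrow> finite (verts G) \<and>
     edges G \<subseteq> {{u, v} | u v. u \<in> verts G \<and> v \<in> verts G \<and> u \<noteq> v} \<and>
     (\<forall>e\<in>edges G. 0 < wt G e)"

text \<open>Both distances are meaningful for vertices of a connected graph only.\<close>

definition hop_dist :: "wgraph \<Rightarrow> nat \<Rightarrow> nat \<Rightarrow> nat" where
  "hop_dist G u v = Inf {path_hops p | p. is_path G u v p}"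

definition wdist :: "wgraph \<Rightarrow> nat \<Rightarrow> nat \<Rightarrow> nat" where
  "wdist G u v = Inf {path_weight G p | p. is_path G u v p}"

definition nbrs :: "wgraph \<Rightarrow> nat \<Rightarrow> nat set" where
  "nbrs G v = {u. {v, u} \<in> edges G}"

definition incident :: "wgraph \<Rightarrow> nat \<Rightarrow> (nat \<times> nat) set" where
  "incident G v = (\<lambda>u. (u, wt G {v, u})) ` nbrs G v"

definition network :: "nat \<Rightarrow> wgraph \<Rightarrow> bool" where
  "network n G \<longleftrightarrow> graph G \<and> connected_graph G \<and> verts G = {1..n}"

section \<open>Skeleton graphs\<close>

text \<open>\<open>H v\<close> is the helper set of the skeleton node \<open>v\<close>. As \<open>n powr (1 - x)\<close> need not be an
  integer, its size may be either of the two roundings of that number. That skeleton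
  nodes know their incident skeleton edges is part of the initial knowledge \<open>hyb_info\<close> below.\<close>

definition skeleton :: "nat \<Rightarrow> real \<Rightarrow> wgraph \<Rightarrow> wgraph \<Rightarrow> (nat \<Rightarrow> nat set) \<Rightarrow> bool" where
  "skeleton K x G S H \<longleftrightarrow>
    (let n = card (verts G); M = verts S; s = real n powr (1 - x) in
     graph S \<and> M \<subseteq> verts G \<and>
     (\<exists>h::nat. tilde_Theta K n (real h) s \<and>
        (\<forall>v\<in>M. \<forall>u\<in>M. v \<noteq> u \<longrightarrow>
           ({v, u} \<in> edges S \<longleftrightarrow> (\<exists>p. is_path G v u p \<and> path_hops p \<le> h))) \<and>
        (\<forall>u\<in>verts G. \<forall>v\<in>verts G. h \<le> hop_dist G u v \<longrightarrow>
           (\<exists>p. is_path G u v p \<and> path_weight G p = wdist G u v \<and>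
              (\<forall>q. sublist q p \<and> h \<le> length q \<longrightarrow> set q \<inter> M \<noteq> {})))) \<and>
     connected_graph S \<and>
     (\<forall>v\<in>M. \<forall>u\<in>M. wdist S v u = wdist G v u) \<and>
     tilde_Theta K n (real (card M)) (real n powr x) \<and>
     (\<forall>v\<in>M. H v \<subseteq> verts G \<and> \<bar>real (card (H v)) - s\<bar> < 1 \<and>
        (\<forall>u\<in>H v. tilde_O K n (real (hop_dist G v u)) s)) \<and>
     (\<forall>u\<in>verts G. tilde_O K n (real (card {w\<in>M. u \<in> H w})) 1) \<and>
     tilde_Omega K n (real (card (\<Union>v\<in>M. H v))) (real n))"

section \<open>Capacity-bounded delivery and randomized synchronous runs\<close>

text \<open>The message \<open>(u, i)\<close> is the \<open>i\<close>-th message that node \<open>u\<close> issues in the current round.\<close>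

type_synonym slot = "nat \<times> nat"

text \<open>Of the messages \<open>A\<close> issued in a round, with destinations \<open>dest\<close>, the set \<open>D\<close> is delivered:
  if a node issues more than \<open>cap\<close> messages, some \<open>cap\<close> of them are let through, and if more than
  \<open>cap\<close> of these are addressed to a node, some \<open>cap\<close> of them arrive.\<close>

definition capped_delivery :: "nat \<Rightarrow> slot set \<Rightarrow> (slot \<Rightarrow> nat) \<Rightarrow> slot set \<Rightarrow> bool" where
  "capped_delivery cap A dest D \<longleftrightarrow> (\<exists>B\<subseteq>A. D \<subseteq> B \<and>
     (\<forall>u. card {m\<in>B. fst m = u} = min cap (card {m\<in>A. fst m = u})) \<and>
     (\<forall>w. card {m\<in>D. dest m = w} = min cap (card {m\<in>B. dest m = w})))"

text \<open>An event records one round: the actions (including random choices) of all nodes, the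
  destinations of the messages and the delivered messages. The adversary knows all past events
  and the current round up to delivery, and may itself be randomized.\<close>

type_synonym 'act event = "(nat \<Rightarrow> 'act) \<times> (slot \<Rightarrow> nat) \<times> slot set"

type_synonym 'act adversary =
  "'act event list \<Rightarrow> (nat \<Rightarrow> 'act) \<Rightarrow> slot set \<Rightarrow> (slot \<Rightarrow> nat) \<Rightarrow> slot set pmf"

definition adversary :: "nat \<Rightarrow> 'act adversary \<Rightarrow> bool" where
  "adversary cap adv \<longleftrightarrow> (\<forall>es acts A dest. finite A \<longrightarrow>
     (\<forall>D\<in>set_pmf (adv es acts A dest). capped_delivery cap A dest D))"

text \<open>The list of configurations of a \<open>k\<close>-round run has length \<open>k + 1\<close>.\<close>

primrec run :: "('ev list \<Rightarrow> 'cfg \<Rightarrow> ('ev \<times> 'cfg) pmf) \<Rightarrow> 'cfg \<Rightarrow> nat \<Rightarrow> ('cfg list \<times> 'ev list) pmf"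
where
  "run step c0 0 = return_pmf ([c0], [])"
| "run step c0 (Suc k) = bind_pmf (run step c0 k)
     (\<lambda>(cs, es). map_pmf (\<lambda>(e, c). (cs @ [c], es @ [e])) (step es (last cs)))"

definition configs :: "('ev list \<Rightarrow> 'cfg \<Rightarrow> ('ev \<times> 'cfg) pmf) \<Rightarrow> 'cfg \<Rightarrow> nat \<Rightarrow> 'cfg list pmf" where
  "configs step c0 k = map_pmf fst (run step c0 k)"

section \<open>The Hybrid model\<close>

text \<open>The last component of the initial knowledge is \<open>None\<close> outside of the skeleton. A skeleton
  node knows its incident skeleton edges with their weights, its helper set, and its input to the
  simulated algorithm.\<close>

record hyb_info =
  hi_id :: nat
  hi_incident :: "(nat \<times> nat) set"
  hi_skeleton :: "((nat \<times> nat) set \<times> nat set \<times> bits) option"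

text \<open>In a round a node first performs an action, i.e. it updates its memory and chooses, possibly
  at random, lists of messages for its neighbors (local edges) and a list of addressed messages
  (global edges); then it updates its memory using the local messages, indexed by the sender, and
  the multiset of global messages that it receives.\<close>

type_synonym hyb_act = "bits \<times> (nat \<Rightarrow> bits list) \<times> (nat \<times> bits) list"

record hyb_alg =
  h_init :: "hyb_info \<Rightarrow> bits"
  h_act :: "bits \<Rightarrow> hyb_act pmf"
  h_upd :: "bits \<Rightarrow> (nat \<Rightarrow> bits list) \<Rightarrow> bits multiset \<Rightarrow> bits"

definition hyb_message_bound :: "nat \<Rightarrow> nat \<Rightarrow> hyb_alg \<Rightarrow> bool" where
  "hyb_message_bound k n alg \<longleftrightarrow>
     (\<forall>mem. \<forall>(mem', loc, glob) \<in> set_pmf (h_act alg mem).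
        (\<forall>w. \<forall>b\<in>set (loc w). real (length b) \<le> real k * log 2 (real n)) \<and>
        (\<forall>(w, b)\<in>set glob. real (length b) \<le> real k * log 2 (real n)))"

definition global_capacity :: "nat \<Rightarrow> nat" where
  "global_capacity n = nat \<lfloor>log 2 (real n)\<rfloor>"

definition hyb_start ::
  "wgraph \<Rightarrow> wgraph \<Rightarrow> (nat \<Rightarrow> nat set) \<Rightarrow> (nat \<Rightarrow> bits) \<Rightarrow> hyb_alg \<Rightarrow> nat \<Rightarrow> bits" where
  "hyb_start G S H inp alg v = h_init alg
     \<lparr>hi_id = v, hi_incident = incident G v,
      hi_skeleton = (if v \<in> verts S then Some (incident S v, H v, inp v) else None)\<rparr>"

definition hyb_step :: "wgraph \<Rightarrow> hyb_alg \<Rightarrow> hyb_act adversary \<Rightarrow>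
    hyb_act event list \<Rightarrow> (nat \<Rightarrow> bits) \<Rightarrow> (hyb_act event \<times> (nat \<Rightarrow> bits)) pmf" where
  "hyb_step G alg adv es cfg = do {
     acts \<leftarrow> Pi_pmf (verts G) undefined (\<lambda>v. h_act alg (cfg v));
     let mem = (\<lambda>v. fst (acts v));
     let loc = (\<lambda>v. fst (snd (acts v)));
     let glob = (\<lambda>v. snd (snd (acts v)));
     let dest = (\<lambda>(u, i). fst (glob u ! i));
     let A = {(u, i). u \<in> verts G \<and> i < length (glob u) \<and> dest (u, i) \<in> verts G};
     D \<leftarrow> adv es acts A dest;
     return_pmf ((acts, dest, D),
       \<lambda>v. h_upd alg (mem v)
         (\<lambda>u. if u \<in> nbrs G v then loc u v else [])
         (image_mset (\<lambda>(u, i). snd (glob u ! i)) (mset_set {m\<in>D. dest m = v})))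
   }"

section \<open>The Anonymous Capacitated model\<close>

text \<open>A message consists of plain bits and of the communication tokens it conveys; both count
  towards its size. A node knows the tokens that it knew initially and those conveyed by the
  messages it received. Messages addressed to unknown tokens or conveying unknown tokens are
  not sent. Inboxes are multisets of messages and thus do not reveal the senders.\<close>

datatype target = Token bits | Random

type_synonym ac_msg = "bits \<times> bits list"

definition msg_size :: "ac_msg \<Rightarrow> nat" where
  "msg_size m = length (fst m) + sum_list (map length (snd m))"

definition may_send :: "bits set \<Rightarrow> target \<times> ac_msg \<Rightarrow> bool" where
  "may_send T m \<longleftrightarrow> set (snd (snd m)) \<subseteq> T \<and>
     (case fst m of Token \<tau> \<Rightarrow> \<tau> \<in> T | Random \<Rightarrow> True)"

text \<open>A node knows its identifier, its own token, its incident edges (the identifiers of its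
  neighbors and the weights), the tokens of certain nodes together with their identifiers, and its
  input.\<close>

record ac_info =
  ai_id :: nat
  ai_token :: bits
  ai_incident :: "(nat \<times> nat) set"
  ai_tokens :: "(nat \<times> bits) set"
  ai_input :: bits

type_synonym ac_act = "bits \<times> (target \<times> ac_msg) list"

record ac_alg =
  a_init :: "ac_info \<Rightarrow> bits"
  a_act :: "bits \<Rightarrow> ac_act pmf"
  a_upd :: "bits \<Rightarrow> ac_msg multiset \<Rightarrow> bits"

text \<open>The memory and the set of known tokens.\<close>

type_synonym ac_state = "bits \<times> bits set"

definition ac_message_bound :: "nat \<Rightarrow> nat \<Rightarrow> ac_alg \<Rightarrow> bool" where
  "ac_message_bound k N alg \<longleftrightarrow>
     (\<forall>mem. \<forall>(mem', out) \<in> set_pmf (a_act alg mem). \<forall>(tgt, m) \<in> set out.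
        real (msg_size m) \<le> real k * log 2 (real N))"

definition identifiers :: "nat set \<Rightarrow> (nat \<Rightarrow> nat) \<Rightarrow> bool" where
  "identifiers M ident \<longleftrightarrow> bij_betw ident M {1..card M}"

definition tokens :: "nat \<Rightarrow> nat set \<Rightarrow> (nat \<Rightarrow> bits) \<Rightarrow> bool" where
  "tokens k M tok \<longleftrightarrow> inj_on tok M \<and>
     (\<forall>v\<in>M. real (length (tok v)) \<le> real k * log 2 (real (card M)))"

text \<open>Besides its own token, node \<open>v\<close> initially knows the tokens of the nodes in \<open>known v\<close>; in the
  plain model \<open>known v\<close> is empty.\<close>

definition ac_start :: "wgraph \<Rightarrow> (nat \<Rightarrow> nat) \<Rightarrow> (nat \<Rightarrow> bits) \<Rightarrow> (nat \<Rightarrow> nat set) \<Rightarrow>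
    (nat \<Rightarrow> bits) \<Rightarrow> ac_alg \<Rightarrow> nat \<Rightarrow> ac_state" where
  "ac_start S ident tok known inp alg v =
    (a_init alg \<lparr>ai_id = ident v, ai_token = tok v,
       ai_incident = (\<lambda>(u, w). (ident u, w)) ` incident S v,
       ai_tokens = (\<lambda>u. (ident u, tok u)) ` known v, ai_input = inp v\<rparr>,
     tok ` insert v (known v))"

definition ac_step :: "wgraph \<Rightarrow> (nat \<Rightarrow> bits) \<Rightarrow> ac_alg \<Rightarrow> ac_act adversary \<Rightarrow>
    ac_act event list \<Rightarrow> (nat \<Rightarrow> ac_state) \<Rightarrow> (ac_act event \<times> (nat \<Rightarrow> ac_state)) pmf" where
  "ac_step S tok alg adv es cfg = do {
     acts \<leftarrow> Pi_pmf (verts S) undefined (\<lambda>v. a_act alg (fst (cfg v)));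
     let out = (\<lambda>v. snd (acts v));
     let A = {(u, i). u \<in> verts S \<and> i < length (out u) \<and> may_send (snd (cfg u)) (out u ! i)};
     rand \<leftarrow> Pi_pmf A undefined (\<lambda>_. pmf_of_set (verts S));
     let dest = (\<lambda>(u, i). case fst (out u ! i) of
                   Token \<tau> \<Rightarrow> the_inv_into (verts S) tok \<tau> | Random \<Rightarrow> rand (u, i));
     D \<leftarrow> adv es acts A dest;
     let inbox = (\<lambda>v. image_mset (\<lambda>(u, i). snd (out u ! i)) (mset_set {m\<in>D. dest m = v}));
     return_pmf ((acts, dest, D),
       \<lambda>v. (a_upd alg (fst (acts v)) (inbox v),
            snd (cfg v) \<union> (\<Union>m\<in>set_mset (inbox v). set (snd m))))
   }"

section \<open>Simulation\<close>

definition coupled :: "real \<Rightarrow> 'a pmf \<Rightarrow> 'b pmf \<Rightarrow> ('a \<Rightarrow> 'b \<Rightarrow> bool) \<Rightarrow> bool" where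
  "coupled p P Q R \<longleftrightarrow> (\<exists>J. map_pmf fst J = P \<and> map_pmf snd J = Q \<and>
     p \<le> measure_pmf.prob J {(a, b). R a b})"

text \<open>The \<open>t\<close>-round run of the AC algorithm that is being simulated starts in the Hybrid round
  \<open>r 0\<close>, and its \<open>i\<close>-th round is completed in the Hybrid round \<open>r i\<close>: at that time every node of
  the skeleton graph can compute, by \<open>dec\<close> from its own memory, its state after \<open>i\<close> rounds of an
  AC run. The initial state in this AC run contains the tokens of all neighbors in \<open>S\<close>.
  The simulation provides the identifiers and the tokens of the AC network.\<close>

definition simulates_on :: "real \<Rightarrow> nat \<Rightarrow> nat \<Rightarrow> nat \<Rightarrow> ac_alg \<Rightarrow> nat \<Rightarrow> hyb_alg \<Rightarrow>
    (bits \<Rightarrow> ac_state) \<Rightarrow> (nat \<Rightarrow> nat) \<Rightarrow> wgraph \<Rightarrow> wgraph \<Rightarrow> (nat \<Rightarrow> nat set) \<Rightarrow>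
    (nat \<Rightarrow> bits) \<Rightarrow> hyb_act adversary \<Rightarrow> bool" where
  "simulates_on p kT c t alg T sim dec r G S H inp adv \<longleftrightarrow>
    (\<exists>ident tok adv'. identifiers (verts S) ident \<and> tokens kT (verts S) tok \<and> adversary c adv' \<and>
       coupled p
         (configs (hyb_step G sim adv) (hyb_start G S H inp sim) T)
         (configs (ac_step S tok alg adv') (ac_start S ident tok (nbrs S) inp alg) t)
         (\<lambda>hs as. \<forall>i\<le>t. \<forall>v\<in>verts S. dec ((hs ! r i) v) = (as ! i) v))"

end

theory Submission
  imports Defs "HOL-Library.FSet"
begin

text \<open>Each of the \<open>n\<close> nodes owns \<open>2 ^ a\<close> wires, where \<open>2 ^ a\<close> is \<open>n powr (1 - x)\<close> up to polylogarithmic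
  factors. The wires are sorted by a bitonic network and scanned for prefix maxima. Every comparator and
  every scan step joins wires whose numbers differ by a fixed XOR mask. Hence a node exchanges all of its
  items with a single partner, one item per round, so no node ever receives more than one global message in
  a round and the choices of the adversary are void. Meanwhile the nodes flood their states to distance
  \<open>L \<ge> 2 ^ a\<close>, which covers helper sets and skeleton edges. So a step of the network takes \<open>L\<close> rounds, and
  sorting takes \<open>n powr (1 - x)\<close> rounds up to polylogarithmic factors.

  A first sort ranks the skeleton nodes. The ranks provide identifiers and tokens, and each skeleton node
  learns those of its neighbours by flooding. To simulate a round, every skeleton node draws its messages,
  truncates them to \<open>c\<close>, and spreads them together with \<open>c\<close> empty slots over its \<open>n powr (1 - x)\<close> helpers,
  which have enough wires since \<open>c\<close> is the square of their number up to polylogarithmic factors. Sorting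
  the messages by destination numbers the messages of each destination. Those with a number below \<open>c\<close> are
  sorted again together with the slots such that the \<open>j\<close>-th message for \<open>w\<close> meets the \<open>j\<close>-th slot of
  \<open>w\<close>, and flooding returns the contents of the slots. Since the adversary of the simulated model may be
  chosen freely, it is taken to deliver exactly these messages. Then the two runs are coupled with
  probability one.\<close>

section \<open>Sorting and scanning along hypercube edges\<close>

text \<open>The program is chosen before \<open>G\<close>, \<open>S\<close> and \<open>H\<close>. So
  loads and radii are bounded only through the skeleton conditions, with the hidden factor
  \<open>K * log n ^ K\<close>, and the nodes must compute the number of skeleton nodes before they
  can start the algorithm for that size. The number of wires need not be a power of two: a missing
  wire behaves as if it carried an infinite key, which is consistent because every comparator sends
  the smaller key to the lower wire. Truncation enforces the capacity of a sender and the numbering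
  that of a recipient. Counting inside a group needs only a prefix maximum, since an item that knows
  its rank and the start of its group knows its index. Slots are needed because a message does not
  know at which helper it will be picked up; the second sort lets both meet without addressing that
  helper. The random draws agree since a uniform rank is the image of a uniform skeleton node.
  Everything after the draws is a function of data that the adversary of the simulated model sees as
  well.\<close>

lemma xor_less_power:
  fixes i :: nat
  assumes "i < 2 ^ k" "\<mu> < 2 ^ k"
  shows "xor i \<mu> < 2 ^ k"
  using assms by (metis take_bit_nat_eq_self_iff take_bit_xor)

text \<open>The block number occupies the bits from \<open>k\<close> on, and a mask below
  \<open>2 ^ k\<close> does not touch them.\<close>

lemma xor_block:
  fixes i :: nat
  assumes "i < 2 ^ k" "\<mu> < 2 ^ k"
  shows "xor (s * 2 ^ k + i) \<mu> = s * 2 ^ k + xor i \<mu>"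
proof -
  have *: "s * 2 ^ k + j = xor (push_bit k s) j" if "j < 2 ^ k" for j :: nat
  proof -
    have "and (push_bit k s) j = 0"
      using that by (auto simp: bit_eq_iff bit_simps)
        (metis bit_take_bit_iff linorder_not_le take_bit_nat_eq_self)
    then show ?thesis
      by (metis disjunctive_add_eq_xor push_bit_eq_mult)
  qed
  show ?thesis
    using *[OF assms(1)] *[OF xor_less_power[OF assms]] by (simp add: xor.assoc)
qed

lemma bit_less_power:
  fixes i :: nat
  shows "i < 2 ^ k \<Longrightarrow> bit i j \<Longrightarrow> j < k"
  by (metis bit_take_bit_iff take_bit_nat_eq_self)

text \<open>The all-ones mask mirrors a block: \<open>i\<close> and its complement have disjoint
  bits, so their sum is their XOR, which is the mask.\<close>

lemma xor_flip:
  fixes i :: nat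
  assumes "i < 2 ^ k"
  shows "xor i (2 ^ k - 1) = 2 ^ k - 1 - i"
proof -
  have m: "bit (2 ^ k - 1 :: nat) j \<longleftrightarrow> j < k" for j
    unfolding mask_eq_exp_minus_1[symmetric] by (simp add: bit_mask_iff)
  have d: "and (xor i (2 ^ k - 1)) i = 0"
    by (rule bit_eqI) (use m bit_less_power[OF assms] in \<open>auto simp: bit_and_iff bit_xor_iff\<close>)
  have "i + xor i (2 ^ k - 1) = xor i (xor i (2 ^ k - 1))"
    using d by (subst disjunctive_add_eq_xor) (auto simp: and.commute)
  also have "\<dots> = 2 ^ k - 1"
    by (simp add: xor.assoc[symmetric])
  finally show ?thesis by linarith
qed

lemma xor_toggle:
  fixes i :: nat
  assumes "i < 2 ^ b"
  shows "xor i (2 ^ b) = i + 2 ^ b" "xor (i + 2 ^ b) (2 ^ b) = i"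
proof -
  have "and i (2 ^ b) = 0"
    by (rule bit_eqI) (use bit_less_power[OF assms] in \<open>auto simp: bit_and_iff bit_exp_iff\<close>)
  then show *: "xor i (2 ^ b) = i + 2 ^ b"
    by (simp add: disjunctive_add_eq_xor)
  show "xor (i + 2 ^ b) (2 ^ b) = i"
    unfolding *[symmetric] by (simp add: xor.assoc)
qed

lemma xor_toggle_div:
  fixes p :: nat
  assumes "b < q"
  shows "xor p (2 ^ b) div 2 ^ q = p div 2 ^ q"
proof -
  have "drop_bit q (xor p (2 ^ b)) = drop_bit q p"
    using assms unfolding drop_bit_xor by (simp add: drop_bit_eq_div[of _ "2 ^ b"])
  then show ?thesis unfolding drop_bit_eq_div .
qed

lemma xor_xor_cancel [simp]: "xor (xor p \<mu>) \<mu> = (p :: nat)"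
  by (simp add: xor.assoc)

lemma xor_toggle_block:
  fixes i s :: nat
  assumes "i < 2 ^ b"
  shows "xor (2 * s * 2 ^ b + i) (2 ^ b) = (2 * s + 1) * 2 ^ b + i"
    and "xor ((2 * s + 1) * 2 ^ b + i) (2 ^ b) = 2 * s * 2 ^ b + i"
proof -
  have "xor (s * 2 ^ Suc b + i) (2 ^ b) = s * 2 ^ Suc b + (i + 2 ^ b)"
    using assms by (subst xor_block) (auto simp: xor_toggle)
  then show *: "xor (2 * s * 2 ^ b + i) (2 ^ b) = (2 * s + 1) * 2 ^ b + i"
    by (simp add: algebra_simps)
  show "xor ((2 * s + 1) * 2 ^ b + i) (2 ^ b) = 2 * s * 2 ^ b + i"
    unfolding *[symmetric] by simp
qed

text \<open>A stage is one parallel step along the edges \<open>{p, xor p \<mu>}\<close>. Wires \<open>\<ge> W\<close> do not exist, and a wire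
  whose partner does not exist is left alone.\<close>

definition stage :: "nat \<Rightarrow> nat \<Rightarrow> (nat \<Rightarrow> 'a \<Rightarrow> 'a \<Rightarrow> 'a) \<Rightarrow> (nat \<Rightarrow> 'a) \<Rightarrow> nat \<Rightarrow> 'a" where
  "stage W \<mu> g f p = (if xor p \<mu> < W then g p (f p) (f (xor p \<mu>)) else f p)"

definition run_stages :: "nat \<Rightarrow> (nat \<times> (nat \<Rightarrow> 'a \<Rightarrow> 'a \<Rightarrow> 'a)) list \<Rightarrow> (nat \<Rightarrow> 'a) \<Rightarrow> nat \<Rightarrow> 'a" where
  "run_stages W xs f = fold (\<lambda>(\<mu>, g). stage W \<mu> g) xs f"

lemma run_stages_simps [simp]:
  "run_stages W [] f = f"
  "run_stages W ((\<mu>, g) # xs) f = run_stages W xs (stage W \<mu> g f)"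
  "run_stages W (xs @ ys) f = run_stages W ys (run_stages W xs f)"
  by (simp_all add: run_stages_def)

text \<open>Here \<open>x\<close> is the item of wire \<open>p\<close> and \<open>y\<close> that of
  its partner. Both branches keep \<open>x\<close> on equal keys, so a tie never puts the same item
  on both wires.\<close>

definition compare_exchange :: "('a \<Rightarrow> 'b::linorder) \<Rightarrow> nat \<Rightarrow> nat \<Rightarrow> 'a \<Rightarrow> 'a \<Rightarrow> 'a" where
  "compare_exchange k \<mu> p x y =
    (if p < xor p \<mu> then (if k x \<le> k y then x else y) else (if k y \<le> k x then x else y))"

primrec clean_masks :: "nat \<Rightarrow> nat list" where
  "clean_masks 0 = []"
| "clean_masks (Suc b) = 2 ^ b # clean_masks b"

text \<open>The merge opens with the mirror mask instead of sorting the halves in opposite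
  directions. Thus all comparators point the same way, as the infinite keys of missing wires
  require.\<close>

primrec sort_masks :: "nat \<Rightarrow> nat list" where
  "sort_masks 0 = []"
| "sort_masks (Suc q) = sort_masks q @ (2 ^ Suc q - 1) # clean_masks q"

definition sort_stages :: "('a \<Rightarrow> 'b::linorder) \<Rightarrow> nat \<Rightarrow> (nat \<times> (nat \<Rightarrow> 'a \<Rightarrow> 'a \<Rightarrow> 'a)) list" where
  "sort_stages k q = map (\<lambda>\<mu>. (\<mu>, compare_exchange k \<mu>)) (sort_masks q)"

lemma length_clean_masks [simp]: "length (clean_masks q) = q"
  by (induction q) auto

lemma length_sort_masks: "length (sort_masks q) \<le> q ^ 2"
  by (induction q) (auto simp: power2_eq_square)

section \<open>Bitonic boolean sequences and the half-cleaner\<close>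

definition bool_stage :: "nat \<Rightarrow> (nat \<Rightarrow> bool) \<Rightarrow> nat \<Rightarrow> bool" where
  "bool_stage \<mu> f p = (if p < xor p \<mu> then f p \<and> f (xor p \<mu>) else f p \<or> f (xor p \<mu>))"

text \<open>The true positions form an interval or the complement of one: the 0-1 sequences that are
  bitonic up to rotation. The choice \<open>v \<le> u\<close> yields the constant ones.\<close>

definition bitonic :: "nat \<Rightarrow> (nat \<Rightarrow> bool) \<Rightarrow> bool" where
  "bitonic N f \<longleftrightarrow> (\<exists>u v. (\<forall>i<N. f i = (u \<le> i \<and> i < v)) \<or> (\<forall>i<N. f i = (\<not> (u \<le> i \<and> i < v))))"

text \<open>Shift the upper half onto the lower one. The conjunction is the interval from
  \<open>u\<close> to \<open>v - h\<close>. If it is nonempty, then \<open>v \<le> 2 * h\<close>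
  forces \<open>u < h\<close>, and the two pieces together cover the half.\<close>

lemma half_clean_interval:
  assumes "\<forall>i<2*h. f i = (u \<le> i \<and> i < v)" "v \<le> 2 * h"
  shows "bitonic h (\<lambda>i. f i \<and> f (i + h))" "bitonic h (\<lambda>i. f i \<or> f (i + h))"
    "(\<forall>i<h. \<not> (f i \<and> f (i + h))) \<or> (\<forall>i<h. f i \<or> f (i + h))"
proof -
  have f: "f i = (u \<le> i \<and> i < v)" "f (i + h) = (u \<le> i + h \<and> i + h < v)" if "i < h" for i
    using assms(1) that by auto
  show "bitonic h (\<lambda>i. f i \<and> f (i + h))"
    unfolding bitonic_def
    by (rule exI[of _ u], rule exI[of _ "v - h"], rule disjI1) (use f in auto)
  show "(\<forall>i<h. \<not> (f i \<and> f (i + h))) \<or> (\<forall>i<h. f i \<or> f (i + h))"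
  proof (cases "v - h \<le> u")
    case True
    then have "\<not> (f i \<and> f (i + h))" if "i < h" for i using f[OF that] True by linarith
    then show ?thesis by blast
  next
    case False
    then have "f i \<or> f (i + h)" if "i < h" for i using f[OF that] False that assms(2) by linarith
    then show ?thesis by blast
  qed
  show "bitonic h (\<lambda>i. f i \<or> f (i + h))"
  proof -
    consider "v \<le> h" | "u \<ge> h" | "u < h" "h < v" by linarith
    then show ?thesis
    proof cases
      case 1
      then show ?thesis unfolding bitonic_def
        by (intro exI[of _ u] exI[of _ v] disjI1) (use f in auto)
    next
      case 2
      then show ?thesis unfolding bitonic_def
        by (intro exI[of _ "u - h"] exI[of _ "v - h"] disjI1) (use f in auto)
    next
      case 3
      then have "(f i \<or> f (i + h)) = (\<not> (v - h \<le> i \<and> i < u))" if "i < h" for i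
        using f[OF that] that by linarith
      then show ?thesis unfolding bitonic_def by blast
    qed
  qed
qed

lemma bitonic_not: "bitonic N (\<lambda>i. \<not> f i) \<longleftrightarrow> bitonic N f"
  unfolding bitonic_def by auto

text \<open>An interval is treated directly. For a complement, negate all values, which exchanges
  conjunction and disjunction.\<close>

lemma half_clean:
  assumes "bitonic (2 * h) f"
  shows "bitonic h (\<lambda>i. f i \<and> f (i + h)) \<and> bitonic h (\<lambda>i. f i \<or> f (i + h)) \<and>
    ((\<forall>i<h. \<not> (f i \<and> f (i + h))) \<or> (\<forall>i<h. f i \<or> f (i + h)))"
proof -
  obtain u v where "(\<forall>i<2*h. f i = (u \<le> i \<and> i < v)) \<or> (\<forall>i<2*h. f i = (\<not> (u \<le> i \<and> i < v)))"
    using assms unfolding bitonic_def by auto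
  then have "(\<forall>i<2*h. f i = (u \<le> i \<and> i < min v (2 * h))) \<or>
      (\<forall>i<2*h. f i = (\<not> (u \<le> i \<and> i < min v (2 * h))))"
    by auto
  then show ?thesis
  proof
    assume "\<forall>i<2*h. f i = (u \<le> i \<and> i < min v (2 * h))"
    from half_clean_interval[OF this] show ?thesis by simp
  next
    assume "\<forall>i<2*h. f i = (\<not> (u \<le> i \<and> i < min v (2 * h)))"
    then have "\<forall>i<2*h. (\<not> f i) = (u \<le> i \<and> i < min v (2 * h))" by auto
    note * = half_clean_interval[OF this min.cobounded2]
    show ?thesis
      using *(1,2)[folded de_Morgan_disj de_Morgan_conj, unfolded bitonic_not] *(3) by blast
  qed
qed

lemma bool_stage_toggle:
  assumes "i < 2 ^ b"
  shows "bool_stage (2 ^ b) f (2 * s * 2 ^ b + i) =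
      (f (s * 2 ^ Suc b + i) \<and> f (s * 2 ^ Suc b + (i + 2 ^ b)))"
    and "bool_stage (2 ^ b) f ((2 * s + 1) * 2 ^ b + i) =
      (f (s * 2 ^ Suc b + i) \<or> f (s * 2 ^ Suc b + (i + 2 ^ b)))"
  using xor_toggle_block[OF assms, of s]
  by (auto simp: bool_stage_def algebra_simps)

text \<open>Invariant of a cascade of half-cleaners: blocks of size \<open>2 ^ b\<close> are still
  only bitonic, but they are already in order relative to each other inside a block of size
  \<open>2 ^ q\<close>. For \<open>b = 0\<close> this is sortedness.\<close>

definition clean_inv :: "nat \<Rightarrow> nat \<Rightarrow> (nat \<Rightarrow> bool) \<Rightarrow> bool" where
  "clean_inv q b f \<longleftrightarrow> (\<forall>s. bitonic (2 ^ b) (\<lambda>i. f (s * 2 ^ b + i))) \<and>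
    (\<forall>p p'. p div 2 ^ q = p' div 2 ^ q \<and> p div 2 ^ b < p' div 2 ^ b \<longrightarrow> f p \<longrightarrow> f p')"

lemma block_half_cases:
  fixes p :: nat
  obtains i where "i < 2 ^ b" "p = 2 * (p div 2 ^ Suc b) * 2 ^ b + i" "p div 2 ^ b = 2 * (p div 2 ^ Suc b)"
  | i where "i < 2 ^ b" "p = (2 * (p div 2 ^ Suc b) + 1) * 2 ^ b + i"
      "p div 2 ^ b = 2 * (p div 2 ^ Suc b) + 1"
proof -
  have d: "p div 2 ^ Suc b = p div 2 ^ b div 2"
    by (simp add: div_mult2_eq[symmetric] mult.commute)
  have p: "p = (p div 2 ^ b) * 2 ^ b + p mod 2 ^ b" "p mod 2 ^ b < 2 ^ b"
    by (metis div_mult_mod_eq) simp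
  show ?thesis
  proof (cases "even (p div 2 ^ b)")
    case True
    then have "p div 2 ^ b = 2 * (p div 2 ^ Suc b)" using d by auto
    with p that(1) show ?thesis by metis
  next
    case False
    then have "p div 2 ^ b = 2 * (p div 2 ^ Suc b) + 1" using d by auto
    with p that(2) show ?thesis by metis
  qed
qed

text \<open>Wires of different old blocks stay ordered, since each new value is formed from two
  values of one old block. Inside an old block the half-cleaner makes the lower half all false or
  the upper half all true.\<close>

lemma clean_inv_step:
  assumes inv: "clean_inv q (Suc b) f" and bq: "Suc b \<le> q"
  shows "clean_inv q b (bool_stage (2 ^ b) f)"
  unfolding clean_inv_def
proof (intro conjI allI impI)
  let ?g = "bool_stage (2 ^ b) f"
  have hc: "bitonic (2 ^ b) (\<lambda>i. f (s * 2 ^ Suc b + i) \<and> f (s * 2 ^ Suc b + (i + 2 ^ b))) \<and>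
     bitonic (2 ^ b) (\<lambda>i. f (s * 2 ^ Suc b + i) \<or> f (s * 2 ^ Suc b + (i + 2 ^ b))) \<and>
    ((\<forall>i<2^b. \<not> (f (s * 2 ^ Suc b + i) \<and> f (s * 2 ^ Suc b + (i + 2 ^ b)))) \<or>
     (\<forall>i<2^b. f (s * 2 ^ Suc b + i) \<or> f (s * 2 ^ Suc b + (i + 2 ^ b))))" for s
    using inv half_clean[of "2 ^ b" "\<lambda>i. f (s * 2 ^ Suc b + i)"] unfolding clean_inv_def
    by simp
  have bit_cong: "bitonic N f' = bitonic N g'" if "\<And>i. i < N \<Longrightarrow> f' i = g' i" for N f' g'
    using that by (simp add: bitonic_def)
  show "bitonic (2 ^ b) (\<lambda>i. ?g (s * 2 ^ b + i))" for s
  proof (cases "even s")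
    case True
    then obtain s' where s: "s = 2 * s'" by blast
    show ?thesis unfolding s
      by (subst bit_cong[OF bool_stage_toggle(1)]) (use hc[of s'] in auto)
  next
    case False
    then obtain s' where s: "s = 2 * s' + 1" using oddE by blast
    show ?thesis unfolding s
      by (subst bit_cong[OF bool_stage_toggle(2)]) (use hc[of s'] in auto)
  qed
  fix p p'
  assume pp: "p div 2 ^ q = p' div 2 ^ q \<and> p div 2 ^ b < p' div 2 ^ b" and gp: "?g p"
  show "?g p'"
  proof (cases "p div 2 ^ Suc b < p' div 2 ^ Suc b")
    case True
    from gp obtain r where r: "r = p \<or> r = xor p (2 ^ b)" "f r"
      by (auto simp: bool_stage_def split: if_splits)
    have "f r'" if "r' = p' \<or> r' = xor p' (2 ^ b)" for r'
    proof -
      have "r div 2 ^ q = r' div 2 ^ q \<and> r div 2 ^ Suc b < r' div 2 ^ Suc b"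
        using r(1) that True pp bq xor_toggle_div[of b "Suc b"] xor_toggle_div[of b q] by auto
      then show ?thesis using inv r(2) unfolding clean_inv_def by blast
    qed
    then show ?thesis by (auto simp: bool_stage_def)
  next
    case False
    have d: "r div 2 ^ Suc b = r div 2 ^ b div 2" for r :: nat
      by (simp add: div_mult2_eq[symmetric] mult.commute)
    have "p div 2 ^ b div 2 \<le> p' div 2 ^ b div 2" using pp by (auto intro: div_le_mono)
    with False have e: "p div 2 ^ Suc b = p' div 2 ^ Suc b" unfolding d by linarith
    define s where "s = p div 2 ^ Suc b"
    from block_half_cases[of b p] obtain i where i: "i < 2 ^ b" "p = 2 * s * 2 ^ b + i"
      using pp block_half_cases[of b p'] e unfolding s_def
      by (metis less_irrefl less_add_one not_less_iff_gr_or_eq)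
    from block_half_cases[of b p'] obtain i' where i': "i' < 2 ^ b" "p' = (2 * s + 1) * 2 ^ b + i'"
      using pp block_half_cases[of b p] e unfolding s_def
      by (metis less_irrefl less_add_one not_less_iff_gr_or_eq)
    show ?thesis
      using gp hc[of s] i i' bool_stage_toggle[OF i(1), of f s] bool_stage_toggle[OF i'(1), of f s]
      by auto
  qed
qed

lemma clean_inv_0: "clean_inv q 0 f \<longleftrightarrow>
    (\<forall>p p'. p div 2 ^ q = p' div 2 ^ q \<and> p < p' \<longrightarrow> f p \<longrightarrow> f p')"
  by (auto simp: clean_inv_def bitonic_def intro: exI[of _ 0] exI[of _ 1])

lemma clean_masks_sort:
  assumes "clean_inv q b f" "b \<le> q"
  shows "clean_inv q 0 (fold bool_stage (clean_masks b) f)"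
  using assms by (induction b arbitrary: f) (auto intro: clean_inv_step)

lemma sorted_threshold:
  fixes f :: "nat \<Rightarrow> bool"
  assumes "\<forall>i j. i < j \<and> j < N \<longrightarrow> f i \<longrightarrow> f j"
  obtains a where "\<forall>i<N. f i = (a \<le> i)" "a \<le> N"
proof (cases "\<exists>i<N. f i")
  case True
  define a where "a = (LEAST i. f i)"
  have "f a" "\<And>i. f i \<Longrightarrow> a \<le> i"
    using True LeastI[of f] Least_le[of f] unfolding a_def by blast+
  moreover obtain i where "i < N" "f i" using True by blast
  ultimately show ?thesis using that[of a] assms
    by (metis le_neq_implies_less less_or_eq_imp_le order.strict_trans1)
next
  case False
  then show ?thesis using that[of N] by auto
qed

text \<open>Let \<open>a\<close> and \<open>c\<close> be the thresholds of the two sorted halves of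
  length \<open>?h\<close>. Comparing mirror images leaves the interval from \<open>a\<close> to
  \<open>?h - c\<close> below and the complement of the interval from \<open>?h - a\<close> to
  \<open>c\<close> above. If the first interval is nonempty, the second is empty.\<close>

lemma flip_clean_inv:
  assumes inv: "clean_inv q 0 f"
  shows "clean_inv (Suc q) q (bool_stage (2 ^ Suc q - 1) f)"
proof -
  let ?g = "bool_stage (2 ^ Suc q - 1) f"
  let ?h = "2 ^ q :: nat"
  have f_cong: "bitonic N f' = bitonic N g'" if "\<And>i. i < N \<Longrightarrow> f' i = g' i" for N f' g'
    using that by (simp add: bitonic_def)
  have main: "\<exists>a c. (\<forall>i<?h. ?g (2 * s * ?h + i) = (a \<le> i \<and> i < ?h - c)) \<and>
      (\<forall>i<?h. ?g ((2 * s + 1) * ?h + i) = (\<not> (?h - a \<le> i \<and> i < c))) \<and> a \<le> ?h \<and> c \<le> ?h" for s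
  proof -
    have srt: "\<forall>i j. i < j \<and> j < ?h \<longrightarrow> f (r * ?h + i) \<longrightarrow> f (r * ?h + j)" for r
    proof (intro allI impI)
      fix i j assume "i < j \<and> j < ?h" "f (r * ?h + i)"
      moreover have "(r * ?h + i) div ?h = (r * ?h + j) div ?h" using calculation by simp
      ultimately show "f (r * ?h + j)" using inv unfolding clean_inv_0 by (meson nat_add_left_cancel_less)
    qed
    obtain a where a: "\<forall>i<?h. f (2 * s * ?h + i) = (a \<le> i)" "a \<le> ?h"
      using sorted_threshold[OF srt] by metis
    obtain c where c: "\<forall>i<?h. f ((2 * s + 1) * ?h + i) = (c \<le> i)" "c \<le> ?h"
      using sorted_threshold[OF srt] by metis
    have x1: "xor (2 * s * ?h + i) (2 ^ Suc q - 1) = (2 * s + 1) * ?h + (?h - 1 - i)" if "i < ?h" for i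
    proof -
      have "xor (s * 2 ^ Suc q + i) (2 ^ Suc q - 1) = s * 2 ^ Suc q + (2 ^ Suc q - 1 - i)"
        using that by (subst xor_block) (auto simp: xor_flip[of i "Suc q", simplified])
      then show ?thesis using that by (simp add: algebra_simps)
    qed
    have x2: "xor ((2 * s + 1) * ?h + i) (2 ^ Suc q - 1) = 2 * s * ?h + (?h - 1 - i)" if "i < ?h" for i
    proof -
      have "xor (2 * s * ?h + (?h - 1 - i)) (2 ^ Suc q - 1) = (2 * s + 1) * ?h + i"
        using x1[of "?h - 1 - i"] that by simp
      from arg_cong[OF this, of "\<lambda>p. xor p (2 ^ Suc q - 1)"] show ?thesis by simp
    qed
    have g1: "?g (2 * s * ?h + i) = (a \<le> i \<and> i < ?h - c)" if "i < ?h" for i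
    proof -
      have "2 * s * ?h + i < (2 * s + 1) * ?h + (?h - 1 - i)" using that by (simp add: algebra_simps)
      moreover have "?h - 1 - i < ?h" using that by auto
      moreover have "f (2 * s * ?h + i) = (a \<le> i)"
        "f ((2 * s + 1) * ?h + (?h - 1 - i)) = (c \<le> ?h - 1 - i)"
        using a(1) c(1) that calculation(2) by blast+
      moreover have "c \<le> ?h - 1 - i \<longleftrightarrow> i < ?h - c" using that by linarith
      ultimately show ?thesis
        unfolding bool_stage_def x1[OF that] by (simp only: if_True)
    qed
    have g2: "?g ((2 * s + 1) * ?h + i) = (\<not> (?h - a \<le> i \<and> i < c))" if "i < ?h" for i
    proof -
      have "\<not> ((2 * s + 1) * ?h + i < 2 * s * ?h + (?h - 1 - i))" using that by (simp add: algebra_simps)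
      moreover have "?h - 1 - i < ?h" using that by auto
      moreover have "f ((2 * s + 1) * ?h + i) = (c \<le> i)"
        "f (2 * s * ?h + (?h - 1 - i)) = (a \<le> ?h - 1 - i)"
        using a(1) c(1) that calculation(2) by blast+
      moreover have "a \<le> ?h - 1 - i \<longleftrightarrow> i < ?h - a" using that a(2) by linarith
      ultimately show ?thesis
        unfolding bool_stage_def x2[OF that] by (auto simp only: if_False)
    qed
    show ?thesis
      using g1 g2 a(2) c(2) by blast
  qed
  show ?thesis
    unfolding clean_inv_def
  proof (intro conjI allI impI)
    fix s :: nat
    obtain s' where "s = 2 * s' \<or> s = 2 * s' + 1" by (metis oddE evenE)
    then show "bitonic ?h (\<lambda>i. ?g (s * ?h + i))"
      using main[of s'] unfolding bitonic_def by blast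
  next
    fix p p'
    assume pp: "p div 2 ^ Suc q = p' div 2 ^ Suc q \<and> p div ?h < p' div ?h" and gp: "?g p"
    define s where "s = p div 2 ^ Suc q"
    have e: "s = p' div 2 ^ Suc q" using pp s_def by simp
    from block_half_cases[of q p] obtain i where i: "i < ?h" "p = 2 * s * ?h + i"
      using pp block_half_cases[of q p'] e unfolding s_def
      by (metis less_irrefl less_add_one not_less_iff_gr_or_eq)
    from block_half_cases[of q p'] obtain i' where i': "i' < ?h" "p' = (2 * s + 1) * ?h + i'"
      using pp block_half_cases[of q p] e unfolding s_def
      by (metis less_irrefl less_add_one not_less_iff_gr_or_eq)
    obtain a c where ac: "\<forall>i<?h. ?g (2 * s * ?h + i) = (a \<le> i \<and> i < ?h - c)"
      "\<forall>i<?h. ?g ((2 * s + 1) * ?h + i) = (\<not> (?h - a \<le> i \<and> i < c))" "a \<le> ?h" "c \<le> ?h"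
      using main[of s] by blast
    have "a \<le> i" "i < ?h - c" using gp ac(1) i by auto
    then show "?g p'" using ac(2) i' by auto
  qed
qed

lemma sort_masks_sort: "clean_inv q 0 (fold bool_stage (sort_masks q) f)"
proof (induction q arbitrary: f)
  case 0
  then show ?case by (auto simp: clean_inv_0)
next
  case (Suc q)
  show ?case
    using clean_masks_sort[OF flip_clean_inv[OF Suc], of f] by simp
qed

text \<open>The 0-1 principle: thresholding the keys turns the comparators into boolean ones.\<close>

lemma threshold_compare_exchange:
  "(\<lambda>p. p < W \<longrightarrow> \<tau> \<le> k (stage W \<mu> (compare_exchange k \<mu>) f p)) =
    bool_stage \<mu> (\<lambda>p. p < W \<longrightarrow> \<tau> \<le> k (f p))"
  by (rule ext) (auto simp: bool_stage_def stage_def compare_exchange_def)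

lemma threshold_sort:
  "(\<lambda>p. p < W \<longrightarrow> \<tau> \<le> k (run_stages W (map (\<lambda>\<mu>. (\<mu>, compare_exchange k \<mu>)) ms) f p)) =
    fold bool_stage ms (\<lambda>p. p < W \<longrightarrow> \<tau> \<le> k (f p))"
  by (induction ms arbitrary: f) (simp_all add: threshold_compare_exchange)

text \<open>Take the key that ends on wire \<open>p\<close> as the threshold: the boolean network
  has a true value at \<open>p\<close>, hence at every later wire.\<close>

lemma sort_stages_mono:
  assumes "W \<le> 2 ^ q" "p \<le> p'" "p' < W"
  shows "k (run_stages W (sort_stages k q) f p) \<le> k (run_stages W (sort_stages k q) f p')"
proof (cases "p = p'")
  case False
  let ?g = "run_stages W (sort_stages k q) f"
  have "clean_inv q 0 (\<lambda>r. r < W \<longrightarrow> k (?g p) \<le> k (?g r))"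
    using sort_masks_sort unfolding sort_stages_def threshold_sort by blast
  moreover have "p div 2 ^ q = p' div 2 ^ q"
    using assms by simp
  ultimately show ?thesis
    using assms False unfolding clean_inv_0 by (metis le_neq_implies_less order_refl)
qed simp

text \<open>The decision \<open>sw\<close> to swap is strict and common to both partners, so the
  swaps form an involution.\<close>

lemma stage_compare_exchange_perm:
  "\<exists>\<sigma>. bij_betw \<sigma> {..<W} {..<W} \<and> (\<forall>p<W. stage W \<mu> (compare_exchange k \<mu>) f p = f (\<sigma> p))"
proof -
  define sw where "sw p \<longleftrightarrow> xor p \<mu> < W \<and>
    (if p < xor p \<mu> then \<not> k (f p) \<le> k (f (xor p \<mu>)) else \<not> k (f (xor p \<mu>)) \<le> k (f p))" for p
  define \<sigma> where "\<sigma> p = (if sw p then xor p \<mu> else p)" for p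
  have "sw (xor p \<mu>)" if "sw p" "p < W" for p
    using that by (auto simp: sw_def split: if_splits)
  then have "\<sigma> (\<sigma> p) = p" if "p < W" for p
    using that by (auto simp: \<sigma>_def)
  moreover have "\<sigma> p < W" if "p < W" for p
    using that by (auto simp: \<sigma>_def sw_def)
  ultimately have "bij_betw \<sigma> {..<W} {..<W}"
    by (intro bij_betw_byWitness[where f' = \<sigma>]) auto
  moreover have "stage W \<mu> (compare_exchange k \<mu>) f p = f (\<sigma> p)" if "p < W" for p
    by (auto simp: \<sigma>_def sw_def stage_def compare_exchange_def)
  ultimately show ?thesis by blast
qed

lemma sort_stages_perm:
  "\<exists>\<sigma>. bij_betw \<sigma> {..<W} {..<W} \<and> (\<forall>p<W. run_stages W (sort_stages k q) f p = f (\<sigma> p))"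
proof -
  have "\<exists>\<sigma>. bij_betw \<sigma> {..<W} {..<W} \<and>
      (\<forall>p<W. run_stages W (map (\<lambda>\<mu>. (\<mu>, compare_exchange k \<mu>)) ms) f p = f (\<sigma> p))" for ms
  proof (induction ms arbitrary: f)
    case Nil
    show ?case by (rule exI[of _ id]) (simp add: bij_betw_id[unfolded id_def])
  next
    case (Cons \<mu> ms)
    obtain \<sigma> where \<sigma>: "bij_betw \<sigma> {..<W} {..<W}"
      "\<forall>p<W. stage W \<mu> (compare_exchange k \<mu>) f p = f (\<sigma> p)"
      using stage_compare_exchange_perm by metis
    obtain \<tau> where \<tau>: "bij_betw \<tau> {..<W} {..<W}"
      "\<forall>p<W. run_stages W (map (\<lambda>\<mu>. (\<mu>, compare_exchange k \<mu>)) ms)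
        (stage W \<mu> (compare_exchange k \<mu>) f) p = stage W \<mu> (compare_exchange k \<mu>) f (\<tau> p)"
      using Cons by blast
    have "\<tau> p < W" if "p < W" for p
      using \<tau>(1) that by (auto simp: bij_betw_def)
    then show ?case
      using \<sigma> \<tau> by (intro exI[of _ "\<sigma> \<circ> \<tau>"]) (auto simp: bij_betw_trans[unfolded o_def])
  qed
  then show ?thesis unfolding sort_stages_def by blast
qed

section \<open>Ranks and positions after sorting\<close>

definition rank_of :: "nat \<Rightarrow> (nat \<Rightarrow> 'b::linorder) \<Rightarrow> nat \<Rightarrow> nat" where
  "rank_of W key x = card {y \<in> {..<W}. key y < key x}"

lemma rank_of_less: "x < W \<Longrightarrow> rank_of W key x < W"
  unfolding rank_of_def
  by (rule less_le_trans[OF psubset_card_mono[of "{..<W}"]]) auto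

lemma rank_of_mono:
  assumes "x < W" "y < W"
  shows "rank_of W key y < rank_of W key x \<longleftrightarrow> key y < key x"
    and "rank_of W key y \<le> rank_of W key x \<longleftrightarrow> key y \<le> key x"
proof -
  have l: "rank_of W key y < rank_of W key x" if "key y < key x" "x < W" "y < W" for x y
    unfolding rank_of_def by (rule psubset_card_mono) (use that in auto)
  have e: "rank_of W key y = rank_of W key x" if "key y = key x" for x y
    unfolding rank_of_def that ..
  show "rank_of W key y < rank_of W key x \<longleftrightarrow> key y < key x"
    using l[of y x] l[of x y] e[of x y] assms by (metis less_asym neqE order.irrefl)
  show "rank_of W key y \<le> rank_of W key x \<longleftrightarrow> key y \<le> key x"
    using l[of y x] l[of x y] e[of x y] assms by (metis less_asym neqE order.irrefl not_le less_imp_le order_refl)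
qed

text \<open>The network realises some permutation into nondecreasing order. With distinct keys the
  items in front of \<open>f x\<close> are exactly those with smaller keys.\<close>

lemma sort_stages_rank:
  assumes W: "W \<le> 2 ^ q" and inj: "inj_on (\<lambda>x. k (f x)) {..<W}" and x: "x < W"
  shows "run_stages W (sort_stages k q) f (rank_of W (\<lambda>x. k (f x)) x) = f x"
proof -
  let ?g = "run_stages W (sort_stages k q) f"
  obtain \<sigma> where \<sigma>: "bij_betw \<sigma> {..<W} {..<W}" "\<And>p. p < W \<Longrightarrow> ?g p = f (\<sigma> p)"
    using sort_stages_perm by metis
  obtain p where p: "p < W" "\<sigma> p = x"
    using \<sigma>(1) x unfolding bij_betw_def by (metis imageE lessThan_iff)
  have le: "k (f (\<sigma> i)) \<le> k (f (\<sigma> j)) \<longleftrightarrow> i \<le> j" if "i < W" "j < W" for i j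
  proof
    show "i \<le> j \<Longrightarrow> k (f (\<sigma> i)) \<le> k (f (\<sigma> j))"
      using sort_stages_mono[OF W, of i j k f] \<sigma>(2) that by simp
    show "i \<le> j" if *: "k (f (\<sigma> i)) \<le> k (f (\<sigma> j))"
    proof (rule ccontr)
      assume "\<not> i \<le> j"
      then have "k (f (\<sigma> j)) = k (f (\<sigma> i))"
        using * sort_stages_mono[OF W, of j i k f] \<sigma>(2) \<open>i < W\<close> \<open>j < W\<close> by (simp add: antisym)
      moreover have "\<sigma> i < W" "\<sigma> j < W"
        using \<sigma>(1) \<open>i < W\<close> \<open>j < W\<close> by (auto simp: bij_betw_def)
      ultimately have "\<sigma> j = \<sigma> i"
        using inj by (auto dest: inj_onD)
      then have "j = i"
        using inj_onD[OF bij_betw_imp_inj_on[OF \<sigma>(1)], of j i] \<open>i < W\<close> \<open>j < W\<close> by simp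
      then show False
        using \<open>\<not> i \<le> j\<close> by simp
    qed
  qed
  have "{y \<in> {..<W}. k (f y) < k (f x)} = \<sigma> ` {..<p}"
  proof (intro equalityI subsetI)
    fix y assume y: "y \<in> {y \<in> {..<W}. k (f y) < k (f x)}"
    then obtain i where "i < W" "\<sigma> i = y"
      using \<sigma>(1) unfolding bij_betw_def by (metis (no_types, lifting) imageE lessThan_iff mem_Collect_eq)
    then show "y \<in> \<sigma> ` {..<p}"
      using y le[of p i] p by (auto simp: not_le[symmetric])
  next
    fix y assume "y \<in> \<sigma> ` {..<p}"
    then obtain i where "i < p" "y = \<sigma> i" by auto
    then show "y \<in> {y \<in> {..<W}. k (f y) < k (f x)}"
      using p le[of p i] \<sigma>(1) by (auto simp: not_le[symmetric] bij_betw_def)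
  qed
  moreover have "inj_on \<sigma> {..<p}"
    using \<sigma>(1) p(1) by (auto simp: bij_betw_def intro: inj_on_subset)
  ultimately have "rank_of W (\<lambda>x. k (f x)) x = p"
    unfolding rank_of_def by (simp add: card_image)
  then show ?thesis using \<sigma>(2) p by simp
qed

text \<open>An item consists of its sorting key, its home wire, and two fields that hold the maxima over the
  block of a wire and over the part of the block up to the wire during a scan.\<close>

type_synonym item = "nat \<times> nat \<times> nat \<times> nat"

text \<open>If the partner is lower, its whole block precedes that of \<open>p\<close>, so its block
  maximum enters the prefix.\<close>

fun scan_step :: "nat \<Rightarrow> nat \<Rightarrow> item \<Rightarrow> item \<Rightarrow> item" where
  "scan_step \<mu> p (k, h, a, c) (k', h', a', c') = (k, h, max a a', if xor p \<mu> < p then max c a' else c)"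

definition scan_stages :: "nat \<Rightarrow> (nat \<times> (nat \<Rightarrow> item \<Rightarrow> item \<Rightarrow> item)) list" where
  "scan_stages q = map (\<lambda>b. (2 ^ b, scan_step (2 ^ b))) [0..<q]"

lemma finite_block: "finite {y :: nat. y div 2 ^ b = s}"
proof (rule finite_subset)
  show "{y. y div 2 ^ b = s} \<subseteq> {..s * 2 ^ b + 2 ^ b}"
  proof
    fix y assume y: "y \<in> {y :: nat. y div 2 ^ b = s}"
    have "y = y div 2 ^ b * 2 ^ b + y mod 2 ^ b" "y mod 2 ^ b < 2 ^ b"
      by (metis div_mult_mod_eq) simp
    then show "y \<in> {..s * 2 ^ b + 2 ^ b}" using y unfolding atMost_iff mem_Collect_eq by (metis nat_add_left_cancel_le less_imp_le)
  qed
qed simp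

text \<open>A wire whose partner is missing does not learn the maximum of the joined block, so that
  maximum is claimed for complete blocks only. The prefix needs only blocks that lie below
  \<open>p\<close>, and these are complete because \<open>p < W\<close>.\<close>

lemma scan_stages_prefix:
  assumes f: "\<And>p. p < W \<Longrightarrow> f p = (k p, h p, v p, v p)" and p: "p < W"
  shows "\<exists>T. run_stages W (scan_stages b) f p =
      (k p, h p, T, Max (v ` {y. y \<le> p \<and> y div 2 ^ b = p div 2 ^ b})) \<and>
    ({y. y div 2 ^ b = p div 2 ^ b} \<subseteq> {..<W} \<longrightarrow> T = Max (v ` {y. y div 2 ^ b = p div 2 ^ b}))"
  using p
proof (induction b arbitrary: p)
  case 0
  have "{y. y \<le> p \<and> y = p} = {p}" "{y. y = p} = {p}" by auto
  then show ?case using f[OF 0] by (simp add: scan_stages_def)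
next
  case (Suc b)
  let ?g = "run_stages W (scan_stages b) f"
  let ?B = "\<lambda>b p. {y :: nat. y div 2 ^ b = p div 2 ^ b}"
  let ?P = "\<lambda>b p. {y :: nat. y \<le> p \<and> y div 2 ^ b = p div 2 ^ b}"
  let ?p' = "xor p (2 ^ b)"
  have run: "run_stages W (scan_stages (Suc b)) f p = stage W (2 ^ b) (scan_step (2 ^ b)) ?g p"
    by (simp add: scan_stages_def)
  obtain T where T: "?g p = (k p, h p, T, Max (v ` ?P b p))" "?B b p \<subseteq> {..<W} \<longrightarrow> T = Max (v ` ?B b p)"
    using Suc by blast
  have d: "y div 2 ^ Suc b = y div 2 ^ b div 2" for y :: nat
    by (simp add: div_mult2_eq[symmetric] mult.commute)
  have fin: "finite (?B b r)" "finite (?P b r)" "?B b r \<noteq> {}" "?P b r \<noteq> {}" for r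
    using finite_block[of b] by (auto intro: finite_subset[of "?P b r" "{..r}"])
  have nb: "?p' div 2 ^ b \<noteq> p div 2 ^ b \<and> ?p' div 2 ^ b div 2 = p div 2 ^ b div 2"
  proof -
    have dm: "(s * 2 ^ b + i) div 2 ^ b = s" if "i < 2 ^ b" for s i :: nat
      using that by simp
    define s where "s = p div 2 ^ Suc b"
    show ?thesis
    proof (cases p rule: block_half_cases[of b])
      case (1 i)
      then have "p = 2 * s * 2 ^ b + i" "?p' = (2 * s + 1) * 2 ^ b + i"
        using xor_toggle_block(1)[of i b s] unfolding s_def by metis+
      then show ?thesis using dm[OF 1(1), of "2 * s"] dm[OF 1(1), of "2 * s + 1"] by simp
    next
      case (2 i)
      then have "p = (2 * s + 1) * 2 ^ b + i" "?p' = 2 * s * 2 ^ b + i"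
        using xor_toggle_block(2)[of i b s] unfolding s_def by metis+
      then show ?thesis using dm[OF 2(1), of "2 * s"] dm[OF 2(1), of "2 * s + 1"] by simp
    qed
  qed
  have lt: "?p' < p \<longleftrightarrow> ?p' div 2 ^ b < p div 2 ^ b"
    using nb div_le_mono[of ?p' p "2 ^ b"] div_le_mono[of p ?p' "2 ^ b"] by linarith
  have two: "a div 2 = e div 2 \<longleftrightarrow> a = e \<or> a = e'" if "e' \<noteq> e \<and> e' div 2 = e div 2" for a e e' :: nat
    using that by linarith
  have BU: "?B (Suc b) p = ?B b p \<union> ?B b ?p'"
    unfolding d using two[OF nb] by blast
  have Pnew: "?P (Suc b) p = ?P b p \<union> (?B b ?p' \<inter> {..p})"
    unfolding d using two[OF nb] by blast
  have side: "if ?p' < p then y < p else p < y" if "y \<in> ?B b ?p'" for y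
  proof -
    have e: "y div 2 ^ b = ?p' div 2 ^ b" using that by simp
    show ?thesis
    proof (cases "?p' < p")
      case True
      then have "y div 2 ^ b < p div 2 ^ b" using lt e by simp
      then have "\<not> p \<le> y" using div_le_mono[of p y "2 ^ b"] by linarith
      then show ?thesis using True by simp
    next
      case False
      then have "p div 2 ^ b < y div 2 ^ b" using lt e nb by linarith
      then have "\<not> y \<le> p" using div_le_mono[of y p "2 ^ b"] by linarith
      then show ?thesis using False by simp
    qed
  qed
  show ?case
  proof (cases "?p' < W")
    case True
    then obtain T' where T': "?g ?p' = (k ?p', h ?p', T', Max (v ` ?P b ?p'))"
      "?B b ?p' \<subseteq> {..<W} \<longrightarrow> T' = Max (v ` ?B b ?p')"
      using Suc.IH by blast
    have st: "run_stages W (scan_stages (Suc b)) f p =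
      (k p, h p, max T T', if ?p' < p then max (Max (v ` ?P b p)) T' else Max (v ` ?P b p))"
      unfolding run stage_def using True T(1) T'(1) by simp
    have tot: "max T T' = Max (v ` ?B (Suc b) p)" if "?B (Suc b) p \<subseteq> {..<W}"
      using that T(2) T'(2) fin unfolding BU by (simp add: image_Un Max_Un)
    show ?thesis
    proof (cases "?p' < p")
      case True
      have below: "?B b ?p' \<subseteq> {..<p}" using side True by auto
      then have "?B b ?p' \<subseteq> {..<W}" using Suc.prems by fastforce
      moreover have "?P (Suc b) p = ?P b p \<union> ?B b ?p'"
        unfolding Pnew using below by fastforce
      ultimately have "Max (v ` ?P (Suc b) p) = max (Max (v ` ?P b p)) T'"
        using T'(2) fin by (simp add: image_Un Max_Un)
      then show ?thesis using st tot True by simp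
    next
      case False
      have "?P (Suc b) p = ?P b p"
        unfolding Pnew using side False by fastforce
      then show ?thesis using st tot False by simp
    qed
  next
    case False
    then have st: "run_stages W (scan_stages (Suc b)) f p = (k p, h p, T, Max (v ` ?P b p))"
      unfolding run stage_def using T(1) by simp
    have "p < ?p'" using False Suc.prems by simp
    then have "?P (Suc b) p = ?P b p"
      unfolding Pnew using side by fastforce
    moreover have "\<not> ?B (Suc b) p \<subseteq> {..<W}"
      using BU False by auto
    ultimately show ?thesis using st by simp
  qed
qed

text \<open>Mask 0 makes every wire its own partner and thus turns a local rewriting into a stage.
  It is applied after the sort, so \<open>p\<close> is the rank of the item.\<close>

fun set_value :: "(nat \<Rightarrow> nat \<Rightarrow> nat) \<Rightarrow> nat \<Rightarrow> item \<Rightarrow> item \<Rightarrow> item" where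
  "set_value F p (k, h, a, c) _ = (k, h, F p a, F p a)"

fun head_home :: "nat \<Rightarrow> item \<Rightarrow> item \<Rightarrow> item" where
  "head_home p (k, h, a, c) _ = (h, h, p, c)"

text \<open>After \<open>head_home\<close> the key is the home wire; the second sort therefore
  returns each item, now carrying its rank and its prefix maximum.\<close>

definition op_stages :: "nat \<Rightarrow> (nat \<Rightarrow> nat \<Rightarrow> nat) \<Rightarrow> (nat \<times> (nat \<Rightarrow> item \<Rightarrow> item \<Rightarrow> item)) list" where
  "op_stages q F = sort_stages fst q @ [(0, set_value F)] @ scan_stages q @ [(0, head_home)] @
     sort_stages fst q"

lemma length_op_stages: "length (op_stages q F) \<le> 2 * q ^ 2 + q + 2"
  using length_sort_masks[of q] by (simp add: op_stages_def sort_stages_def scan_stages_def)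

lemma rank_of_bij:
  assumes "inj_on key {..<W}"
  shows "bij_betw (rank_of W key) {..<W} {..<W}"
proof -
  have "inj_on (rank_of W key) {..<W}"
  proof (rule inj_onI)
    fix x y assume "x \<in> {..<W}" "y \<in> {..<W}" "rank_of W key x = rank_of W key y"
    then have "key x = key y"
      using rank_of_mono(2)[of x W y key] rank_of_mono(2)[of y W x key] by simp
    then show "x = y" using assms \<open>x \<in> _\<close> \<open>y \<in> _\<close> by (auto dest: inj_onD)
  qed
  moreover have "rank_of W key ` {..<W} \<subseteq> {..<W}"
    by (auto intro: rank_of_less)
  ultimately show ?thesis
    by (simp add: bij_betw_def endo_inj_surj)
qed

text \<open>Between the two sorts wire \<open>p\<close> holds the item of \<open>inv p\<close>. The
  positions up to the rank of \<open>x\<close> are those of the items with keys at most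
  \<open>key x\<close>, so the prefix maximum ranges over exactly these items.\<close>

lemma op_stages_correct:
  assumes W: "W \<le> 2 ^ q" and inj: "inj_on key {..<W}" and x: "x < W"
    and f: "\<And>p. p < W \<Longrightarrow> f p = (key p, p, aux p, c p)"
  shows "run_stages W (op_stages q F) f x =
    (x, x, rank_of W key x, Max ((\<lambda>y. F (rank_of W key y) (aux y)) ` {y \<in> {..<W}. key y \<le> key x}))"
proof -
  let ?rk = "rank_of W key"
  define f1 where "f1 = run_stages W (sort_stages fst q) f"
  have rk_eq: "rank_of W (\<lambda>x. fst (f x)) y = ?rk y" if "y < W" for y
    unfolding rank_of_def using f that by (intro arg_cong[where f = card]) auto
  have f1: "f1 (?rk y) = (key y, y, aux y, c y)" if "y < W" for y
  proof -
    have "inj_on (\<lambda>x. fst (f x)) {..<W}"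
      using inj f by (simp add: inj_on_def)
    from sort_stages_rank[where f = f and k = fst, OF W this that] show ?thesis
      unfolding f1_def using rk_eq[OF that] f[OF that] by simp
  qed
  note bij = rank_of_bij[OF inj]
  define inv where "inv = the_inv_into {..<W} ?rk"
  have inv: "inv p < W" "?rk (inv p) = p" if "p < W" for p
    using bij that unfolding inv_def bij_betw_def
    by (metis lessThan_iff the_inv_into_into order_refl) (metis bij bij_betw_def f_the_inv_into_f lessThan_iff that)
  have inv': "inv (?rk y) = y" if "y < W" for y
    using bij that unfolding inv_def bij_betw_def by (simp add: the_inv_into_f_f)
  define v where "v p = F p (aux (inv p))" for p
  define f2 where "f2 = stage W 0 (set_value F) f1"
  have f2: "f2 p = (key (inv p), inv p, v p, v p)" if "p < W" for p
    using f1[OF inv(1)[OF that]] inv(2)[OF that] that by (simp add: f2_def stage_def v_def)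
  define f3 where "f3 = run_stages W (scan_stages q) f2"
  have f3: "\<exists>T. f3 p = (key (inv p), inv p, T, Max (v ` {..p}))" if "p < W" for p
  proof -
    have "{y. y \<le> p \<and> y div 2 ^ q = p div 2 ^ q} = {..p}"
      using that W by auto
    then show ?thesis
      using scan_stages_prefix[of W f2 "\<lambda>p. key (inv p)" inv v p q, OF f2 that] unfolding f3_def by auto
  qed
  define f4 where "f4 = stage W 0 head_home f3"
  have f4: "f4 p = (inv p, inv p, p, Max (v ` {..p}))" if "p < W" for p
    using f3[OF that] that by (auto simp: f4_def stage_def)
  have res: "run_stages W (op_stages q F) f x = run_stages W (sort_stages fst q) f4 x"
    unfolding op_stages_def f4_def f3_def f2_def f1_def by simp
  have rx: "?rk x < W" using rank_of_less[OF x] .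
  \<comment> \<open>With home wires as keys, the items smaller than that of \<open>x\<close> come
    from the wires below \<open>x\<close>; so the rank of this item is \<open>x\<close>
    itself.\<close>
  have "{y \<in> {..<W}. fst (f4 y) < fst (f4 (?rk x))} = ?rk ` {..<x}"
  proof (intro equalityI subsetI)
    fix y assume y: "y \<in> {y \<in> {..<W}. fst (f4 y) < fst (f4 (?rk x))}"
    then have "inv y < x" using rx inv'[OF x] f4[of y] f4[OF rx] by simp
    then show "y \<in> ?rk ` {..<x}" using y inv(2)[of y] by force
  next
    fix y assume "y \<in> ?rk ` {..<x}"
    then show "y \<in> {y \<in> {..<W}. fst (f4 y) < fst (f4 (?rk x))}"
      using x rx by (auto simp: f4 inv' rank_of_less)
  qed
  moreover have "inj_on ?rk {..<x}"
    using bij x by (auto simp: bij_betw_def intro: inj_on_subset)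
  ultimately have "rank_of W (\<lambda>p. fst (f4 p)) (?rk x) = x"
    unfolding rank_of_def[of W "\<lambda>p. fst (f4 p)"] by (simp add: card_image)
  moreover have "inj_on (\<lambda>p. fst (f4 p)) {..<W}"
    by (rule inj_onI) (metis f4 fst_conv inv(2) lessThan_iff)
  ultimately have "run_stages W (op_stages q F) f x = f4 (?rk x)"
    using sort_stages_rank[OF W, of fst f4 "?rk x"] rx res by simp
  also have "\<dots> = (x, x, ?rk x, Max (v ` {..?rk x}))"
    using f4[OF rx] inv'[OF x] by simp
  also have "v ` {..?rk x} = (\<lambda>y. F (?rk y) (aux y)) ` {y \<in> {..<W}. key y \<le> key x}"
  proof (intro equalityI subsetI)
    fix z assume "z \<in> v ` {..?rk x}"
    then obtain p where p: "p \<le> ?rk x" "z = v p" by auto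
    then have "p < W" using rx by simp
    then have "z = F (?rk (inv p)) (aux (inv p))" "inv p < W" "key (inv p) \<le> key x"
      using inv p x rank_of_mono(2)[OF x, of "inv p" key] by (auto simp: v_def)
    then show "z \<in> (\<lambda>y. F (?rk y) (aux y)) ` {y \<in> {..<W}. key y \<le> key x}" by blast
  next
    fix z assume "z \<in> (\<lambda>y. F (?rk y) (aux y)) ` {y \<in> {..<W}. key y \<le> key x}"
    then obtain y where y: "y < W" "key y \<le> key x" "z = F (?rk y) (aux y)" by auto
    then have "z = v (?rk y)" "?rk y \<le> ?rk x"
      using inv' rank_of_mono(2)[OF x, of y key] by (auto simp: v_def)
    then show "z \<in> v ` {..?rk x}" by blast
  qed
  finally show ?thesis .
qed

definition item_bound :: "nat \<Rightarrow> item \<Rightarrow> bool" where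
  "item_bound X = (\<lambda>(k, h, a, c). k < X \<and> h < X \<and> a < X \<and> c < X)"

text \<open>Items travel in fields of fixed width. Stages only copy fields, take maxima, and insert
  wire numbers or values of \<open>F\<close>.\<close>

lemma op_stages_item_bound:
  assumes "(\<mu>, g) \<in> set (op_stages q F)" "p < W" "item_bound X x" "item_bound X y"
    "W \<le> X" "\<And>p a. p < W \<Longrightarrow> a < X \<Longrightarrow> F p a < X"
  shows "item_bound X (g p x y)"
  using assms
  by (cases x; cases y)
    (auto simp: op_stages_def sort_stages_def scan_stages_def compare_exchange_def item_bound_def split: if_splits)

text \<open>Sorted by group and then by wire, the group of \<open>x\<close> begins at position
  \<open>start_of W g x\<close>, and \<open>x\<close> follows \<open>index_of g x\<close> places
  later.\<close>

definition start_of :: "nat \<Rightarrow> (nat \<Rightarrow> nat) \<Rightarrow> nat \<Rightarrow> nat" where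
  "start_of W g x = card {y \<in> {..<W}. g y < g x}"

definition index_of :: "(nat \<Rightarrow> nat) \<Rightarrow> nat \<Rightarrow> nat" where
  "index_of g x = card {y \<in> {..<x}. g y = g x}"

text \<open>The prefix maximum of these values at a wire is attained by the first wire of its group, so it
  reveals where the group begins. Reducing modulo \<open>X\<close> only serves to bound the values of foreign items.\<close>

definition group_value :: "nat \<Rightarrow> nat \<Rightarrow> nat \<Rightarrow> nat \<Rightarrow> nat" where
  "group_value W X p a = (a * W + (W - 1 - p)) mod X"

section \<open>Lexicographic keys: numbering groups and matching codes\<close>

lemma block_le_iff:
  fixes a b x y W :: nat
  assumes "x < W" "y < W"
  shows "a * W + x < b * W + y \<longleftrightarrow> a < b \<or> (a = b \<and> x < y)"
    and "a * W + x \<le> b * W + y \<longleftrightarrow> a < b \<or> (a = b \<and> x \<le> y)"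
proof -
  have l: "a * W + x < b * W" if "a < b" "x < W" for a b x
  proof -
    have "(a + 1) * W \<le> b * W" using that by (intro mult_le_mono1) auto
    then show ?thesis using that by simp
  qed
  have "(a * W + x < b * W + y \<longleftrightarrow> a < b \<or> (a = b \<and> x < y)) \<and>
      (a * W + x \<le> b * W + y \<longleftrightarrow> a < b \<or> (a = b \<and> x \<le> y))"
    using l[of a b x] l[of b a y] assms by (cases a b rule: linorder_cases) auto
  then show "a * W + x < b * W + y \<longleftrightarrow> a < b \<or> (a = b \<and> x < y)"
    "a * W + x \<le> b * W + y \<longleftrightarrow> a < b \<or> (a = b \<and> x \<le> y)"
    by blast+
qed

lemma start_add_index:
  assumes "x < W"
  shows "rank_of W (\<lambda>p. g p * W + p) x = start_of W g x + index_of g x"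
proof -
  have "{y \<in> {..<W}. g y * W + y < g x * W + x} =
    {y \<in> {..<W}. g y < g x} \<union> {y \<in> {..<x}. g y = g x}"
    using assms by (auto simp: block_le_iff)
  then show ?thesis
    unfolding rank_of_def start_of_def index_of_def
    by (simp add: card_Un_disjoint disjoint_iff)
qed

text \<open>The values increase from group to group and decrease inside a group. So the maximum up
  to \<open>x\<close> belongs to the first wire \<open>y0\<close> of its group, whose rank is the
  start of the group. The bound on \<open>X\<close> makes the reduction in
  \<open>group_value\<close> the identity here.\<close>

lemma group_op:
  assumes W: "W \<le> 2 ^ q" and x: "x < W"
    and f: "\<And>p. p < W \<Longrightarrow> f p = (g p * W + p, p, g p, c p)"
    and X: "\<And>p. p < W \<Longrightarrow> (g p + 1) * W \<le> X"
  shows "run_stages W (op_stages q (group_value W X)) f x =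
    (x, x, start_of W g x + index_of g x, g x * W + (W - 1 - start_of W g x))"
proof -
  let ?key = "\<lambda>p. g p * W + p"
  have inj: "inj_on ?key {..<W}"
    by (rule inj_onI) (metis block_le_iff(1) lessThan_iff less_irrefl linorder_neqE_nat)
  have val: "group_value W X p (g y) = g y * W + (W - 1 - p)" if "p < W" "y < W" for p y
    unfolding group_value_def using X[OF that(2)] that by (intro mod_less) auto
  define y0 where "y0 = (LEAST y. g y = g x)"
  have y0: "g y0 = g x" "y0 \<le> x" "\<And>y. y < y0 \<Longrightarrow> g y \<noteq> g x"
    unfolding y0_def by (auto intro: LeastI Least_le dest: not_less_Least)
  have "index_of g y0 = 0" unfolding index_of_def using y0 by auto
  moreover have "start_of W g y0 = start_of W g x" unfolding start_of_def y0(1) ..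
  ultimately have r0: "rank_of W ?key y0 = start_of W g x"
    using start_add_index[of y0 W g] y0(2) x by simp
  have "Max ((\<lambda>y. group_value W X (rank_of W ?key y) (g y)) ` {y \<in> {..<W}. ?key y \<le> ?key x}) =
    g x * W + (W - 1 - start_of W g x)"
  proof (rule Max_eqI)
    have "group_value W X (rank_of W ?key y0) (g y0) = g x * W + (W - 1 - start_of W g x)"
      using val[OF rank_of_less[of y0 W ?key], of y0] y0(1,2) x unfolding r0 by simp
    moreover have "?key y0 \<le> ?key x" using y0 by simp
    ultimately show "g x * W + (W - 1 - start_of W g x) \<in>
        (\<lambda>y. group_value W X (rank_of W ?key y) (g y)) ` {y \<in> {..<W}. ?key y \<le> ?key x}"
      using y0 x by (intro image_eqI[of _ _ y0]) auto
  next
    fix z assume "z \<in> (\<lambda>y. group_value W X (rank_of W ?key y) (g y)) ` {y \<in> {..<W}. ?key y \<le> ?key x}"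
    then obtain y where y: "y < W" "?key y \<le> ?key x" "z = group_value W X (rank_of W ?key y) (g y)"
      by auto
    have z: "z = g y * W + (W - 1 - rank_of W ?key y)"
      using y val[OF rank_of_less[OF y(1)] y(1)] by simp
    consider "g y < g x" | "g y = g x" using y x block_le_iff(2)[of y W x "g y" "g x"] by auto
    then show "z \<le> g x * W + (W - 1 - start_of W g x)"
    proof cases
      case 1
      then show ?thesis unfolding z using y(1)
        by (subst block_le_iff(2)) auto
    next
      case 2
      then have "start_of W g x \<le> rank_of W ?key y"
        using start_add_index[OF y(1), of g] by (simp add: start_of_def)
      then show ?thesis unfolding z 2 by simp
    qed
  qed simp
  then show ?thesis
    using op_stages_correct[where f = f and key = ?key and aux = g and c = c, OF W inj x f]
      start_add_index[OF x] by simp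
qed

text \<open>The key of an element of \<open>B\<close> is the successor of the key of the element of
  \<open>A\<close> with the same code. This element is then the last one of \<open>A\<close> before
  it and carries the largest value. The \<open>+ 1\<close> in \<open>code p + 1\<close> separates
  the values of \<open>A\<close> from the 0 of all other wires, and \<open>pl p < P\<close> lets
  division by \<open>P\<close> recover the code.\<close>

lemma match_op:
  fixes A B :: "nat set" and code pl :: "nat \<Rightarrow> nat"
  assumes W: "W \<le> 2 ^ q" and AB: "A \<subseteq> {..<W}" "B \<subseteq> {..<W}" "A \<inter> B = {}"
    and inj: "inj_on code A" "inj_on code B"
    and code: "\<And>p. p \<in> A \<union> B \<Longrightarrow> code p < Y" and pl: "\<And>p. p \<in> A \<Longrightarrow> pl p < P"
    and f: "\<And>p. p < W \<Longrightarrow> f p =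
      (if p \<in> A then 2 * code p else if p \<in> B then 2 * code p + 1 else 2 * Y + p, p,
       if p \<in> A then (code p + 1) * P + pl p else 0, c p)"
    and x: "x \<in> B"
  obtains r M where "run_stages W (op_stages q (\<lambda>p a. a)) f x = (x, x, r, M)"
    "\<And>y. y \<in> A \<Longrightarrow> code y = code x \<Longrightarrow> M = (code x + 1) * P + pl y"
    "(\<forall>y\<in>A. code y \<noteq> code x) \<Longrightarrow> M div P \<noteq> code x + 1"
proof -
  define key where "key p = (if p \<in> A then 2 * code p else if p \<in> B then 2 * code p + 1 else 2 * Y + p)" for p
  define aux where "aux p = (if p \<in> A then (code p + 1) * P + pl p else 0)" for p
  define S where "S = {y \<in> {..<W}. key y \<le> key x}"
  have inj_key: "inj_on key {..<W}"
  proof (rule inj_onI)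
    fix p p' assume e: "key p = key p'"
    have par: "2 * a \<noteq> 2 * b + 1" "2 * b + 1 \<noteq> 2 * a" for a b :: nat by presburger+
    consider "p \<in> A" "p' \<in> A" | "p \<in> B" "p' \<in> B" "p \<notin> A" "p' \<notin> A" | "p \<in> A" "p' \<in> B" "p' \<notin> A"
      | "p \<in> B" "p' \<in> A" "p \<notin> A" | "p \<notin> A \<union> B" "p' \<notin> A \<union> B" | "p \<in> A \<union> B" "p' \<notin> A \<union> B"
      | "p \<notin> A \<union> B" "p' \<in> A \<union> B"
      by blast
    then show "p = p'"
      using e code[of p] code[of p'] inj par[of "code p" "code p'"] par[of "code p'" "code p"]
      by cases (auto simp: key_def dest: inj_onD split: if_splits)
  qed
  have xW: "x < W" "x \<notin> A" using x AB by auto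
  define M where "M = Max (aux ` S)"
  have fin: "finite S" "x \<in> S" unfolding S_def using xW by auto
  have run: "run_stages W (op_stages q (\<lambda>p a. a)) f x = (x, x, rank_of W key x, M)"
    using op_stages_correct[where f = f and key = key and aux = aux and c = c and F = "\<lambda>p a. a", OF W inj_key xW(1)]
      f unfolding key_def aux_def M_def S_def by simp
  have S: "code z \<le> code x" if "z \<in> S" "z \<in> A" for z
    using that x xW unfolding S_def key_def by auto
  show thesis
  proof (rule that[OF run])
    fix y assume y: "y \<in> A" "code y = code x"
    show "M = (code x + 1) * P + pl y"
      unfolding M_def
    proof (rule Max_eqI)
      have "y \<in> S" unfolding S_def key_def using y x xW AB by auto
      then show "(code x + 1) * P + pl y \<in> aux ` S"
        using y by (intro image_eqI[of _ _ y]) (auto simp: aux_def)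
    next
      fix z assume "z \<in> aux ` S"
      then obtain w where w: "w \<in> S" "z = aux w" by auto
      show "z \<le> (code x + 1) * P + pl y"
      proof (cases "w \<in> A")
        case True
        then have "w = y \<or> code w < code x"
          using S[OF w(1) True] y inj(1) by (metis inj_onD le_neq_implies_less)
        then show ?thesis
          using w True pl[OF True] pl[OF y(1)] y(2) block_le_iff(2)[of "pl w" P "pl y" "code w + 1" "code x + 1"]
          by (auto simp: aux_def)
      qed (use w in \<open>auto simp: aux_def\<close>)
    qed (use fin in auto)
  next
    assume no: "\<forall>y\<in>A. code y \<noteq> code x"
    have "M \<in> aux ` S" unfolding M_def using fin by (intro Max_in) auto
    then obtain w where w: "w \<in> S" "M = aux w" by auto
    show "M div P \<noteq> code x + 1"
    proof (cases "w \<in> A")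
      case True
      then have "M div P = code w + 1"
        using w pl[OF True] True by (simp add: aux_def del: mult_Suc)
      then show ?thesis using no True by auto
    qed (use w in \<open>auto simp: aux_def\<close>)
  qed
qed

section \<open>Choosing the first elements of a finite set\<close>

definition position_in :: "'a set \<Rightarrow> ('a \<Rightarrow> nat) \<Rightarrow> 'a \<Rightarrow> nat" where
  "position_in A h x = card {y \<in> A. h y < h x}"

lemma position_in_bij:
  assumes fin: "finite A" and inj: "inj_on h A"
  shows "bij_betw (position_in A h) A {..<card A}"
proof -
  have l: "position_in A h x < position_in A h y" if "h x < h y" "x \<in> A" for x y
    unfolding position_in_def by (rule psubset_card_mono) (use that fin in auto)
  have "inj_on (position_in A h) A"
    by (rule inj_onI) (metis inj inj_onD l less_irrefl linorder_neqE_nat)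
  moreover have "position_in A h ` A \<subseteq> {..<card A}"
    unfolding position_in_def using fin by (auto intro!: psubset_card_mono)
  ultimately show ?thesis
    by (simp add: bij_betw_def card_image card_subset_eq)
qed

text \<open>The positions are the numbers below \<open>card A\<close>, each attained once. The
  equality with \<open>min\<close> is the form in which \<open>capped_delivery\<close>
  counts.\<close>

lemma card_first:
  assumes "finite A" "inj_on h A"
  shows "card {x \<in> A. position_in A h x < c} = min c (card A)"
proof -
  note bij = position_in_bij[OF assms]
  have "position_in A h ` {x \<in> A. position_in A h x < c} = {..<min c (card A)}"
    using bij unfolding bij_betw_def by (auto simp: image_iff) (metis imageE lessThan_iff)
  moreover have "inj_on (position_in A h) {x \<in> A. position_in A h x < c}"
    using bij unfolding bij_betw_def by (auto intro: inj_on_subset)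
  ultimately show ?thesis by (metis card_image card_lessThan)
qed

section \<open>Products and couplings of probability mass functions\<close>

lemma rel_pmf_Pi_pmf:
  assumes "finite A" "\<And>x. x \<in> A \<Longrightarrow> rel_pmf (R x) (p x) (q x)"
  shows "rel_pmf (\<lambda>f g. \<forall>x\<in>A. R x (f x) (g x)) (Pi_pmf A d p) (Pi_pmf A d' q)"
  using assms
proof (induction A rule: finite_induct)
  case empty
  then show ?case by (simp add: rel_pmf_return_pmf1)
next
  case (insert a A)
  have "rel_pmf (\<lambda>(x, f) (y, g). R a x y \<and> (\<forall>x\<in>A. R x (f x) (g x)))
      (pair_pmf (p a) (Pi_pmf A d p)) (pair_pmf (q a) (Pi_pmf A d' q))"
    using rel_pmf_rel_prod[of "R a" "\<lambda>f g. \<forall>x\<in>A. R x (f x) (g x)"] insert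
    by (simp add: rel_prod_conv case_prod_unfold)
  then show ?case
    unfolding Pi_pmf_insert[OF insert.hyps] pmf.rel_map
    by (rule pmf.rel_mono_strong) (use insert.hyps in auto)
qed

lemma rel_pmf_bind_set:
  assumes "rel_pmf R p q" "\<And>x y. R x y \<Longrightarrow> x \<in> set_pmf p \<Longrightarrow> y \<in> set_pmf q \<Longrightarrow> rel_pmf S (f x) (g y)"
  shows "rel_pmf S (bind_pmf p f) (bind_pmf q g)"
proof -
  have "rel_pmf (\<lambda>x y. R x y \<and> x \<in> set_pmf p \<and> y \<in> set_pmf q) p q"
    by (rule pmf.rel_mono_strong[OF assms(1)]) auto
  then show ?thesis by (rule rel_pmf_bindI) (use assms(2) in auto)
qed

text \<open>The joint distribution behind \<open>rel_pmf\<close> satisfies the relation with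
  probability one.\<close>

lemma coupled_if_rel_pmf:
  assumes "rel_pmf R P Q" "p \<le> 1"
  shows "coupled p P Q R"
proof -
  obtain J where J: "map_pmf fst J = P" "map_pmf snd J = Q" "\<And>a b. (a, b) \<in> set_pmf J \<Longrightarrow> R a b"
    using assms(1) by (auto simp: rel_pmf.simps)
  have "measure_pmf.prob J {(a, b). R a b} = 1"
    using J(3) by (intro measure_pmf.prob_eq_1[THEN iffD2]) (auto simp: AE_measure_pmf_iff)
  then show ?thesis using J assms(2) unfolding coupled_def by auto
qed

section \<open>Runs\<close>

text \<open>\<open>run\<close> grows at its end. Isolating the last step as a map on histories lets
  a run be cut anywhere and continued with the events that the adversary remembers.\<close>

definition extend :: "('ev list \<Rightarrow> 'cfg \<Rightarrow> ('ev \<times> 'cfg) pmf) \<Rightarrow> 'cfg list \<times> 'ev list \<Rightarrow>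
    ('cfg list \<times> 'ev list) pmf" where
  "extend step = (\<lambda>(cs, es). map_pmf (\<lambda>(e, c). (cs @ [c], es @ [e])) (step es (last cs)))"

primrec extend_n :: "('ev list \<Rightarrow> 'cfg \<Rightarrow> ('ev \<times> 'cfg) pmf) \<Rightarrow> nat \<Rightarrow> 'cfg list \<times> 'ev list \<Rightarrow>
    ('cfg list \<times> 'ev list) pmf" where
  "extend_n step 0 x = return_pmf x"
| "extend_n step (Suc k) x = bind_pmf (extend_n step k x) (extend step)"

lemma run_add: "run step c0 (a + k) = bind_pmf (run step c0 a) (extend_n step k)"
proof (induction k)
  case 0
  show ?case by (simp add: bind_return_pmf')
next
  case (Suc k)
  have "run step c0 (a + Suc k) = bind_pmf (run step c0 (a + k)) (extend step)"
    by (simp add: extend_def case_prod_unfold)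
  then show ?case by (simp add: Suc bind_assoc_pmf)
qed

lemma extend_n_add: "extend_n step (a + k) x = bind_pmf (extend_n step a x) (extend_n step k)"
  by (induction k) (simp_all add: bind_return_pmf' bind_assoc_pmf)

lemma extend_n_1 [simp]: "extend_n step (Suc 0) x = extend step x"
  by (simp add: bind_return_pmf)

section \<open>Delivery without loss\<close>

text \<open>Without overload both caps become equalities of cardinalities between a set and a finite
  superset, and these force equality.\<close>

lemma capped_delivery_all:
  assumes D: "capped_delivery cap A dest D" and fin: "finite A"
    and out: "\<And>u. card {m \<in> A. fst m = u} \<le> cap" and inc: "\<And>w. card {m \<in> A. dest m = w} \<le> cap"
  shows "D = A"
proof -
  obtain B where B: "B \<subseteq> A" "D \<subseteq> B" "\<And>u. card {m \<in> B. fst m = u} = min cap (card {m \<in> A. fst m = u})"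
    "\<And>w. card {m \<in> D. dest m = w} = min cap (card {m \<in> B. dest m = w})"
    using D unfolding capped_delivery_def by blast
  have "{m \<in> B. fst m = u} = {m \<in> A. fst m = u}" for u
    using B(1,3) out[of u] fin by (intro card_subset_eq) auto
  then have BA: "B = A" by blast
  have "{m \<in> D. dest m = w} = {m \<in> A. dest m = w}" for w
    using B(1,2,4) inc[of w] fin unfolding BA by (intro card_subset_eq) auto
  then show ?thesis by blast
qed

section \<open>Balls in a network\<close>

text \<open>The recursion follows flooding: after one more round \<open>v\<close> knows what it knew
  and what its neighbours knew.\<close>

primrec ball_of :: "wgraph \<Rightarrow> nat \<Rightarrow> nat \<Rightarrow> nat set" where
  "ball_of G 0 v = {v}"
| "ball_of G (Suc l) v = ball_of G l v \<union> (\<Union>u\<in>nbrs G v. ball_of G l u)"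

lemma network_nbrs:
  assumes "network n G"
  shows "nbrs G v \<subseteq> {1..n}" "u \<in> nbrs G v \<longleftrightarrow> v \<in> nbrs G u"
proof -
  have e: "edges G \<subseteq> {{u, v} | u v. u \<in> verts G \<and> v \<in> verts G \<and> u \<noteq> v}" "verts G = {1..n}"
    using assms unfolding network_def graph_def by auto
  show "nbrs G v \<subseteq> {1..n}"
    unfolding nbrs_def using e by (auto simp: doubleton_eq_iff)
  show "u \<in> nbrs G v \<longleftrightarrow> v \<in> nbrs G u"
    unfolding nbrs_def by (simp add: insert_commute)
qed

lemma ball_of_subset:
  assumes "network n G" "v \<in> {1..n}"
  shows "ball_of G l v \<subseteq> {1..n}"
  using assms(2)
proof (induction l arbitrary: v)
  case (Suc l)
  have "ball_of G l u \<subseteq> {1..n}" if "u \<in> nbrs G v" for u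
    using Suc.IH network_nbrs(1)[OF assms(1), of v] that by blast
  then show ?case using Suc.IH[OF Suc.prems] unfolding ball_of.simps by blast
qed auto

lemma ball_of_mono: "l \<le> l' \<Longrightarrow> ball_of G l v \<subseteq> ball_of G l' v"
  by (induction l' rule: dec_induct) auto

lemma is_path_ball_of:
  assumes "is_path G u v p" "path_hops p \<le> l"
  shows "u \<in> ball_of G l v"
proof -
  have "p \<noteq> [] \<Longrightarrow> successively (\<lambda>a b. {a, b} \<in> edges G) p \<Longrightarrow> hd p \<in> ball_of G (length p - 1) (last p)" for p
  proof (induction p rule: rev_induct)
    case (snoc v p)
    show ?case
    proof (cases "p = []")
      case False
      then have "hd p \<in> ball_of G (length p - 1) (last p)" "last p \<in> nbrs G v"
        using snoc by (auto simp: successively_append_iff nbrs_def insert_commute)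
      then have "hd p \<in> ball_of G (Suc (length p - 1)) v" by auto
      moreover have "Suc (length p - 1) = length (p @ [v]) - 1" using False by (cases p) auto
      ultimately show ?thesis using False by (simp only: hd_append2 last_snoc not_False_eq_True)
    qed simp
  qed simp
  then have "u \<in> ball_of G (path_hops p) v"
    using assms(1) unfolding is_path_def path_hops_def by auto
  then show ?thesis using ball_of_mono[OF assms(2)] by blast
qed

lemma is_path_rev: "is_path G u v p \<Longrightarrow> is_path G v u (rev p)"
  unfolding is_path_def
  by (auto simp: hd_rev last_rev successively_rev insert_commute)

text \<open>Connectivity makes the set of path lengths nonempty, so the infimum in
  \<open>hop_dist\<close> is attained by a path.\<close>

lemma hop_dist_ball_of:
  assumes "network n G" "u \<in> {1..n}" "v \<in> {1..n}" "hop_dist G u v \<le> l"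
  shows "u \<in> ball_of G l v" "v \<in> ball_of G l u"
proof -
  have "{path_hops p | p. is_path G u v p} \<noteq> {}"
    using assms(1-3) unfolding network_def connected_graph_def by auto
  then have "hop_dist G u v \<in> {path_hops p | p. is_path G u v p}"
    unfolding hop_dist_def by (rule Inf_nat_def1)
  then obtain p where p: "is_path G u v p" "path_hops p \<le> l" using assms(4) by auto
  show "u \<in> ball_of G l v" using is_path_ball_of[OF p] .
  show "v \<in> ball_of G l u" using is_path_ball_of[OF is_path_rev[OF p(1)]] p(2) by (simp add: path_hops_def)
qed

section \<open>Super-rounds\<close>

text \<open>Memories are written in unary: their length is not restricted, and neither is the number of local
  messages, so that a node can forward its whole memory to its neighbours as a list of empty messages.\<close>

definition store :: "'a::countable \<Rightarrow> bits" where
  "store x = replicate (to_nat x) True"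

definition fetch :: "bits \<Rightarrow> 'a::countable" where
  "fetch bs = from_nat (length bs)"

lemma fetch_store [simp]: "fetch (store x) = x"
  by (simp add: fetch_def store_def)

text \<open>Truncation to a fixed width, because \<open>hyb_message_bound\<close> quantifies over
  all memory contents, reachable or not: the length must not depend on the encoded value.\<close>

definition enc_nat :: "nat \<Rightarrow> nat \<Rightarrow> bits" where
  "enc_nat B x = map (bit x) [0..<B]"

fun enc_item :: "nat \<Rightarrow> item \<Rightarrow> bits" where
  "enc_item B (k, h, a, c) = enc_nat B k @ enc_nat B h @ enc_nat B a @ enc_nat B c"

definition dec_nat :: "bits \<Rightarrow> nat" where
  "dec_nat bs = horner_sum of_bool 2 bs"

definition dec_item :: "nat \<Rightarrow> bits \<Rightarrow> item" where
  "dec_item B bs = (dec_nat (take B bs), dec_nat (take B (drop B bs)),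
     dec_nat (take B (drop (2 * B) bs)), dec_nat (drop (3 * B) bs))"

fun norm_item :: "nat \<Rightarrow> item \<Rightarrow> item" where
  "norm_item B (k, h, a, c) = (take_bit B k, take_bit B h, take_bit B a, take_bit B c)"

lemma dec_enc_item: "dec_item B (enc_item B x) = norm_item B x"
proof -
  have [simp]: "length (enc_nat B y) = B" "dec_nat (enc_nat B y) = take_bit B y" for y
    by (simp_all add: enc_nat_def dec_nat_def horner_sum_bit_eq_take_bit)
  show ?thesis by (cases x) (simp add: dec_item_def)
qed

lemma length_enc_item: "length (enc_item B x) = 4 * B"
  by (cases x) (simp add: enc_nat_def)

lemma norm_item_id: "item_bound (2 ^ B) x \<Longrightarrow> norm_item B x = x"
  by (cases x) (simp add: item_bound_def take_bit_nat_eq_self)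

text \<open>Identifier, round number, user state, user states seen within the super-round, items received from
  the partner within the super-round.\<close>

type_synonym 'u node = "nat \<times> nat \<times> 'u \<times> 'u fset \<times> item list"

text \<open>Super-round \<open>i\<close> takes \<open>L\<close> rounds. At its start
  \<open>pre i\<close> makes the random choices; the resulting states are flooded while the
  \<open>m\<close> items of the partner arrive one by one; at its end \<open>post i\<close> computes
  the next state. The mask \<open>msk i\<close> acts on nodes, not on wires.\<close>

locale super_rounds =
  fixes n m B L :: nat
    and ini :: "hyb_info \<Rightarrow> 'u::countable"
    and pre :: "nat \<Rightarrow> 'u \<Rightarrow> 'u pmf"
    and msk :: "nat \<Rightarrow> nat"
    and post :: "nat \<Rightarrow> 'u \<Rightarrow> 'u fset \<Rightarrow> item list \<Rightarrow> 'u"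
    and wire :: "'u \<Rightarrow> nat \<Rightarrow> item"
  assumes n: "2 \<le> n" and L: "0 < L" "m \<le> L"
begin

text \<open>Identifiers start at 1, whereas the XOR acts on numbers from 0. A value above
  \<open>n\<close> signals a missing partner.\<close>

definition partner :: "nat \<Rightarrow> nat \<Rightarrow> nat" where
  "partner i v = Suc (xor (v - 1) (msk i))"

lemma partner_partner: "1 \<le> v \<Longrightarrow> partner i (partner i v) = v"
  by (simp add: partner_def)

fun node_act :: "'u node \<Rightarrow> 'u node pmf" where
  "node_act (v, t, u, K, b) =
    (if t mod L = 0 then map_pmf (\<lambda>u'. (v, t, u', {|u'|}, [])) (pre (t div L) u)
     else return_pmf (v, t, u, K, b))"

fun node_sends :: "'u node \<Rightarrow> bool" where
  "node_sends (v, t, u, K, b) \<longleftrightarrow> length b < m \<and> partner (t div L) v \<le> n"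

fun node_global :: "'u node \<Rightarrow> (nat \<times> bits) list" where
  "node_global (v, t, u, K, b) = (if length b < m \<and> partner (t div L) v \<le> n
     then [(partner (t div L) v, enc_item B (wire u (length b)))] else [])"

fun node_known :: "'u node \<Rightarrow> 'u fset" where
  "node_known (v, t, u, K, b) = K"

text \<open>The length of the buffer \<open>b\<close> counts the items received so far and so tells
  which one is next. When an item is due in a run, \<open>M\<close> is a singleton and
  \<open>SOME\<close> returns its element.\<close>

fun node_update :: "'u node \<Rightarrow> 'u set \<Rightarrow> bits multiset \<Rightarrow> 'u node" where
  "node_update (v, t, u, K, b) N M =
    (let K' = Abs_fset (fset K \<union> N);
         b' = (if length b < m \<and> partner (t div L) v \<le> n then b @ [dec_item B (SOME x. x \<in># M)] else b)
     in if Suc t mod L = 0 then (v, Suc t, post (t div L) u K' b', {||}, []) else (v, Suc t, u, K', b'))"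

text \<open>A neighbour sends \<open>Suc (to_nat x)\<close> empty messages; the successor
  distinguishes the code 0 from the empty list of a non-neighbour.\<close>

definition heard :: "(nat \<Rightarrow> bits list) \<Rightarrow> 'u set" where
  "heard loc = (\<Union>w\<in>{1..n}. if loc w = [] then {}
     else fset (node_known (from_nat (length (loc w) - 1) :: 'u node)))"

definition sim :: hyb_alg where
  "sim = \<lparr>h_init = (\<lambda>info. store (hi_id info, 0 :: nat, ini info, {||} :: 'u fset, [] :: item list)),
    h_act = (\<lambda>mem. map_pmf (\<lambda>x. (store x, \<lambda>_. replicate (Suc (to_nat x)) [], node_global x))
      (node_act (fetch mem))),
    h_upd = (\<lambda>mem loc M. store (node_update (fetch mem) (heard loc) M))\<rparr>"

lemma sim_message_bound:
  assumes "4 * real B \<le> real k * log 2 (real n)"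
  shows "hyb_message_bound k n sim"
proof -
  have "0 \<le> real k * log 2 (real n)" using n by simp
  moreover have "length b = 4 * B" if "(w, b) \<in> set (node_global x)" for w b x
    using that by (cases x) (auto simp: length_enc_item split: if_splits)
  ultimately have b: "real (length b) \<le> real k * log 2 (real n)" if "(w, b) \<in> set (node_global x)" for w b x
    using assms that by (metis of_nat_mult of_nat_numeral)
  show ?thesis
    unfolding hyb_message_bound_def
  proof (intro allI ballI)
    fix mem x assume "x \<in> set_pmf (h_act sim mem)"
    then obtain y where x: "x = (store y, \<lambda>_. replicate (Suc (to_nat y)) [], node_global y)"
      by (auto simp: sim_def)
    show "case x of (mem', loc, glob) \<Rightarrow>
        (\<forall>w. \<forall>b\<in>set (loc w). real (length b) \<le> real k * log 2 (real n)) \<and>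
        (\<forall>(w, b)\<in>set glob. real (length b) \<le> real k * log 2 (real n))"
      unfolding x using b[of _ _ y] \<open>0 \<le> real k * log 2 (real n)\<close> by auto
  qed
qed

section \<open>Execution in a fixed network against a fixed adversary\<close>

context
  fixes G adv
  assumes G: "network n G" and adv: "adversary (global_capacity n) (adv :: hyb_act adversary)"
begin

lemma verts_G: "verts G = {1..n}" and finite_verts: "finite (verts G)"
  using G by (auto simp: network_def)

lemma capacity: "1 \<le> global_capacity n"
proof -
  have "1 \<le> log 2 (real n)" using n by (simp add: le_log_iff)
  then show ?thesis unfolding global_capacity_def by linarith
qed

text \<open>The effect of a round as a function of the choices \<open>a\<close> alone: the adversary
  does not occur in it.\<close>

definition round_result :: "(nat \<Rightarrow> 'u node) \<Rightarrow> nat \<Rightarrow> 'u node" where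
  "round_result a v = node_update (a v) (\<Union>w\<in>nbrs G v. fset (node_known (a w)))
     (case a v of (_, t, u, K, b) \<Rightarrow> case a (partner (t div L) v) of (_, _, u', _, b') \<Rightarrow>
        {#enc_item B (wire u' (length b'))#})"

text \<open>The clocks agree and partners have received equally many items, so a node sends in a
  round exactly when its partner does.\<close>

definition in_step :: "nat \<Rightarrow> (nat \<Rightarrow> 'u node) \<Rightarrow> bool" where
  "in_step t a \<longleftrightarrow> (\<forall>v\<in>verts G. \<exists>u K b. a v = (v, t, u, K, b) \<and>
     (partner (t div L) v \<in> verts G \<longrightarrow>
       (\<exists>u' K' b'. a (partner (t div L) v) = (partner (t div L) v, t, u', K', b') \<and> length b' = length b)))"

lemma in_stepD:
  assumes "in_step t a" "v \<in> verts G"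
  shows "fst (a v) = v" "fst (snd (a v)) = t"
    "partner (t div L) v \<in> verts G \<Longrightarrow>
      length (snd (snd (snd (snd (a (partner (t div L) v)))))) = length (snd (snd (snd (snd (a v)))))"
proof -
  obtain u K b where a: "a v = (v, t, u, K, b)" and p: "partner (t div L) v \<in> verts G \<longrightarrow>
       (\<exists>u' K' b'. a (partner (t div L) v) = (partner (t div L) v, t, u', K', b') \<and> length b' = length b)"
    using assms unfolding in_step_def by blast
  show "fst (a v) = v" "fst (snd (a v)) = t" using a by auto
  show "partner (t div L) v \<in> verts G \<Longrightarrow>
      length (snd (snd (snd (snd (a (partner (t div L) v)))))) = length (snd (snd (snd (snd (a v)))))"
    using a p by auto
qed

text \<open>Pairing is an involution, so every node sends and receives at most one global message,
  which any capacity of at least 1 admits. The adversary is left with a single delivery set, and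
  only the independent choices of the nodes remain random.\<close>

lemma hyb_step_round:
  assumes cfg: "\<And>v. v \<in> verts G \<Longrightarrow> cfg v = store (s v)"
    and step: "\<And>a. a \<in> set_pmf (Pi_pmf (verts G) undefined (\<lambda>v. node_act (s v))) \<Longrightarrow> in_step t a"
  shows "rel_pmf (\<lambda>(e, c) a. \<forall>v\<in>verts G. c v = store (round_result a v))
    (hyb_step G sim adv es cfg) (Pi_pmf (verts G) undefined (\<lambda>v. node_act (s v)))"
proof -
  define of_node where "of_node x = (store x, \<lambda>_ :: nat. replicate (Suc (to_nat x)) ([] :: bits), node_global x)"
    for x :: "'u node"
  have acts: "rel_pmf (\<lambda>acts a. \<forall>v\<in>verts G. acts v = of_node (a v))
      (Pi_pmf (verts G) undefined (\<lambda>v. h_act sim (cfg v)))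
      (Pi_pmf (verts G) undefined (\<lambda>v. node_act (s v)))"
  proof (rule rel_pmf_Pi_pmf[OF finite_verts])
    fix v assume v: "v \<in> verts G"
    have "h_act sim (cfg v) = map_pmf of_node (node_act (s v))"
      unfolding sim_def of_node_def cfg[OF v] by simp
    then show "rel_pmf (\<lambda>x y. x = of_node y) (h_act sim (cfg v)) (node_act (s v))"
      by (simp add: pmf.rel_map pmf.rel_refl)
  qed
  show ?thesis
    unfolding hyb_step_def
  proof (subst bind_return_pmf'[of "Pi_pmf (verts G) undefined (\<lambda>v. node_act (s v))", symmetric],
      rule rel_pmf_bind_set[OF acts])
    fix acts a
    assume eq: "\<forall>v\<in>verts G. acts v = of_node (a v)"
      and "a \<in> set_pmf (Pi_pmf (verts G) undefined (\<lambda>v. node_act (s v)))"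
    then have st: "in_step t a" using step by blast
    define glob where "glob v = snd (snd (acts v))" for v
    define dest where "dest = (\<lambda>(u, i). fst (glob u ! i))"
    define A where "A = {(u, i). u \<in> verts G \<and> i < length (glob u) \<and> dest (u, i) \<in> verts G}"
    define \<pi> where "\<pi> = partner (t div L)"
    define buf where "buf v = snd (snd (snd (snd (a v))))" for v
    have glob: "glob v = (if length (buf v) < m \<and> \<pi> v \<le> n
        then [(\<pi> v, enc_item B (wire (fst (snd (snd (a v)))) (length (buf v))))] else [])" if "v \<in> verts G" for v
      using eq that in_stepD(1,2)[OF st that] unfolding glob_def of_node_def buf_def \<pi>_def
      by (cases "a v") auto
    have Aiff: "(u, i) \<in> A \<longleftrightarrow> u \<in> verts G \<and> i = 0 \<and> length (buf u) < m \<and> \<pi> u \<le> n" for u i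
    proof (cases "u \<in> verts G \<and> length (buf u) < m \<and> \<pi> u \<le> n")
      case True
      then show ?thesis using glob[of u] verts_G unfolding A_def dest_def by (auto simp: \<pi>_def partner_def)
    next
      case False
      then have "u \<in> verts G \<Longrightarrow> glob u = []" using glob[of u] by auto
      then show ?thesis using False unfolding A_def by auto
    qed
    have destA: "dest (u, i) = \<pi> u" if "(u, i) \<in> A" for u i
      using that glob[of u] unfolding Aiff dest_def by auto
    have finA: "finite A"
      by (rule finite_subset[of _ "verts G \<times> {0}"]) (use Aiff finite_verts in auto)
    have \<pi>\<pi>: "\<pi> (\<pi> v) = v" if "v \<in> verts G" for v
      using that verts_G by (simp add: \<pi>_def partner_partner)
    have "card {x \<in> A. fst x = u} \<le> 1" for u
    proof -
      have "{x \<in> A. fst x = u} \<subseteq> {(u, 0)}" using Aiff by auto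
      from card_mono[OF _ this] show ?thesis by simp
    qed
    moreover have "card {x \<in> A. dest x = w} \<le> 1" for w
    proof -
      have "{x \<in> A. dest x = w} \<subseteq> {(\<pi> w, 0)}"
      proof
        fix x assume "x \<in> {x \<in> A. dest x = w}"
        then show "x \<in> {(\<pi> w, 0)}" using Aiff destA \<pi>\<pi> by (cases x) auto
      qed
      from card_mono[OF _ this] show ?thesis by simp
    qed
    moreover have "capped_delivery (global_capacity n) A dest D" if "D \<in> set_pmf (adv es acts A dest)" for D
      using adv finA that unfolding adversary_def by blast
    ultimately have DA: "D = A" if "D \<in> set_pmf (adv es acts A dest)" for D
      using capped_delivery_all[OF _ finA] that order_trans[OF _ capacity] by blast
    have result: "h_upd sim (fst (acts v)) (\<lambda>u. if u \<in> nbrs G v then fst (snd (acts u)) v else [])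
        (image_mset (\<lambda>(u, i). snd (glob u ! i)) (mset_set {x \<in> A. dest x = v})) = store (round_result a v)"
      (is "?l = _") if v: "v \<in> verts G" for v
    proof -
      have N: "heard (\<lambda>u. if u \<in> nbrs G v then fst (snd (acts u)) v else []) =
          (\<Union>w\<in>nbrs G v. fset (node_known (a w)))"
      proof -
        have "nbrs G v \<subseteq> {1..n}" using network_nbrs(1)[OF G] .
        then show ?thesis
          unfolding heard_def using eq verts_G by (intro set_eqI) (auto simp: of_node_def subset_iff split: if_splits)
      qed
      obtain u K b where av: "a v = (v, t, u, K, b)" using st v unfolding in_step_def by blast
      have M: "image_mset (\<lambda>(u, i). snd (glob u ! i)) (mset_set {x \<in> A. dest x = v}) =
          {#enc_item B (wire (fst (snd (snd (a (\<pi> v))))) (length (buf (\<pi> v))))#}"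
        if s: "length b < m" "\<pi> v \<le> n"
      proof -
        have pv: "\<pi> v \<in> verts G" using s verts_G by (simp add: \<pi>_def partner_def)
        have l: "length (buf (\<pi> v)) = length b"
          using in_stepD(3)[OF st v] pv av unfolding buf_def \<pi>_def by simp
        have "{x \<in> A. dest x = v} = {(\<pi> v, 0)}"
        proof (intro equalityI subsetI)
          fix x assume "x \<in> {x \<in> A. dest x = v}"
          then show "x \<in> {(\<pi> v, 0)}" using Aiff destA \<pi>\<pi> by (cases x) auto
        next
          fix x assume "x \<in> {(\<pi> v, 0 :: nat)}"
          moreover have "(\<pi> v, 0) \<in> A" unfolding Aiff using pv l s \<pi>\<pi>[OF v] v verts_G by simp
          ultimately show "x \<in> {x \<in> A. dest x = v}" using destA \<pi>\<pi>[OF v] by auto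
        qed
        then show ?thesis using glob[OF pv] l s \<pi>\<pi>[OF v] v verts_G by simp
      qed
      have "fst (acts v) = store (a v)" using eq v by (simp add: of_node_def)
      then have "?l = store (node_update (a v) (\<Union>w\<in>nbrs G v. fset (node_known (a w)))
         (image_mset (\<lambda>(u, i). snd (glob u ! i)) (mset_set {x \<in> A. dest x = v})))"
        unfolding sim_def using N by simp
      also have "\<dots> = store (round_result a v)"
        using M unfolding round_result_def av
        by (cases "a (\<pi> v)") (auto simp: \<pi>_def buf_def Let_def)
      finally show ?thesis .
    qed
    show "rel_pmf (\<lambda>(e, c) a. \<forall>v\<in>verts G. c v = store (round_result a v))
       (let mem = \<lambda>v. fst (acts v); loc = \<lambda>v. fst (snd (acts v)); glob = \<lambda>v. snd (snd (acts v));
            dest = \<lambda>(u, i). fst (glob u ! i);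
            A = {(u, i). u \<in> verts G \<and> i < length (glob u) \<and> dest (u, i) \<in> verts G}
        in bind_pmf (adv es acts A dest) (\<lambda>D. return_pmf ((acts, dest, D),
             \<lambda>v. h_upd sim (mem v) (\<lambda>u. if u \<in> nbrs G v then loc u v else [])
               (image_mset (\<lambda>(u, i). snd (glob u ! i)) (mset_set {m \<in> D. dest m = v})))))
       (return_pmf a)"
      unfolding rel_pmf_return_pmf2 Let_def glob_def[symmetric] dest_def[symmetric] A_def[symmetric]
      using DA result eq by (auto simp: of_node_def)
  qed
qed

text \<open>The state after the random choices and \<open>l\<close> rounds. The minimum reflects
  that the exchange of items is over after \<open>m\<close> rounds while flooding goes on up to
  \<open>L\<close>.\<close>

definition mid :: "nat \<Rightarrow> nat \<Rightarrow> (nat \<Rightarrow> 'u) \<Rightarrow> nat \<Rightarrow> 'u node" where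
  "mid i l U v = (v, i * L + l, U v, Abs_fset (U ` ball_of G l v),
     if partner i v \<in> verts G then map (\<lambda>j. norm_item B (wire (U (partner i v)) j)) [0..<min l m] else [])"

definition super_post :: "nat \<Rightarrow> (nat \<Rightarrow> 'u) \<Rightarrow> nat \<Rightarrow> 'u" where
  "super_post i U v = post i (U v) (Abs_fset (U ` ball_of G L v))
     (if partner i v \<in> verts G then map (\<lambda>j. norm_item B (wire (U (partner i v)) j)) [0..<m] else [])"

definition after :: "nat \<Rightarrow> nat \<Rightarrow> (nat \<Rightarrow> 'u) \<Rightarrow> nat \<Rightarrow> 'u node" where
  "after i l U v = (if l = L then (v, Suc i * L, super_post i U v, {||}, []) else mid i l U v)"

definition boundary :: "nat \<Rightarrow> (nat \<Rightarrow> 'u) \<Rightarrow> (nat \<Rightarrow> bits) \<Rightarrow> bool" where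
  "boundary i U cfg \<longleftrightarrow> (\<forall>v\<in>verts G. cfg v = store (v, i * L, U v, {||} :: 'u fset, [] :: item list))"

lemma partner_verts: "v \<in> verts G \<Longrightarrow> partner i (partner i v) = v" "partner i v \<in> verts G \<longleftrightarrow> partner i v \<le> n"
  using verts_G by (auto simp: partner_partner) (simp add: partner_def)

lemma fset_ball: "v \<in> verts G \<Longrightarrow> fset (Abs_fset (U ` ball_of G l v)) = U ` ball_of G l v"
  using ball_of_subset[OF G, of v l] verts_G by (intro Abs_fset_inverse) (auto intro: finite_subset)

lemma div_round: "l < L \<Longrightarrow> (i * L + l) div L = i" "l < L \<Longrightarrow> (i * L + l) mod L = l"
  using L by auto

lemma in_step_mid:
  assumes "l < L" "\<And>v. v \<in> verts G \<Longrightarrow> a v = mid i l U v"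
  shows "in_step (i * L + l) a"
proof -
  have "\<exists>u K b. a v = (v, i * L + l, u, K, b) \<and> (partner i v \<in> verts G \<longrightarrow>
       (\<exists>u' K' b'. a (partner i v) = (partner i v, i * L + l, u', K', b') \<and> length b' = length b))"
    if v: "v \<in> verts G" for v
  proof (cases "partner i v \<in> verts G")
    case True
    then show ?thesis using assms(2)[OF v] assms(2)[OF True] partner_verts(1)[OF v, of i] v by (simp add: mid_def)
  next
    case False
    then show ?thesis using assms(2)[OF v] by (simp add: mid_def)
  qed
  then show ?thesis unfolding in_step_def div_round[OF assms(1)] by blast
qed

lemma round_result_mid:
  assumes l: "l < L" and a: "\<And>v. v \<in> verts G \<Longrightarrow> a v = mid i l U v" and v: "v \<in> verts G"
  shows "round_result a v = after i (Suc l) U v"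
proof -
  have md: "(Suc (i * L + l)) mod L = 0 \<longleftrightarrow> Suc l = L"
  proof (cases "Suc l = L")
    case True
    then have "Suc (i * L + l) = Suc i * L" by simp
    then show ?thesis using True by simp
  next
    case False
    then have "Suc l < L" using l by simp
    then have "(i * L + Suc l) mod L = Suc l" by (rule div_round)
    then show ?thesis using False by simp
  qed
  have N: "(\<Union>w\<in>nbrs G v. fset (node_known (a w))) = (\<Union>w\<in>nbrs G v. U ` ball_of G l w)"
  proof (rule SUP_cong)
    fix w assume "w \<in> nbrs G v"
    then have "w \<in> verts G" using network_nbrs(1)[OF G, of v] verts_G by auto
    then show "fset (node_known (a w)) = U ` ball_of G l w"
      using a by (simp add: mid_def fset_ball)
  qed simp
  have K: "fset (Abs_fset (U ` ball_of G l v)) \<union> (\<Union>w\<in>nbrs G v. U ` ball_of G l w) = U ` ball_of G (Suc l) v"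
    unfolding fset_ball[OF v] by auto
  let ?b = "\<lambda>l v. if partner i v \<in> verts G then map (\<lambda>j. norm_item B (wire (U (partner i v)) j)) [0..<min l m] else []"
  define b' where "b' = (if length (?b l v) < m \<and> partner i v \<le> n then ?b l v @
      [dec_item B (SOME x. x \<in># (case a (partner i v) of (_, _, u', _, b') \<Rightarrow> {#enc_item B (wire u' (length b'))#}))]
      else ?b l v)"
  have b': "b' = ?b (Suc l) v"
  proof (cases "partner i v \<in> verts G")
    case True
    then have "a (partner i v) = mid i l U (partner i v)" using a by blast
    then show ?thesis
      unfolding b'_def using True partner_verts(1)[OF v, of i] partner_verts(2)[of i v] v
      by (auto simp: mid_def dec_enc_item min_def le_Suc_eq not_le not_less)
  next
    case False
    then show ?thesis unfolding b'_def using partner_verts(2)[of i v] by simp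
  qed
  have "round_result a v = (if Suc l = L then (v, Suc (i * L + l), post i (U v) (Abs_fset (U ` ball_of G (Suc l) v)) b', {||}, [])
      else (v, Suc (i * L + l), U v, Abs_fset (U ` ball_of G (Suc l) v), b'))"
    unfolding round_result_def N using l K md
    by (simp add: a[OF v] mid_def[of i l U v] div_round Let_def b'_def del: ball_of.simps)
  then show ?thesis
    unfolding b' after_def using L by (auto simp: mid_def super_post_def min_absorb2)
qed

section \<open>From single rounds to super-rounds\<close>

lemma hyb_step_mid:
  assumes l: "0 < l" "l < L" and cfg: "\<And>v. v \<in> verts G \<Longrightarrow> cfg v = store (after i l U v)"
    and c: "(e, c) \<in> set_pmf (hyb_step G sim adv es cfg)" and v: "v \<in> verts G"
  shows "c v = store (after i (Suc l) U v)"
proof -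
  let ?p = "Pi_pmf (verts G) undefined (\<lambda>v. node_act (mid i l U v))"
  have act: "node_act (mid i l U v) = return_pmf (mid i l U v)" for v
    using l by (simp add: mid_def div_round)
  have a: "a v = mid i l U v" if "a \<in> set_pmf ?p" "v \<in> verts G" for a v
    using that finite_verts by (simp add: act)
  have cfg': "cfg v = store (mid i l U v)" if "v \<in> verts G" for v
    using cfg[OF that] l by (simp add: after_def)
  have "rel_pmf (\<lambda>(e, c) a. \<forall>v\<in>verts G. c v = store (round_result a v)) (hyb_step G sim adv es cfg) ?p"
    by (rule hyb_step_round[where t = "i * L + l"]) (use cfg' a in_step_mid[OF l(2)] in blast)+
  then obtain a where "a \<in> set_pmf ?p" "\<forall>v\<in>verts G. c v = store (round_result a v)"
    using rel_pmf_imp_rel_set[THEN rel_setD1, OF _ c] by fastforce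
  then show ?thesis
    using round_result_mid[OF l(2), of a i U v] a v by simp
qed

lemma hyb_step_first:
  assumes cfg: "boundary i U cfg"
  shows "rel_pmf (\<lambda>(e, c) U'. \<forall>v\<in>verts G. c v = store (after i 1 U' v))
    (hyb_step G sim adv es cfg) (Pi_pmf (verts G) undefined (\<lambda>v. pre i (U v)))"
proof -
  let ?p = "Pi_pmf (verts G) undefined (\<lambda>v. node_act (v, i * L, U v, {||}, []))"
  let ?q = "Pi_pmf (verts G) undefined (\<lambda>v. pre i (U v))"
  have act: "node_act (v, i * L, U v, {||}, []) = map_pmf (\<lambda>u'. (v, i * L, u', {|u'|}, [])) (pre i (U v))" for v
    using L by simp
  have s: "Abs_fset {u} = {|u|}" for u :: 'u
    by (metis Abs_fset_inverse finite.emptyI finite_insert fset_inverse fset_simps mem_Collect_eq)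
  have pq: "rel_pmf (\<lambda>a U'. \<forall>v\<in>verts G. a v = mid i 0 U' v) ?p ?q"
  proof -
    have "rel_pmf (\<lambda>a U'. \<forall>v\<in>verts G. a v = (v, i * L, U' v, {|U' v|}, [])) ?p ?q"
    proof (rule rel_pmf_Pi_pmf[OF finite_verts])
      show "rel_pmf (\<lambda>a u'. a = (v, i * L, u', {|u'|}, [])) (node_act (v, i * L, U v, {||}, [])) (pre i (U v))" for v
        unfolding act by (simp add: pmf.rel_map pmf.rel_refl)
    qed
    then show ?thesis by (simp only: mid_def ball_of.simps image_insert image_empty s min_0L upt_0 add_0_right
        list.map if_cancel upt_rec[of 0 0] less_irrefl if_False)
  qed
  have "in_step (i * L) a" if a: "a \<in> set_pmf ?p" for a
  proof -
    obtain U' where "\<forall>v\<in>verts G. a v = mid i 0 U' v"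
      using rel_pmf_imp_rel_set[OF pq, THEN rel_setD1, OF a] by blast
    then show ?thesis using in_step_mid[of 0 a i U'] L by simp
  qed
  then have "rel_pmf (\<lambda>(e, c) a. \<forall>v\<in>verts G. c v = store (round_result a v)) (hyb_step G sim adv es cfg) ?p"
    by (intro hyb_step_round[where t = "i * L"]) (use cfg in \<open>auto simp: boundary_def\<close>)
  then have "rel_pmf ((\<lambda>(e, c) a. \<forall>v\<in>verts G. c v = store (round_result a v)) OO
      (\<lambda>a U'. \<forall>v\<in>verts G. a v = mid i 0 U' v)) (hyb_step G sim adv es cfg) ?q"
    unfolding pmf.rel_compp using pq by blast
  then show ?thesis
    by (rule pmf.rel_mono_strong) (use round_result_mid[of 0] L in auto)
qed

text \<open>The first round produces the draws \<open>U'\<close>, and the later rounds are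
  determined by them; so all \<open>L\<close> rounds together are coupled with one product
  distribution.\<close>

lemma super_round:
  assumes cfg: "boundary i U (last cs)"
  shows "rel_pmf (\<lambda>(cs', es') U'. \<exists>ds. cs' = cs @ ds \<and> length ds = L \<and> boundary (Suc i) (super_post i U') (last cs'))
    (extend_n (hyb_step G sim adv) L (cs, es)) (Pi_pmf (verts G) undefined (\<lambda>v. pre i (U v)))"
proof -
  let ?step = "hyb_step G sim adv"
  define Q where "Q k x U' \<longleftrightarrow> (\<exists>ds. fst x = cs @ ds \<and> length ds = k \<and>
    (\<forall>v\<in>verts G. last (fst x) v = store (after i k U' v)))" for k U' and x :: "(nat \<Rightarrow> bits) list \<times> hyb_act event list"
  have "rel_pmf (Q (Suc k)) (extend_n ?step (Suc k) (cs, es)) (Pi_pmf (verts G) undefined (\<lambda>v. pre i (U v)))"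
    if "Suc k \<le> L" for k
    using that
  proof (induction k)
    case 0
    show ?case
      unfolding extend_n_1 extend_def prod.case pmf.rel_map
      by (rule pmf.rel_mono_strong[OF hyb_step_first[OF cfg, of es]]) (auto simp: Q_def case_prod_unfold)
  next
    case (Suc k)
    have "rel_pmf (Q (Suc (Suc k))) (bind_pmf (extend_n ?step (Suc k) (cs, es)) (extend ?step))
      (bind_pmf (Pi_pmf (verts G) undefined (\<lambda>v. pre i (U v))) return_pmf)"
    proof (rule rel_pmf_bindI)
      show "rel_pmf (Q (Suc k)) (extend_n ?step (Suc k) (cs, es)) (Pi_pmf (verts G) undefined (\<lambda>v. pre i (U v)))"
        using Suc by simp
    next
      fix x U' assume x: "Q (Suc k) x U'"
      obtain cs1 es1 where x1: "x = (cs1, es1)" by force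
      have "c v = store (after i (Suc (Suc k)) U' v)"
        if "(e, c) \<in> set_pmf (?step es1 (last cs1))" "v \<in> verts G" for e c v
        using hyb_step_mid[of "Suc k" "last cs1" i U' e c es1 v] that x Suc.prems unfolding Q_def x1 by auto
      then show "rel_pmf (Q (Suc (Suc k))) (extend ?step x) (return_pmf U')"
        using x unfolding x1 extend_def rel_pmf_return_pmf2 by (auto simp: Q_def)
    qed
    then show ?case by (simp only: extend_n.simps(2)[of _ "Suc k"] bind_return_pmf')
  qed
  from this[of "L - 1"] have "rel_pmf (Q L) (extend_n ?step L (cs, es)) (Pi_pmf (verts G) undefined (\<lambda>v. pre i (U v)))"
    using L by simp
  then show ?thesis
    by (rule pmf.rel_mono_strong) (auto simp: Q_def boundary_def after_def)
qed

lemma super_round_return: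
  assumes "boundary i U (last cs)" "\<And>v. v \<in> verts G \<Longrightarrow> pre i (U v) = return_pmf (U v)"
  shows "\<forall>(cs', es') \<in> set_pmf (extend_n (hyb_step G sim adv) L (cs, es)).
    \<exists>ds. cs' = cs @ ds \<and> length ds = L \<and> boundary (Suc i) (super_post i U) (last cs')"
proof -
  \<comment> \<open>\<open>Pi_pmf\<close> returns \<open>undefined\<close> outside of its index set.
    Balls around vertices consist of vertices, so \<open>super_post\<close> cannot tell
    \<open>?U\<close> from \<open>U\<close> there.\<close>
  let ?U = "\<lambda>v. if v \<in> verts G then U v else undefined"
  have "Pi_pmf (verts G) undefined (\<lambda>v. pre i (U v)) = return_pmf ?U"
    using finite_verts assms(2) by (subst Pi_pmf_cong[OF refl refl, of _ _ "\<lambda>v. return_pmf (U v)"]) auto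
  moreover have "super_post i ?U v = super_post i U v" if "v \<in> verts G" for v
  proof -
    have "?U ` ball_of G L v = U ` ball_of G L v"
      using ball_of_subset[OF G, of v L] that verts_G by (intro image_cong) auto
    then show ?thesis using that unfolding super_post_def by auto
  qed
  ultimately show ?thesis
    using super_round[OF assms(1), of es] by (auto simp: rel_pmf_return_pmf2 boundary_def)
qed

lemma boundary_start: "boundary 0 (\<lambda>v. ini \<lparr>hi_id = v, hi_incident = incident G v,
    hi_skeleton = (if v \<in> verts S then Some (incident S v, H v, inp v) else None)\<rparr>) (hyb_start G S H inp sim)"
  by (simp add: boundary_def hyb_start_def sim_def)

end

end

section \<open>The state of a node\<close>

text \<open>\<open>Msg w i d pl\<close> is the \<open>i\<close>-th message of the skeleton node \<open>w\<close>, with payload \<open>pl\<close> and addressed to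
  the skeleton node of rank \<open>d\<close>. \<open>Slot w d j\<close> awaits the \<open>j\<close>-th message for \<open>w\<close>, which has rank \<open>d\<close>.\<close>

datatype cargo = Msg nat nat nat nat | Slot nat nat nat

instance cargo :: countable by countable_datatype

text \<open>The fields are: identifier; incident skeleton edges, helpers and input; rank and number
  of skeleton nodes; simulated state; outgoing messages with the ranks of their destinations; cargo;
  items on the wires; triples of destination rank, number and payload read off the slots. Sets
  appear as lists or \<open>fset\<close>, which keeps the type countable and hence storable.\<close>

datatype ust = Ust (uid: nat) (usk: "((nat \<times> nat) list \<times> nat list \<times> bits) option")
  (urk: nat) (unn: nat) (uac: "bits \<times> bits fset") (uout: "(nat \<times> ac_msg) list")
  (ucg: "cargo list") (uwr: "item list") (ures: "(nat \<times> nat \<times> nat) list")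

instance ust :: countable by countable_datatype

primrec set_wr where "set_wr x (Ust i s r N a out g w res) = Ust i s r N a out g x res"
primrec set_cg where "set_cg x (Ust i s r N a out g w res) = Ust i s r N a out x w res"
primrec set_res where "set_res x (Ust i s r N a out g w res) = Ust i s r N a out g w x"
primrec set_out where "set_out x (Ust i s r N a out g w res) = Ust i s r N a x g w res"
primrec set_ac where "set_ac x (Ust i s r N a out g w res) = Ust i s r N x out g w res"
primrec set_rank where "set_rank x y (Ust i s r N a out g w res) = Ust i s x y a out g w res"

lemma set_wr_simps [simp]:
  "uid (set_wr x u) = uid u" "usk (set_wr x u) = usk u" "urk (set_wr x u) = urk u" "unn (set_wr x u) = unn u"
  "uac (set_wr x u) = uac u" "uout (set_wr x u) = uout u" "ucg (set_wr x u) = ucg u" "uwr (set_wr x u) = x"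
  "ures (set_wr x u) = ures u" "set_wr x (set_wr y u) = set_wr x u" "set_wr (uwr u) u = u"
  by (cases u; simp)+

lemma set_cg_simps [simp]:
  "uid (set_cg x u) = uid u" "usk (set_cg x u) = usk u" "urk (set_cg x u) = urk u" "unn (set_cg x u) = unn u"
  "uac (set_cg x u) = uac u" "uout (set_cg x u) = uout u" "ucg (set_cg x u) = x" "uwr (set_cg x u) = uwr u"
  "ures (set_cg x u) = ures u"
  by (cases u; simp)+

lemma set_res_simps [simp]:
  "uid (set_res x u) = uid u" "usk (set_res x u) = usk u" "urk (set_res x u) = urk u" "unn (set_res x u) = unn u"
  "uac (set_res x u) = uac u" "uout (set_res x u) = uout u" "ucg (set_res x u) = ucg u" "uwr (set_res x u) = uwr u"
  "ures (set_res x u) = x"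
  by (cases u; simp)+

lemma set_out_simps [simp]:
  "uid (set_out x u) = uid u" "usk (set_out x u) = usk u" "urk (set_out x u) = urk u" "unn (set_out x u) = unn u"
  "uac (set_out x u) = uac u" "uout (set_out x u) = x" "ucg (set_out x u) = ucg u" "uwr (set_out x u) = uwr u"
  "ures (set_out x u) = ures u"
  by (cases u; simp)+

lemma set_ac_simps [simp]:
  "uid (set_ac x u) = uid u" "usk (set_ac x u) = usk u" "urk (set_ac x u) = urk u" "unn (set_ac x u) = unn u"
  "uac (set_ac x u) = x" "uout (set_ac x u) = uout u" "ucg (set_ac x u) = ucg u" "uwr (set_ac x u) = uwr u"
  "ures (set_ac x u) = ures u"
  by (cases u; simp)+

lemma set_rank_simps [simp]:
  "uid (set_rank x y u) = uid u" "usk (set_rank x y u) = usk u" "urk (set_rank x y u) = x" "unn (set_rank x y u) = y"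
  "uac (set_rank x y u) = uac u" "uout (set_rank x y u) = uout u" "ucg (set_rank x y u) = ucg u"
  "uwr (set_rank x y u) = uwr u" "ures (set_rank x y u) = ures u"
  by (cases u; simp)+

section \<open>Instructions\<close>

type_synonym instr = "(ust \<Rightarrow> ust pmf) \<times> nat \<times> (ust \<Rightarrow> ust fset \<Rightarrow> item list \<Rightarrow> ust)"

definition known_ball :: "wgraph \<Rightarrow> nat \<Rightarrow> (nat \<Rightarrow> ust) \<Rightarrow> nat \<Rightarrow> ust fset" where
  "known_ball G L U v = Abs_fset (U ` ball_of G L v)"

definition ustep :: "wgraph \<Rightarrow> nat \<Rightarrow> nat \<Rightarrow> nat \<Rightarrow> instr \<Rightarrow> (nat \<Rightarrow> ust) \<Rightarrow> nat \<Rightarrow> ust" where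
  "ustep G L B m = (\<lambda>(_, \<mu>, post) U v. post (U v) (known_ball G L U v)
     (if Suc (xor (v - 1) \<mu>) \<in> verts G
      then map (\<lambda>j. norm_item B (uwr (U (Suc (xor (v - 1) \<mu>))) ! j)) [0..<m] else []))"

text \<open>With mask 0 every node is its own partner, so the super-round serves for flooding and a
  local computation.\<close>

definition local_instr :: "(ust \<Rightarrow> ust fset \<Rightarrow> ust) \<Rightarrow> instr" where
  "local_instr f = (return_pmf, 0, \<lambda>u K _. f u K)"

text \<open>Wire \<open>(v - 1) * m + j\<close> is the \<open>j\<close>-th wire of node \<open>v\<close>.\<close>

definition stage_instr :: "nat \<Rightarrow> nat \<times> (nat \<Rightarrow> item \<Rightarrow> item \<Rightarrow> item) \<Rightarrow> instr" where
  "stage_instr m = (\<lambda>(\<mu>, g). (return_pmf, \<mu> div m, \<lambda>u _ r. set_wr (map (\<lambda>j. if r = [] then uwr u ! j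
     else g ((uid u - 1) * m + j) (uwr u ! j) (r ! xor j (\<mu> mod m))) [0..<m]) u))"

lemma ustep_local: "ustep G L B m (local_instr f) U v = f (U v) (known_ball G L U v)"
  by (simp add: ustep_def local_instr_def)

text \<open>The high bits of a mask act on the node and the low bits on the wire inside it, so one
  mask on wires pairs up whole nodes.\<close>

lemma xor_split:
  fixes w j \<mu> :: nat
  assumes "j < 2 ^ a"
  shows "xor (w * 2 ^ a + j) \<mu> = xor w (\<mu> div 2 ^ a) * 2 ^ a + xor j (\<mu> mod 2 ^ a)"
    and "xor j (\<mu> mod 2 ^ a) < 2 ^ a"
proof -
  show "xor j (\<mu> mod 2 ^ a) < 2 ^ a" using assms by (intro xor_less_power) auto
  let ?x = "xor (w * 2 ^ a + j) \<mu>"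
  have "drop_bit a ?x = xor w (\<mu> div 2 ^ a)"
    unfolding drop_bit_xor using assms by (simp add: drop_bit_eq_div)
  moreover have "take_bit a ?x = xor j (\<mu> mod 2 ^ a)"
    unfolding take_bit_xor using assms by (simp add: take_bit_eq_mod)
  ultimately show "?x = xor w (\<mu> div 2 ^ a) * 2 ^ a + xor j (\<mu> mod 2 ^ a)"
    by (metis drop_bit_eq_div take_bit_eq_mod div_mult_mod_eq)
qed

lemma block_index_less:
  fixes w j n m :: nat
  assumes "j < m"
  shows "w * m + j < n * m \<longleftrightarrow> w < n"
proof -
  have "(w * m + j) div m = w" using assms by simp
  then show ?thesis using assms by (metis div_less_iff_less_mult gr_implies_not0 neq0_conv)
qed

definition wires_are :: "nat \<Rightarrow> nat \<Rightarrow> (nat \<Rightarrow> ust) \<Rightarrow> (nat \<Rightarrow> item) \<Rightarrow> bool" where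
  "wires_are n m U f \<longleftrightarrow> (\<forall>w\<in>{1..n}. uid (U w) = w \<and> uwr (U w) = map (\<lambda>j. f ((w - 1) * m + j)) [0..<m])"

text \<open>As \<open>m\<close> is a power of two, all wires of a node have their partners at one
  node. They exist or are missing together, although \<open>n\<close> is arbitrary; a missing node
  shows as \<open>r = []\<close>. The bound on the items makes the encoding lossless.\<close>

lemma ustep_stage_instr:
  assumes m: "m = 2 ^ a" and G: "verts G = {1..n}" and wires: "wires_are n m U f"
    and bound: "\<And>p. p < n * m \<Longrightarrow> item_bound (2 ^ B) (f p)" and v: "v \<in> {1..n}"
  shows "ustep G L B m (stage_instr m (\<mu>, g)) U v =
    set_wr (map (\<lambda>j. stage (n * m) \<mu> g f ((v - 1) * m + j)) [0..<m]) (U v)"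
proof -
  let ?w = "Suc (xor (v - 1) (\<mu> div m))"
  have U: "uid (U w) = w" "uwr (U w) = map (\<lambda>j. f ((w - 1) * m + j)) [0..<m]" if "w \<in> {1..n}" for w
    using wires that unfolding wires_are_def by auto
  have iff: "xor ((v - 1) * m + j) \<mu> < n * m \<longleftrightarrow> ?w \<in> {1..n}" if "j < m" for j
    using xor_split(1)[of j a "v - 1" \<mu>] xor_split(2)[of j a \<mu>] that block_index_less[of "xor j (\<mu> mod m)" m] unfolding m by auto
  define r where "r = (if ?w \<in> verts G then map (\<lambda>j. norm_item B (uwr (U ?w) ! j)) [0..<m] else [])"
  have m0: "0 < m" unfolding m by simp
  have "(if r = [] then uwr (U v) ! j else g ((v - 1) * m + j) (uwr (U v) ! j) (r ! xor j (\<mu> mod m))) =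
      stage (n * m) \<mu> g f ((v - 1) * m + j)" if j: "j < m" for j
  proof (cases "?w \<in> {1..n}")
    case True
    let ?j = "xor j (\<mu> mod m)"
    have j': "?j < m" using xor_split(2)[of j a \<mu>] j unfolding m by simp
    have x: "xor ((v - 1) * m + j) \<mu> = (?w - 1) * m + ?j"
      using xor_split(1)[of j a "v - 1" \<mu>] j unfolding m by simp
    have lt: "(?w - 1) * m + ?j < n * m" using iff[OF j] True x by simp
    have uw: "uwr (U ?w) ! ?j = f ((?w - 1) * m + ?j)" using U(2)[OF True] j' by simp
    have "r ! ?j = f (xor ((v - 1) * m + j) \<mu>)"
      using True j' norm_item_id[OF bound[OF lt]] uw unfolding r_def G x by simp
    moreover have "r \<noteq> []" using True m0 unfolding r_def G by simp
    ultimately show ?thesis using j U(2)[OF v] lt x by (simp add: stage_def)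
  next
    case False
    then show ?thesis using j U(2)[OF v] iff[OF j] unfolding r_def G by (simp add: stage_def)
  qed
  then show ?thesis
    unfolding ustep_def stage_instr_def prod.case r_def[symmetric] U(1)[OF v]
    by (intro arg_cong2[where f = set_wr]) (auto intro!: map_cong)
qed

lemma fold_stage_instrs:
  assumes m: "m = 2 ^ a" and G: "verts G = {1..n}"
  assumes "wires_are n m U f" "\<And>p. p < n * m \<Longrightarrow> item_bound (2 ^ B) (f p)"
    and "\<And>\<mu> g p x y. (\<mu>, g) \<in> set xs \<Longrightarrow> p < n * m \<Longrightarrow> item_bound (2 ^ B) x \<Longrightarrow> item_bound (2 ^ B) y \<Longrightarrow>
      item_bound (2 ^ B) (g p x y)"
    and "v \<in> {1..n}"
  shows "fold (ustep G L B m) (map (stage_instr m) xs) U v =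
    set_wr (map (\<lambda>j. run_stages (n * m) xs f ((v - 1) * m + j)) [0..<m]) (U v)"
  using assms(3-)
proof (induction xs arbitrary: U f)
  case Nil
  then have "uwr (U v) = map (\<lambda>j. f ((v - 1) * m + j)) [0..<m]" unfolding wires_are_def by auto
  then show ?case by (metis fold_simps(1) id_apply list.simps(8) run_stages_simps(1) set_wr_simps(11))
next
  case (Cons x xs)
  obtain \<mu> g where x: "x = (\<mu>, g)" by force
  let ?U = "ustep G L B m (stage_instr m x) U"
  let ?f = "stage (n * m) \<mu> g f"
  have step: "?U w = set_wr (map (\<lambda>j. ?f ((w - 1) * m + j)) [0..<m]) (U w)" if "w \<in> {1..n}" for w
    unfolding x by (rule ustep_stage_instr[OF m G Cons.prems(1,2) that])
  have "fold (ustep G L B m) (map (stage_instr m) xs) ?U v =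
    set_wr (map (\<lambda>j. run_stages (n * m) xs ?f ((v - 1) * m + j)) [0..<m]) (?U v)"
  proof (rule Cons.IH)
    show "wires_are n m ?U ?f"
      using step Cons.prems(1) unfolding wires_are_def by simp
    show "item_bound (2 ^ B) (?f p)" if "p < n * m" for p
      using Cons.prems(2)[of p] Cons.prems(2)[of "xor p \<mu>"] Cons.prems(3)[of \<mu> g p "f p" "f (xor p \<mu>)"] that x
      by (simp add: stage_def)
    show "item_bound (2 ^ B) (g' p y z)"
      if "(\<mu>', g') \<in> set xs" "p < n * m" "item_bound (2 ^ B) y" "item_bound (2 ^ B) z" for \<mu>' g' p y z
      using Cons.prems(3)[of \<mu>' g' p y z] that by simp
    show "v \<in> {1..n}" by fact
  qed
  then show ?case using step[OF Cons.prems(4)] unfolding x by simp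
qed

lemma fold_op_instrs:
  assumes m: "m = 2 ^ a" and G: "verts G = {1..n}" and wires: "wires_are n m U f"
    and bound: "\<And>p. p < n * m \<Longrightarrow> item_bound (2 ^ B) (f p)" and W: "n * m \<le> 2 ^ B"
    and F: "\<And>p a. p < n * m \<Longrightarrow> a < 2 ^ B \<Longrightarrow> F p a < 2 ^ B" and v: "v \<in> {1..n}"
  shows "fold (ustep G L B m) (map (stage_instr m) (op_stages q F)) U v =
    set_wr (map (\<lambda>j. run_stages (n * m) (op_stages q F) f ((v - 1) * m + j)) [0..<m]) (U v)"
  by (rule fold_stage_instrs[OF m G wires bound _ v])
    (use op_stages_item_bound[where X = "2 ^ B" and W = "n * m"] W F in blast)+

section \<open>Routing the messages of one round\<close>

text \<open>The order depends on the set alone. So a node that computes its set of cargo also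
  obtains the order used in the abstract description below.\<close>

definition listing :: "'a set \<Rightarrow> 'a list" where
  "listing S = (SOME xs. set xs = S \<and> distinct xs)"

lemma listing: "finite S \<Longrightarrow> set (listing S) = S" "finite S \<Longrightarrow> distinct (listing S)"
  using someI_ex[of "\<lambda>xs. set xs = S \<and> distinct xs"] finite_distinct_list[of S]
  unfolding listing_def by blast+

lemma length_listing: "finite S \<Longrightarrow> length (listing S) = card S"
  using listing[of S] distinct_card by metis

text \<open>Slots and idle wires get the group \<open>n\<close>, which lies above the ranks of all
  destinations and so leaves the counts of messages undisturbed.\<close>

definition group_at :: "nat \<Rightarrow> cargo list \<Rightarrow> nat \<Rightarrow> nat" where
  "group_at n xs j = (if j < length xs then (case xs ! j of Msg w i d pl \<Rightarrow> d | Slot w d i \<Rightarrow> n) else n)"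

text \<open>The message with number \<open>ix\<close> for the node of rank \<open>d\<close> gets an even key, and the slot that awaits it gets
  the next key. Hence the prefix maximum at the slot is the value of that message, if there is one.\<close>

definition match_item :: "nat \<Rightarrow> nat \<Rightarrow> nat \<Rightarrow> nat \<Rightarrow> nat \<Rightarrow> cargo list \<Rightarrow> nat \<Rightarrow> item \<Rightarrow> item" where
  "match_item n c P W p xs j x = (case x of (_, _, pos, pm) \<Rightarrow>
     let ix = pos - (W - 1 - pm mod W); idle = (2 * (n * c) + p, p, 0, 0) in
     if j < length xs then
       (case xs ! j of
          Msg w i d pl \<Rightarrow> if ix < c then (2 * (d * c + ix), p, (d * c + ix + 1) * P + pl, 0) else idle
        | Slot w d i \<Rightarrow> (2 * (d * c + i) + 1, p, 0, 0))
     else idle)"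

text \<open>A slot is filled only if the quotient is its own code plus one. Any other quotient means
  that no message with its code exists.\<close>

definition read_slots :: "nat \<Rightarrow> nat \<Rightarrow> cargo list \<Rightarrow> item list \<Rightarrow> (nat \<times> nat \<times> nat) list" where
  "read_slots c P xs ws = concat (map (\<lambda>j. case xs ! j of Msg w i d pl \<Rightarrow> []
     | Slot w d i \<Rightarrow> (case ws ! j of (_, _, _, pm) \<Rightarrow>
         if pm div P = d * c + i + 1 then [(d, i, pm mod P)] else [])) [0..<length xs])"

text \<open>The routing of one round as deterministic combinatorics: the message lists are already
  truncated to \<open>c\<close> and addressed by ranks.\<close>

locale routing =
  fixes n a c N B P q :: nat
    and M :: "nat set" and hl :: "nat \<Rightarrow> nat list" and rk :: "nat \<Rightarrow> nat"
    and ms :: "nat \<Rightarrow> (nat \<times> ac_msg) list" and pay :: "nat \<Rightarrow> nat \<Rightarrow> nat"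
  assumes M: "M \<subseteq> {1..n}" and N: "N \<le> n"
    and hl: "\<And>w. w \<in> M \<Longrightarrow> hl w \<noteq> [] \<and> set (hl w) \<subseteq> {1..n}"
    and rk: "bij_betw rk M {..<N}"
    and ms: "\<And>w. w \<in> M \<Longrightarrow> length (ms w) \<le> c" "\<And>w i. w \<in> M \<Longrightarrow> i < length (ms w) \<Longrightarrow> fst (ms w ! i) < N"
    and pay: "\<And>w i. w \<in> M \<Longrightarrow> i < length (ms w) \<Longrightarrow> pay w i < P"
begin

abbreviation "m \<equiv> (2 :: nat) ^ a"
abbreviation "W \<equiv> n * 2 ^ a"

text \<open>Messages and slots are dealt out to the helpers in turn, which keeps the load
  even.\<close>

definition helper :: "nat \<Rightarrow> nat \<Rightarrow> nat" where
  "helper w i = hl w ! (i mod length (hl w))"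

definition issued :: "(nat \<times> nat) set" where
  "issued = {(w, i). w \<in> M \<and> i < length (ms w)}"

definition dst :: "nat \<times> nat \<Rightarrow> nat" where
  "dst = (\<lambda>(w, i). fst (ms w ! i))"

definition msg_of :: "nat \<times> nat \<Rightarrow> cargo" where
  "msg_of = (\<lambda>(w, i). Msg w i (fst (ms w ! i)) (pay w i))"

definition cargo_for :: "nat \<Rightarrow> cargo set" where
  "cargo_for v = msg_of ` {(w, i) \<in> issued. helper w i = v} \<union>
     {Slot w (rk w) j | w j. w \<in> M \<and> j < c \<and> helper w j = v}"

definition cg :: "nat \<Rightarrow> cargo list" where
  "cg v = listing (cargo_for v)"

definition grp :: "nat \<Rightarrow> nat" where
  "grp p = group_at n (cg (p div m + 1)) (p mod m)"

definition cat :: "nat \<Rightarrow> cargo option" where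
  "cat p = (if p mod m < length (cg (p div m + 1)) then Some (cg (p div m + 1) ! (p mod m)) else None)"

definition home :: "cargo \<Rightarrow> nat" where
  "home x = (THE p. p < W \<and> cat p = Some x)"

text \<open>The number that the first operation on the wires will assign: messages for one
  destination are ordered by their home wires.\<close>

definition place :: "nat \<times> nat \<Rightarrow> nat" where
  "place b = card {b' \<in> issued. dst b' = dst b \<and> home (msg_of b') < home (msg_of b)}"

definition accepted :: "(nat \<times> nat) set" where
  "accepted = {b \<in> issued. place b < c}"

definition match_f :: "nat \<Rightarrow> item" where
  "match_f p = match_item n c P W p (cg (p div m + 1)) (p mod m)
     (p, p, start_of W grp p + index_of grp p, grp p * W + (W - 1 - start_of W grp p))"

definition res_f :: "nat \<Rightarrow> item" where
  "res_f = run_stages W (op_stages q (\<lambda>p a. a)) match_f"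

lemma finite_M: "finite M" using M finite_subset by blast

lemma finite_issued: "finite issued"
  by (rule finite_subset[of _ "M \<times> {..<c}"]) (use ms(1) finite_M in \<open>fastforce simp: issued_def\<close>)+

lemma finite_cargo: "finite (cargo_for v)"
proof -
  have "finite {Slot w (rk w) j | w j. w \<in> M \<and> j < c \<and> helper w j = v}"
    by (rule finite_subset[of _ "(\<lambda>(w, j). Slot w (rk w) j) ` (M \<times> {..<c})"]) (use finite_M in auto)
  moreover have "finite {(w, i) \<in> issued. helper w i = v}"
    by (rule finite_subset[OF _ finite_issued]) auto
  ultimately show ?thesis unfolding cargo_for_def by blast
qed

lemma set_cg: "set (cg v) = cargo_for v" "distinct (cg v)" "length (cg v) = card (cargo_for v)"
  unfolding cg_def using listing[OF finite_cargo] length_listing[OF finite_cargo] by auto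

lemma helper_in: "w \<in> M \<Longrightarrow> helper w i \<in> {1..n}"
  using hl[of w] unfolding helper_def by (meson length_greater_0_conv mod_less_divisor nth_mem subsetD)

text \<open>Cargo determines the node that carries it; hence no cargo sits on the wires of two
  nodes.\<close>

definition owner :: "cargo \<Rightarrow> nat" where
  "owner x = (case x of Msg w i d pl \<Rightarrow> helper w i | Slot w d j \<Rightarrow> helper w j)"

lemma owner: "x \<in> cargo_for v \<Longrightarrow> owner x = v"
  by (auto simp: cargo_for_def owner_def msg_of_def)

lemma cat_in:
  assumes "cat p = Some x"
  shows "x \<in> cargo_for (p div m + 1)"
  using assms nth_mem set_cg(1) unfolding cat_def by (metis option.distinct(1) option.inject)

lemma cat_inj:
  assumes "cat p = Some x" "cat p' = Some x"
  shows "p = p'"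
proof -
  have d: "p div m = p' div m"
    using owner[OF cat_in[OF assms(1)]] owner[OF cat_in[OF assms(2)]] by simp
  have "p mod m < length (cg (p div m + 1))" "p' mod m < length (cg (p div m + 1))"
    "cg (p div m + 1) ! (p mod m) = cg (p div m + 1) ! (p' mod m)"
    using assms unfolding cat_def d by (auto split: if_splits)
  then have "p mod m = p' mod m" using set_cg(2) nth_eq_iff_index_eq by blast
  with d show ?thesis by (metis div_mult_mod_eq)
qed

section \<open>Correctness of the routing when every node has enough wires\<close>

context
  assumes size: "\<forall>v\<in>{1..n}. card (cargo_for v) \<le> m"
begin

lemma home:
  assumes "x \<in> cargo_for v" "v \<in> {1..n}"
  shows "home x < W" "cat (home x) = Some x" "home x div m + 1 = v"
proof -
  obtain j where j: "j < length (cg v)" "cg v ! j = x"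
    using assms(1) set_cg(1) by (metis in_set_conv_nth)
  have jm: "j < m" using j(1) bspec[OF size assms(2)] set_cg(3)[of v] by simp
  let ?p = "(v - 1) * m + j"
  have p: "?p div m + 1 = v" "?p mod m = j" using jm assms(2) by auto
  have "?p < W" using block_index_less[OF jm, of "v - 1" n] assms(2) by auto
  moreover have "cat ?p = Some x" unfolding cat_def p using j by simp
  ultimately have "home x = ?p" unfolding home_def using cat_inj by (intro the_equality) auto
  then show "home x < W" "cat (home x) = Some x" "home x div m + 1 = v"
    using \<open>?p < W\<close> \<open>cat ?p = Some x\<close> p by auto
qed

lemma home_eq: "p < W \<Longrightarrow> cat p = Some x \<Longrightarrow> home x = p"
  unfolding home_def using cat_inj by (intro the_equality) auto

lemma msg_cargo: "b \<in> issued \<Longrightarrow> msg_of b \<in> cargo_for (helper (fst b) (snd b))"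
  by (auto simp: cargo_for_def case_prod_unfold)

lemma home_msg:
  assumes "b \<in> issued"
  shows "home (msg_of b) < W" "cat (home (msg_of b)) = Some (msg_of b)"
  using home[OF msg_cargo[OF assms] helper_in] assms by (auto simp: issued_def)

lemma inj_home_msg: "inj_on (\<lambda>b. home (msg_of b)) issued"
proof (rule inj_onI)
  fix b b' assume "b \<in> issued" "b' \<in> issued" "home (msg_of b) = home (msg_of b')"
  then have "msg_of b = msg_of b'" using home_msg(2) by (metis option.inject)
  then show "b = b'" by (auto simp: msg_of_def split: prod.splits)
qed

lemma grp_cat: "grp p = (case cat p of Some (Msg w i d pl) \<Rightarrow> d | _ \<Rightarrow> n)"
  unfolding grp_def group_at_def cat_def by (auto split: cargo.splits)

lemma cat_msg: "cat p = Some (Msg w i d pl) \<Longrightarrow> (w, i) \<in> issued \<and> msg_of (w, i) = Msg w i d pl \<and> d = dst (w, i) \<and> pl = pay w i"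
  using cat_in[of p "Msg w i d pl"] by (auto simp: cargo_for_def msg_of_def dst_def)

lemma cat_slot: "cat p = Some (Slot w d j) \<Longrightarrow> w \<in> M \<and> d = rk w \<and> j < c \<and> helper w j = p div m + 1"
  using cat_in[of p "Slot w d j"] by (auto simp: cargo_for_def msg_of_def)

lemma dst_less: "b \<in> issued \<Longrightarrow> dst b < N"
  using ms(2) by (auto simp: issued_def dst_def)

lemma grp_less: "grp p \<le> n"
  unfolding grp_cat using dst_less N by (fastforce split: option.splits cargo.splits dest: cat_msg)

lemma grp_msg: "b \<in> issued \<Longrightarrow> grp (home (msg_of b)) = dst b"
  unfolding grp_cat using home_msg(2)[of b] by (auto simp: msg_of_def dst_def split: prod.splits)

text \<open>All wires in a group below \<open>n\<close> carry messages, so counting the earlier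
  wires of the group counts messages for the same destination.\<close>

lemma index_place:
  assumes b: "b \<in> issued"
  shows "index_of grp (home (msg_of b)) = place b"
proof -
  let ?h = "\<lambda>b. home (msg_of b)"
  have "{y \<in> {..<?h b}. grp y = grp (?h b)} = ?h ` {b' \<in> issued. dst b' = dst b \<and> ?h b' < ?h b}"
  proof (intro equalityI subsetI)
    fix y assume y: "y \<in> {y \<in> {..<?h b}. grp y = grp (?h b)}"
    then have yW: "y < W" using home_msg(1)[OF b] by simp
    have "grp y < n" using y grp_msg[OF b] dst_less[OF b] N by simp
    then obtain w i d pl where cy: "cat y = Some (Msg w i d pl)"
      unfolding grp_cat by (auto split: option.splits cargo.splits)
    from cat_msg[OF cy] have "(w, i) \<in> issued" "?h (w, i) = y" "dst (w, i) = grp y"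
      using home_eq[OF yW cy] cy by (auto simp: grp_cat)
    then show "y \<in> ?h ` {b' \<in> issued. dst b' = dst b \<and> ?h b' < ?h b}"
      using y grp_msg[OF b] by (intro image_eqI[of _ _ "(w, i)"]) auto
  qed (use grp_msg b in auto)
  moreover have "inj_on ?h {b' \<in> issued. dst b' = dst b \<and> ?h b' < ?h b}"
    by (rule inj_on_subset[OF inj_home_msg]) auto
  ultimately show ?thesis unfolding index_of_def place_def by (simp add: card_image)
qed

lemma place_position: "b \<in> issued \<Longrightarrow>
    place b = position_in {b' \<in> issued. dst b' = dst b} (\<lambda>b. home (msg_of b)) b"
  unfolding place_def position_in_def by (auto intro!: arg_cong[where f = card])

lemma place_inj:
  assumes "b \<in> issued" "b' \<in> issued" "dst b = dst b'" "place b = place b'"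
  shows "b = b'"
proof -
  have "bij_betw (position_in {b'' \<in> issued. dst b'' = dst b'} (\<lambda>b. home (msg_of b)))
      {b'' \<in> issued. dst b'' = dst b'} {..<card {b'' \<in> issued. dst b'' = dst b'}}"
    by (rule position_in_bij) (use finite_issued inj_home_msg in \<open>auto intro: inj_on_subset\<close>)
  then show ?thesis
    using assms place_position[OF assms(1)] place_position[OF assms(2)]
    by (auto simp: bij_betw_def dest: inj_onD)
qed

lemma card_accepted: "card {b \<in> accepted. dst b = d} = min c (card {b \<in> issued. dst b = d})"
proof -
  have "card {b \<in> {b \<in> issued. dst b = d}. position_in {b \<in> issued. dst b = d} (\<lambda>b. home (msg_of b)) b < c} =
      min c (card {b \<in> issued. dst b = d})"
    by (rule card_first) (use finite_issued inj_home_msg in \<open>auto intro: inj_on_subset\<close>)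
  moreover have "{b \<in> accepted. dst b = d} =
      {b \<in> {b \<in> issued. dst b = d}. position_in {b \<in> issued. dst b = d} (\<lambda>b. home (msg_of b)) b < c}"
    using place_position unfolding accepted_def by auto
  ultimately show ?thesis by simp
qed

lemma group_wires:
  assumes W: "W \<le> 2 ^ q" and X: "(n + 1) * W \<le> 2 ^ B" and p: "p < W"
  shows "run_stages W (op_stages q (group_value W (2 ^ B))) (\<lambda>p. (grp p * W + p, p, grp p, 0)) p =
    (p, p, start_of W grp p + index_of grp p, grp p * W + (W - 1 - start_of W grp p))"
proof (rule group_op[OF W p])
  show "(grp p + 1) * W \<le> 2 ^ B" for p
    using mult_le_mono1[of "grp p + 1" "n + 1" W] grp_less[of p] X by linarith
qed simp

lemma start_less: "p < W \<Longrightarrow> start_of W grp p < W"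
  unfolding start_of_def by (rule less_le_trans[OF psubset_card_mono[of "{..<W}"]]) auto

text \<open>The residue of the prefix maximum modulo \<open>W\<close> is \<open>W - 1\<close> minus
  the start of the group. Subtracting this start from the rank leaves the index.\<close>

lemma match_f_cat:
  assumes p: "p < W"
  shows "match_f p = (case cat p of None \<Rightarrow> (2 * (n * c) + p, p, 0, 0)
    | Some (Msg w i d pl) \<Rightarrow> if index_of grp p < c
        then (2 * (d * c + index_of grp p), p, (d * c + index_of grp p + 1) * P + pl, 0)
        else (2 * (n * c) + p, p, 0, 0)
    | Some (Slot w d i) \<Rightarrow> (2 * (d * c + i) + 1, p, 0, 0))"
proof -
  have "(grp p * W + (W - 1 - start_of W grp p)) mod W = W - 1 - start_of W grp p"
    using p by simp
  moreover have "W - 1 - (W - 1 - start_of W grp p) = start_of W grp p"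
    using start_less[OF p] by simp
  ultimately have "start_of W grp p + index_of grp p -
      (W - 1 - (grp p * W + (W - 1 - start_of W grp p)) mod W) = index_of grp p"
    by simp
  then show ?thesis
    unfolding match_f_def match_item_def cat_def Let_def prod.case by (auto split: cargo.splits)
qed

text \<open>\<open>match_op\<close> is applied to the accepted messages and the slots, with the code
  \<open>d * c + j\<close> for the message number \<open>j\<close> to rank \<open>d\<close>. All
  numbers involved are below \<open>c\<close>, so the code determines the pair.\<close>

lemma slot_res:
  assumes W: "W \<le> 2 ^ q" and p: "p < W" and slot: "cat p = Some (Slot w d j)"
  obtains r pm where "res_f p = (p, p, r, pm)"
    "pm div P = d * c + j + 1 \<longleftrightarrow> (\<exists>b\<in>accepted. dst b = d \<and> place b = j)"
    "\<And>b. b \<in> accepted \<Longrightarrow> dst b = d \<Longrightarrow> place b = j \<Longrightarrow> pm mod P = pay (fst b) (snd b)"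
proof -
  let ?h = "\<lambda>b. home (msg_of b)"
  define A where "A = ?h ` accepted"
  define S where "S = {p. p < W \<and> (\<exists>w d j. cat p = Some (Slot w d j))}"
  define code where "code p = (case cat p of Some (Msg w i d pl) \<Rightarrow> d * c + index_of grp p
    | Some (Slot w d j) \<Rightarrow> d * c + j | None \<Rightarrow> 0)" for p
  define pl where "pl p = (case cat p of Some (Msg w i d pl) \<Rightarrow> pl | _ \<Rightarrow> 0)" for p
  have acc: "accepted \<subseteq> issued" by (auto simp: accepted_def)
  have A: "cat (?h b) = Some (msg_of b)" "code (?h b) = dst b * c + place b" "pl (?h b) = pay (fst b) (snd b)"
    "place b < c" "?h b < W" if "b \<in> accepted" for b
    using that home_msg[of b] index_place[of b] acc
    by (auto simp: code_def pl_def msg_of_def dst_def accepted_def split: prod.splits)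
  have dc: "d * c + j = d' * c + j' \<Longrightarrow> j < c \<Longrightarrow> j' < c \<Longrightarrow> d = d' \<and> j = j'" for d d' j j'
    by (metis block_le_iff(1) less_irrefl linorder_neqE_nat)
  have dcn: "d * c + j < n * c" if "d < N" "j < c" for d j
    using block_le_iff(1)[of j c 0 d n] that N by simp
  have rkN: "rk w < N" if "w \<in> M" for w using rk that by (auto simp: bij_betw_def)
  have f: "match_f p = (if p \<in> A then 2 * code p else if p \<in> S then 2 * code p + 1 else 2 * (n * c) + p, p,
       if p \<in> A then (code p + 1) * P + pl p else 0, 0)" if p: "p < W" for p
  proof (cases "cat p")
    case None
    have "p \<notin> A" "p \<notin> S" using None A(1) by (auto simp: A_def S_def)
    then show ?thesis unfolding match_f_cat[OF p] using None by simp
  next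
    case (Some x)
    show ?thesis
    proof (cases x)
      case (Msg w i d l)
      have c: "(w, i) \<in> issued" "msg_of (w, i) = x" "?h (w, i) = p"
        using cat_msg[of p w i d l] Some Msg home_eq[OF p Some] by auto
      have "p \<in> A \<longleftrightarrow> index_of grp p < c"
      proof
        assume "p \<in> A"
        then obtain b where "b \<in> accepted" "p = ?h b" by (auto simp: A_def)
        then show "index_of grp p < c" using index_place[of b] acc A(4)[of b] by auto
      next
        assume "index_of grp p < c"
        then have "(w, i) \<in> accepted" using c index_place[OF c(1)] by (auto simp: accepted_def)
        then show "p \<in> A" using c(3) unfolding A_def by (metis image_eqI)
      qed
      moreover have "p \<notin> S" using Some Msg by (auto simp: S_def)
      ultimately show ?thesis unfolding match_f_cat[OF p] using Some Msg by (simp add: code_def pl_def)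
    next
      case (Slot w d j)
      have "p \<notin> A" using Some Slot A(1) by (auto simp: A_def msg_of_def split: prod.splits)
      moreover have "p \<in> S" using Some Slot p by (auto simp: S_def)
      ultimately show ?thesis unfolding match_f_cat[OF p] using Some Slot by (simp add: code_def)
    qed
  qed
  have pS: "p \<in> S" using p slot by (auto simp: S_def)
  have code_p: "code p = d * c + j" using slot by (simp add: code_def)
  have sl: "w \<in> M" "d = rk w" "j < c" using cat_slot[OF slot] by auto
  have P0: "0 < P" if "b \<in> accepted" for b
    using pay[of "fst b" "snd b"] that acc by (auto simp: issued_def)
  obtain r pm where run: "run_stages W (op_stages q (\<lambda>p a. a)) match_f p = (p, p, r, pm)"
    "\<And>y. y \<in> A \<Longrightarrow> code y = code p \<Longrightarrow> pm = (code p + 1) * P + pl y"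
    "(\<forall>y\<in>A. code y \<noteq> code p) \<Longrightarrow> pm div P \<noteq> code p + 1"
  proof (rule match_op[where A = A and B = S and code = code and pl = pl and Y = "n * c" and P = P
        and c = "\<lambda>_. 0" and f = match_f, OF W _ _ _ _ _ _ _ f pS])
    show "A \<subseteq> {..<W}" "S \<subseteq> {..<W}" using A(5) by (auto simp: A_def S_def)
    show "A \<inter> S = {}" using A(1) by (auto simp: A_def S_def msg_of_def split: prod.splits)
    show "inj_on code A"
    proof (rule inj_onI)
      fix y y' assume "y \<in> A" "y' \<in> A" "code y = code y'"
      then obtain b b' where b: "b \<in> accepted" "b' \<in> accepted" "y = ?h b" "y' = ?h b'" by (auto simp: A_def)
      then have "dst b = dst b' \<and> place b = place b'"
        using A(2,4) \<open>code y = code y'\<close> by (intro dc) auto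
      then show "y = y'" using place_inj b acc by blast
    qed
    show "inj_on code S"
    proof (rule inj_onI)
      fix y y' assume y: "y \<in> S" "y' \<in> S" "code y = code y'"
      then obtain w d j w' d' j' where c: "cat y = Some (Slot w d j)" "cat y' = Some (Slot w' d' j')"
        by (auto simp: S_def)
      have "d = d' \<and> j = j'"
        using y(3) cat_slot[OF c(1)] cat_slot[OF c(2)] c by (intro dc) (auto simp: code_def)
      moreover have "w = w'"
        using calculation cat_slot[OF c(1)] cat_slot[OF c(2)] rk by (auto simp: bij_betw_def dest: inj_onD)
      ultimately show "y = y'" using cat_inj c by blast
    qed
    show "code y < n * c" if yAS: "y \<in> A \<union> S" for y
    proof (cases "y \<in> A")
      case True
      then show ?thesis using A(2,4) dcn dst_less acc by (auto simp: A_def)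
    next
      case False
      then obtain w d j where "cat y = Some (Slot w d j)" using yAS unfolding S_def by auto
      then show ?thesis using cat_slot[of y w d j] dcn rkN by (simp add: code_def)
    qed
    show "pl y < P" if yA: "y \<in> A" for y
    proof -
      obtain b where b: "b \<in> accepted" "y = ?h b" using yA by (auto simp: A_def)
      then show ?thesis using A(3)[OF b(1)] pay[of "fst b" "snd b"] acc by (auto simp: issued_def)
    qed
  qed auto
  show thesis
  proof (rule that)
    show "res_f p = (p, p, r, pm)" unfolding res_f_def using run(1) .
    have hit: "pm = (d * c + j + 1) * P + pay (fst b) (snd b)" if "b \<in> accepted" "dst b = d" "place b = j" for b
      using run(2)[of "?h b"] that A[OF that(1)] code_p by (auto simp: A_def)
    have payP: "pay (fst b) (snd b) < P" if "b \<in> accepted" for b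
      using pay[of "fst b" "snd b"] that acc by (auto simp: issued_def)
    show "pm mod P = pay (fst b) (snd b)" if "b \<in> accepted" "dst b = d" "place b = j" for b
      unfolding hit[OF that] using payP[OF that(1)] by (simp del: mult_Suc add: mod_mult_self3)
    show "pm div P = d * c + j + 1 \<longleftrightarrow> (\<exists>b\<in>accepted. dst b = d \<and> place b = j)"
    proof
      assume "\<exists>b\<in>accepted. dst b = d \<and> place b = j"
      then obtain b where b: "b \<in> accepted" "dst b = d" "place b = j" by blast
      show "pm div P = d * c + j + 1"
        unfolding hit[OF b] using payP[OF b(1)] by (simp del: mult_Suc)
    next
      assume "pm div P = d * c + j + 1"
      then obtain y where y: "y \<in> A" "code y = code p" using run(3) code_p by auto
      then obtain b where "b \<in> accepted" "y = ?h b" by (auto simp: A_def)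
      then show "\<exists>b\<in>accepted. dst b = d \<and> place b = j"
        using dc[of "dst b" "place b" d j] A[of b] y(2) code_p sl(3) by auto
    qed
  qed
qed

lemma read_slots_eq:
  assumes W: "W \<le> 2 ^ q" and v: "v \<in> {1..n}"
  shows "set (read_slots c P (cg v) (map (\<lambda>j. res_f ((v - 1) * m + j)) [0..<m])) =
    {(dst b, place b, pay (fst b) (snd b)) | b. b \<in> accepted \<and>
       (\<exists>w\<in>M. dst b = rk w \<and> helper w (place b) = v)}"
    (is "?L = ?R")
proof -
  have lm: "length (cg v) \<le> m" using bspec[OF size v] set_cg(3) by simp
  have wire: "((v - 1) * m + j) div m + 1 = v" "((v - 1) * m + j) mod m = j" "(v - 1) * m + j < W"
    if "j < length (cg v)" for j
  proof -
    have j: "j < m" using that lm by simp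
    show "((v - 1) * m + j) div m + 1 = v" "((v - 1) * m + j) mod m = j" using j v by auto
    show "(v - 1) * m + j < W" using block_index_less[OF j, of "v - 1" n] v by auto
  qed
  have cat: "cat ((v - 1) * m + j) = Some (cg v ! j)" if "j < length (cg v)" for j
    unfolding cat_def wire[OF that] using that by simp
  show ?thesis
  proof (intro equalityI subsetI)
    fix x assume "x \<in> ?L"
    then obtain j where "j \<in> set [0..<length (cg v)]" "x \<in> set (case cg v ! j of Msg w i d pl \<Rightarrow> []
     | Slot w d i \<Rightarrow> (case map (\<lambda>j. res_f ((v - 1) * m + j)) [0..<m] ! j of (_, _, _, pm) \<Rightarrow>
         if pm div P = d * c + i + 1 then [(d, i, pm mod P)] else []))"
      unfolding read_slots_def set_concat set_map by blast
    then have j: "j < length (cg v)" and x: "x \<in> set (case cg v ! j of Msg w i d pl \<Rightarrow> []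
     | Slot w d i \<Rightarrow> (case res_f ((v - 1) * m + j) of (_, _, _, pm) \<Rightarrow>
         if pm div P = d * c + i + 1 then [(d, i, pm mod P)] else []))"
      using lm by auto
    then obtain w d i where s: "cg v ! j = Slot w d i" by (cases "cg v ! j") auto
    obtain r pm where r: "res_f ((v - 1) * m + j) = ((v - 1) * m + j, (v - 1) * m + j, r, pm)"
      "pm div P = d * c + i + 1 \<longleftrightarrow> (\<exists>b\<in>accepted. dst b = d \<and> place b = i)"
      "\<And>b. b \<in> accepted \<Longrightarrow> dst b = d \<Longrightarrow> place b = i \<Longrightarrow> pm mod P = pay (fst b) (snd b)"
      using slot_res[OF W wire(3)[OF j] cat[OF j, unfolded s]] by metis
    from x s r(1) have x': "pm div P = d * c + i + 1" "x = (d, i, pm mod P)" by (auto split: if_splits)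
    then obtain b where "b \<in> accepted" "dst b = d" "place b = i" using r(2) by auto
    moreover have "w \<in> M" "d = rk w" "helper w i = v"
      using cat_slot[OF cat[OF j, unfolded s]] wire[OF j] by auto
    ultimately show "x \<in> ?R" using x' r(3) by (intro CollectI exI[of _ b]) auto
  next
    fix x assume "x \<in> ?R"
    then obtain b w where b: "x = (dst b, place b, pay (fst b) (snd b))" "b \<in> accepted" "w \<in> M"
      "dst b = rk w" "helper w (place b) = v" by auto
    then have "Slot w (rk w) (place b) \<in> cargo_for v"
      by (auto simp: cargo_for_def accepted_def)
    then obtain j where j: "j < length (cg v)" "cg v ! j = Slot w (rk w) (place b)"
      using set_cg(1) by (metis in_set_conv_nth)
    obtain r pm where r: "res_f ((v - 1) * m + j) = ((v - 1) * m + j, (v - 1) * m + j, r, pm)"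
      "pm div P = rk w * c + place b + 1 \<longleftrightarrow> (\<exists>b'\<in>accepted. dst b' = rk w \<and> place b' = place b)"
      "\<And>b'. b' \<in> accepted \<Longrightarrow> dst b' = rk w \<Longrightarrow> place b' = place b \<Longrightarrow> pm mod P = pay (fst b') (snd b')"
      using slot_res[OF W wire(3)[OF j(1)] cat[OF j(1), unfolded j(2)]] by metis
    have "pm div P = rk w * c + place b + 1" "pm mod P = pay (fst b) (snd b)"
      using r(2,3) b by auto
    then show "x \<in> ?L"
      unfolding read_slots_def using j r(1) b(1,4) lm by (auto intro!: bexI[of _ j])
  qed
qed

end

end

section \<open>Tokens and message codes\<close>

text \<open>Bijective binary numeration with the digits 1 (\<open>True\<close>) and 2
  (\<open>False\<close>). It has no leading zeros, so injectivity needs no padding.\<close>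

fun nat_bits :: "nat \<Rightarrow> bits" where
  "nat_bits r = (if r = 0 then [] else odd r # nat_bits ((r - 1) div 2))"

declare nat_bits.simps [simp del]

lemma nat_bits_0 [simp]: "nat_bits 0 = []" by (simp add: nat_bits.simps)

lemma nat_bits_pos: "0 < r \<Longrightarrow> nat_bits r = odd r # nat_bits ((r - 1) div 2)"
  by (simp add: nat_bits.simps[of r])

lemma nat_bits_inj: "nat_bits r = nat_bits r' \<Longrightarrow> r = r'"
proof (induction r arbitrary: r' rule: less_induct)
  case (less r)
  show ?case
  proof (cases "r = 0 \<or> r' = 0")
    case True
    then show ?thesis using less.prems by (metis list.distinct(1) nat_bits_0 nat_bits_pos neq0_conv)
  next
    case False
    then have e: "odd r = odd r'" "nat_bits ((r - 1) div 2) = nat_bits ((r' - 1) div 2)"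
      using less.prems by (auto simp: nat_bits_pos)
    obtain s s' where s: "r = Suc s" "r' = Suc s'" using False by (metis not0_implies_Suc)
    have "s div 2 = s' div 2" using less.IH e(2) unfolding s by auto
    moreover have "even s = even s'" using e(1) unfolding s by simp
    ultimately have "s = s'" by (metis even_two_times_div_two odd_two_times_div_two_succ)
    then show ?thesis unfolding s by simp
  qed
qed

lemma length_nat_bits: "2 ^ length (nat_bits r) \<le> r + 1"
proof (induction r rule: less_induct)
  case (less r)
  show ?case
  proof (cases "r = 0")
    case False
    then have "2 ^ length (nat_bits ((r - 1) div 2)) \<le> (r - 1) div 2 + 1" using less[of "(r - 1) div 2"] by simp
    then show ?thesis using False by (simp add: nat_bits_pos)
  qed simp
qed

text \<open>In a network of at least two nodes tokens must not be empty, since a message may convey any number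
  of empty tokens at no cost. In a network of one node the only admissible token is empty.\<close>

definition tok_of :: "nat \<Rightarrow> nat \<Rightarrow> bits" where
  "tok_of N r = (if N = 1 then [] else True # nat_bits r)"

lemma inj_tok_of: "inj_on (tok_of N) {..<N}"
  by (auto simp: inj_on_def tok_of_def dest: nat_bits_inj)

text \<open>One half of the factor 2 pays for the leading \<open>True\<close>, as
  \<open>log 2 N\<close> is at least 1 for two or more nodes.\<close>

lemma length_tok_of:
  assumes "r < N"
  shows "real (length (tok_of N r)) \<le> 2 * log 2 (real N)"
proof (cases "N = 1")
  case False
  have "(2::real) ^ length (nat_bits r) \<le> real N"
    using length_nat_bits[of r] assms by (metis (no_types, lifting) Suc_eq_plus1 Suc_leI le_trans of_nat_le_iff of_nat_numeral of_nat_power)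
  then have "real (length (nat_bits r)) \<le> log 2 (real N)"
    using assms by (simp add: le_log_iff powr_realpow)
  moreover have "1 \<le> log 2 (real N)" using assms False by (simp add: le_log_iff)
  ultimately show ?thesis using False by (simp add: tok_of_def)
qed (simp add: tok_of_def)

section \<open>Numbering messages in base 4\<close>

definition digits :: "bits \<Rightarrow> nat list" where
  "digits = map (\<lambda>x. if x then 2 else 1)"

text \<open>The symbol 3 opens each token, which makes the sequence decodable. The symbol 0 never
  occurs, so the base-4 number of a sequence also determines its length.\<close>

definition symbols :: "ac_msg \<Rightarrow> nat list" where
  "symbols msg = digits (fst msg) @ concat (map (\<lambda>t. 3 # digits t) (snd msg))"

definition num :: "nat list \<Rightarrow> nat" where
  "num ds = foldr (\<lambda>d s. d + 4 * s) ds 0"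

definition msg_code :: "ac_msg \<Rightarrow> nat" where
  "msg_code msg = num (symbols msg)"

lemma num_simps [simp]: "num [] = 0" "num (d # ds) = d + 4 * num ds"
  by (simp_all add: num_def)

lemma digits_set: "set (digits b) \<subseteq> {1, 2}" by (auto simp: digits_def)

lemma symbols_set: "set (symbols msg) \<subseteq> {1, 2, 3}"
  by (auto simp: symbols_def digits_def)

lemma num_less: "set ds \<subseteq> {1, 2, 3} \<Longrightarrow> num ds < 4 ^ length ds"
  by (induction ds) auto

lemma num_inj: "set ds \<subseteq> {1, 2, 3} \<Longrightarrow> set es \<subseteq> {1, 2, 3} \<Longrightarrow> num ds = num es \<Longrightarrow> ds = es"
proof (induction ds arbitrary: es)
  case Nil
  then show ?case by (cases es) auto
next
  case (Cons d ds)
  obtain e es' where es: "es = e # es'" using Cons.prems by (cases es) auto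
  have "d + 4 * num ds = e + 4 * num es'" "d \<in> {1, 2, 3}" "e \<in> {1, 2, 3}" using Cons.prems es by auto
  then have "d = e \<and> num ds = num es'" by auto presburger+
  then show ?case using Cons es by auto
qed

lemma symbols_inj: "symbols (b, ts) = symbols (b', ts') \<Longrightarrow> b = b' \<and> ts = ts'"
proof (induction ts arbitrary: b b' ts')
  have dinj: "digits x = digits y \<Longrightarrow> x = y" for x y
    unfolding digits_def by (rule map_injective) (auto simp: inj_def split: if_splits)
  have split: "b = b' \<and> r = r'"
    if "digits b @ r = digits b' @ r'" "r = [] \<or> hd r = 3" "r' = [] \<or> hd r' = 3" for b b' r r'
  proof -
    have tw: "takeWhile (\<lambda>x. x \<noteq> 3) (digits b @ r) = digits b" if "r = [] \<or> hd r = 3" for b r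
      using that digits_set[of b] by (subst takeWhile_append2) (auto, cases r, auto)
    then have "digits b = digits b'" using that by metis
    then show ?thesis using that(1) dinj by auto
  qed
  {
    case Nil
    then show ?case
      using split[of b "[]" b' "concat (map (\<lambda>t. 3 # digits t) ts')"] by (cases ts') (auto simp: symbols_def)
  next
    case (Cons t ts)
    have e: "digits b @ 3 # symbols (t, ts) = digits b' @ concat (map (\<lambda>t. 3 # digits t) ts')"
      using Cons.prems by (simp add: symbols_def)
    have "b = b' \<and> 3 # symbols (t, ts) = concat (map (\<lambda>t. 3 # digits t) ts')"
      by (rule split[OF e]) (cases ts'; auto)+
    moreover obtain t' ts'' where "ts' = t' # ts''" using calculation by (cases ts') auto
    ultimately show ?case using Cons.IH[of t t' ts''] by (simp add: symbols_def)
  }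
qed

lemma inj_msg_code: "inj msg_code"
proof (rule injI)
  fix x y assume "msg_code x = msg_code y"
  then have "symbols x = symbols y"
    unfolding msg_code_def using num_inj symbols_set by blast
  then show "x = y" using symbols_inj[of "fst x" "snd x" "fst y" "snd y"] by (simp add: prod_eq_iff)
qed

text \<open>Each separator is charged to its token, which has at least one bit; so there are at most
  two symbols per bit.\<close>

lemma msg_code_less:
  assumes "[] \<notin> set (snd msg)"
  shows "msg_code msg < 4 ^ (2 * msg_size msg)"
proof -
  have *: "length (concat (map (\<lambda>t. 3 # digits t) ts)) \<le> 2 * sum_list (map length ts)" if "[] \<notin> set ts" for ts
    using that
  proof (induction ts)
    case (Cons t ts)
    then have "1 \<le> length t" by (cases t) auto
    then show ?case using Cons by (simp add: digits_def)
  qed simp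
  have "length (symbols msg) \<le> 2 * msg_size msg"
    using *[OF assms] by (simp add: symbols_def msg_size_def digits_def)
  then have "(4::nat) ^ length (symbols msg) \<le> 4 ^ (2 * msg_size msg)" by (intro power_increasing) auto
  then show ?thesis
    unfolding msg_code_def using num_less[OF symbols_set, of msg] by linarith
qed

section \<open>The simulating program\<close>

text \<open>The parameters: \<open>2 ^ a\<close> wires per node, capacity \<open>c\<close>, sorting
  depth \<open>q\<close>, fields of \<open>B\<close> bits, payloads below \<open>P\<close>,
  super-rounds of \<open>L\<close> rounds. \<open>ALG\<close> is a family because the size of the
  skeleton is learnt during the run.\<close>

locale simulation =
  fixes n a c q B P L :: nat and ALG :: "nat \<Rightarrow> ac_alg"
begin

abbreviation "m \<equiv> (2 :: nat) ^ a"
abbreviation "W \<equiv> n * 2 ^ a"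

definition ini :: "hyb_info \<Rightarrow> ust" where
  "ini info = Ust (hi_id info) (map_option (\<lambda>(inc, H, inp). (listing inc, sorted_list_of_set H, inp)) (hi_skeleton info))
     0 0 ([], {||}) [] [] [] []"

definition load :: "nat \<Rightarrow> (nat \<Rightarrow> nat) \<Rightarrow> item list" where
  "load v g = map (\<lambda>j. (g j * W + ((v - 1) * m + j), (v - 1) * m + j, g j, 0)) [0..<m]"

text \<open>One wire of each skeleton node enters group 1 and all others enter group 0. The index
  inside group 1 becomes the rank, and the number of positions from the start of group 1 on is the
  number of skeleton nodes.\<close>

definition mk_rank :: "ust \<Rightarrow> ust fset \<Rightarrow> ust" where
  "mk_rank u K = set_wr (load (uid u) (\<lambda>j. if usk u \<noteq> None \<and> j = 0 then 1 else 0)) u"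

definition read_rank :: "ust \<Rightarrow> ust fset \<Rightarrow> ust" where
  "read_rank u K = (case uwr u ! 0 of (_, _, pos, pm) \<Rightarrow>
     let st = W - 1 - pm mod W in set_rank (pos - st) (W - st) u)"

definition rank_in :: "ust fset \<Rightarrow> nat \<Rightarrow> nat" where
  "rank_in K v = urk (THE s. s |\<in>| K \<and> uid s = v)"

definition ac_init :: "ust \<Rightarrow> ust fset \<Rightarrow> ust" where
  "ac_init u K = (case usk u of None \<Rightarrow> u | Some (inc, _, inp) \<Rightarrow> set_ac
     (a_init (ALG (unn u)) \<lparr>ai_id = Suc (urk u), ai_token = tok_of (unn u) (urk u),
        ai_incident = (\<lambda>(v, w). (Suc (rank_in K v), w)) ` set inc,
        ai_tokens = (\<lambda>v. (Suc (rank_in K v), tok_of (unn u) (rank_in K v))) ` fst ` set inc, ai_input = inp\<rparr>,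
      Abs_fset (insert (tok_of (unn u) (urk u)) ((\<lambda>v. tok_of (unn u) (rank_in K v)) ` fst ` set inc))) u)"

definition valid :: "bits set \<Rightarrow> (target \<times> ac_msg) list \<Rightarrow> nat set" where
  "valid T out = {i. i < length out \<and> may_send T (out ! i)}"

definition dest_rank :: "nat \<Rightarrow> target \<Rightarrow> nat \<Rightarrow> nat" where
  "dest_rank N tgt r = (case tgt of Token \<tau> \<Rightarrow> the_inv_into {..<N} (tok_of N) \<tau> | Random \<Rightarrow> r)"

definition out_list :: "nat set \<Rightarrow> (nat \<Rightarrow> nat) \<Rightarrow> (target \<times> ac_msg) list \<Rightarrow> (nat \<times> ac_msg) list" where
  "out_list I d out = take c (map (\<lambda>i. (d i, snd (out ! i))) (sorted_list_of_set I))"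

text \<open>A rank is drawn for every valid message, even for one with a token, because
  \<open>ac_step\<close> draws likewise; so the two product spaces match. The list is cut to
  \<open>c\<close> messages only afterwards.\<close>

definition sample :: "ust \<Rightarrow> ust pmf" where
  "sample u = (case usk u of None \<Rightarrow> return_pmf u | Some _ \<Rightarrow>
     bind_pmf (a_act (ALG (unn u)) (fst (uac u))) (\<lambda>act.
       let I = valid (fset (snd (uac u))) (snd act) in
       map_pmf (\<lambda>g. set_out (out_list I (\<lambda>i. dest_rank (unn u) (fst (snd act ! i)) (g i)) (snd act))
           (set_ac (fst act, snd (uac u)) u))
         (Pi_pmf I undefined (\<lambda>_. pmf_of_set {..<unn u}))))"

text \<open>Messages of a network of one node cannot be encoded, because they may contain any number of empty
  tokens. There the sender is the recipient, so the index of the message suffices.\<close>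

definition payload :: "ust \<Rightarrow> nat \<Rightarrow> nat" where
  "payload u i = (if unn u = 1 then i else msg_code (snd (uout u ! i)))"

definition unpack :: "ust \<Rightarrow> nat \<Rightarrow> ac_msg" where
  "unpack u pl = (if unn u = 1 then snd (uout u ! pl) else inv msg_code pl)"

definition cargo_of :: "ust \<Rightarrow> ust fset \<Rightarrow> cargo set" where
  "cargo_of u K = (\<Union>s\<in>fset K. case usk s of None \<Rightarrow> {} | Some (_, h, _) \<Rightarrow>
     {Msg (uid s) i (fst (uout s ! i)) (payload s i) | i. i < length (uout s) \<and> h ! (i mod length h) = uid u} \<union>
     {Slot (uid s) (urk s) j | j. j < c \<and> h ! (j mod length h) = uid u})"

definition mk_cargo :: "ust \<Rightarrow> ust fset \<Rightarrow> ust" where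
  "mk_cargo u K = (let xs = listing (cargo_of u K) in set_cg xs (set_wr (load (uid u) (group_at n xs)) u))"

definition mk_match :: "ust \<Rightarrow> ust fset \<Rightarrow> ust" where
  "mk_match u K = set_wr (map (\<lambda>j. match_item n c P W ((uid u - 1) * m + j) (ucg u) j (uwr u ! j)) [0..<m]) u"

definition read_res :: "ust \<Rightarrow> ust fset \<Rightarrow> ust" where
  "read_res u K = set_res (read_slots c P (ucg u) (uwr u)) u"

text \<open>The number \<open>j\<close> keeps messages with equal payloads apart, so the set of
  pairs has the multiplicities of the inbox.\<close>

definition receive :: "ust \<Rightarrow> ust fset \<Rightarrow> ust" where
  "receive u K = (case usk u of None \<Rightarrow> u | Some _ \<Rightarrow>
     let inbox = image_mset (\<lambda>(j, pl). unpack u pl) (mset_set {(j, pl). \<exists>s\<in>fset K. (urk u, j, pl) \<in> set (ures s)})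
     in set_ac (a_upd (ALG (unn u)) (fst (uac u)) inbox,
       snd (uac u) |\<union>| Abs_fset (\<Union>x\<in>set_mset inbox. set (snd x))) u)"

definition group_prog :: "instr list" where
  "group_prog = map (stage_instr m) (op_stages q (group_value W (2 ^ B)))"

definition init_prog :: "instr list" where
  "init_prog = local_instr mk_rank # group_prog @ [local_instr read_rank, local_instr ac_init]"

definition round_tail :: "instr list" where
  "round_tail = group_prog @ local_instr mk_match # map (stage_instr m) (op_stages q (\<lambda>p a. a)) @
     [local_instr read_res, local_instr receive]"

definition round_head :: instr where
  "round_head = (sample, 0, \<lambda>u K _. mk_cargo u K)"

definition prog :: "nat \<Rightarrow> instr" where
  "prog i = (if i < length init_prog then init_prog ! i
     else (round_head # round_tail) ! ((i - length init_prog) mod length (round_head # round_tail)))"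

lemma wires_are_load:
  assumes "\<And>v. v \<in> {1..n} \<Longrightarrow> uid (U v) = v \<and> uwr (U v) = load v (g v)"
  shows "wires_are n m U (\<lambda>p. (g (p div m + 1) (p mod m) * W + p, p, g (p div m + 1) (p mod m), 0))"
  using assms unfolding wires_are_def load_def by auto

section \<open>The program of a round implements the routing\<close>

context
  fixes G :: wgraph and U :: "nat \<Rightarrow> ust" and M :: "nat set" and N :: nat and rk :: "nat \<Rightarrow> nat"
    and hl :: "nat \<Rightarrow> nat list" and ms :: "nat \<Rightarrow> (nat \<times> ac_msg) list" and pay :: "nat \<Rightarrow> nat \<Rightarrow> nat"
  assumes G: "network n G" and W: "W \<le> 2 ^ q" and B1: "(n + 1) * W \<le> 2 ^ B"
    and B2: "2 * (n * c) + W \<le> 2 ^ B" and B3: "(n * c + 1) * P \<le> 2 ^ B"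
    and U: "\<And>v. v \<in> {1..n} \<Longrightarrow> uid (U v) = v"
      "\<And>v. v \<in> {1..n} \<Longrightarrow> if v \<in> M then (\<exists>inc inp. usk (U v) = Some (inc, hl v, inp)) else usk (U v) = None"
      "\<And>v. v \<in> M \<Longrightarrow> urk (U v) = rk v \<and> unn (U v) = N \<and> uout (U v) = ms v"
      "\<And>v i. v \<in> M \<Longrightarrow> i < length (ms v) \<Longrightarrow> payload (U v) i = pay v i"
    and hb: "\<And>w v. w \<in> M \<Longrightarrow> v \<in> set (hl w) \<Longrightarrow> w \<in> ball_of G L v \<and> v \<in> ball_of G L w"
    and routing: "routing n c N P M hl rk ms pay"
    and size: "\<forall>v\<in>{1..n}. card (routing.cargo_for c M hl rk ms pay v) \<le> m"
begin

interpretation r: routing n a c N B P q M hl rk ms pay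
  by (rule routing)

lemma fset_known:
  assumes "v \<in> {1..n}"
  shows "fset (known_ball G L U' v) = U' ` ball_of G L v"
  unfolding known_ball_def using ball_of_subset[OF G assms, of L]
  by (intro Abs_fset_inverse) (auto intro: finite_subset)

text \<open>A skeleton node that has \<open>v\<close> among its helpers lies in the ball of
  \<open>v\<close>, so the flooded states tell \<open>v\<close> its whole cargo.\<close>

lemma cargo_of_eq:
  assumes v: "v \<in> {1..n}"
  shows "cargo_of (U v) (known_ball G L U v) = r.cargo_for v"
proof -
  have helper: "r.helper w i \<in> set (hl w)" if "w \<in> M" for w i
    using r.hl[OF that] unfolding r.helper_def by (meson length_greater_0_conv mod_less_divisor nth_mem)
  define F where "F w = (if w \<in> M then
     {Msg w i (fst (ms w ! i)) (pay w i) | i. i < length (ms w) \<and> r.helper w i = v} \<union>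
     {Slot w (rk w) j | j. j < c \<and> r.helper w j = v} else {})" for w
  have F: "(case usk (U w) of None \<Rightarrow> {} | Some (_, h, _) \<Rightarrow>
     {Msg (uid (U w)) i (fst (uout (U w) ! i)) (payload (U w) i) | i. i < length (uout (U w)) \<and> h ! (i mod length h) = uid (U v)} \<union>
     {Slot (uid (U w)) (urk (U w)) j | j. j < c \<and> h ! (j mod length h) = uid (U v)}) = F w" if wn: "w \<in> {1..n}" for w
  proof (cases "w \<in> M")
    case True
    then obtain inc inp where "usk (U w) = Some (inc, hl w, inp)" using U(2)[OF wn] by auto
    then show ?thesis using U(1)[OF wn] U(1)[OF v] U(3)[OF True] U(4)[OF True] True
      by (auto simp add: F_def r.helper_def)
  next
    case False
    then show ?thesis using U(2)[OF wn] by (simp add: F_def)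
  qed
  have "cargo_of (U v) (known_ball G L U v) = (\<Union>w\<in>ball_of G L v. F w)"
    unfolding cargo_of_def fset_known[OF v] image_image
    by (rule SUP_cong[OF refl]) (use F ball_of_subset[OF G v, of L] in blast)
  also have "\<dots> = (\<Union>w\<in>M. F w)"
  proof (intro equalityI subsetI)
    fix x assume "x \<in> (\<Union>w\<in>M. F w)"
    then obtain w where w: "w \<in> M" "x \<in> F w" by blast
    then have "v \<in> set (hl w)" using helper by (auto simp: F_def)
    then show "x \<in> (\<Union>w\<in>ball_of G L v. F w)" using hb w by blast
  qed (auto simp: F_def split: if_splits)
  also have "\<dots> = r.cargo_for v"
    unfolding F_def r.cargo_for_def r.issued_def r.msg_of_def by (auto simp: image_iff)
  finally show ?thesis .
qed

lemma verts_G': "verts G = {1..n}" using G by (simp add: network_def)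

lemma item_bound_load:
  assumes "p < W" "g \<le> n"
  shows "item_bound (2 ^ B) (g * W + p, p, g, 0)"
proof -
  have "0 < n" using assms(1) by (cases n) auto
  then have "g * W + p < (n + 1) * W"
    using assms block_le_iff(1)[of p W 0 g "n + 1"] by simp
  moreover have "g < (n + 1) * W" using assms by (cases W) auto
  moreover have "p < (n + 1) * W" using assms by simp
  ultimately show ?thesis using B1 assms unfolding item_bound_def by auto
qed

lemma group_value_less: "group_value W (2 ^ B) p x < 2 ^ B"
  by (simp add: group_value_def)

text \<open>Origin of two bounds on \<open>B\<close>: keys stay below \<open>2 * (n * c) + W\<close>
  and values below \<open>(n * c + 1) * P\<close>.\<close>

lemma match_f_bound:
  assumes p: "p < W"
  shows "item_bound (2 ^ B) (r.match_f p)"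
proof -
  have nc: "2 * (n * c) \<le> 2 ^ B" using B2 by (rule add_leD1)
  have P: "(d * c + j + 1) * P + l < 2 ^ B" "2 * (d * c + j) + 1 < 2 ^ B" if "d < N" "j < c" "l < P" for d j l
  proof -
    have dc: "d * c + j < n * c" using block_le_iff(1)[of j c 0 d n] that r.N by simp
    have "(d * c + j + 1) * P + l < (n * c + 1) * P"
      using block_le_iff(1)[of l P 0 "d * c + j + 1" "n * c + 1"] that dc by simp
    then show "(d * c + j + 1) * P + l < 2 ^ B" using B3 by linarith
    show "2 * (d * c + j) + 1 < 2 ^ B" using dc nc by simp
  qed
  have S: "2 * (d * c + j) + 1 < 2 ^ B" if "d < N" "j < c" for d j
  proof -
    have "d * c + j < n * c" using block_le_iff(1)[of j c 0 d n] that r.N by simp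
    then show ?thesis using nc by simp
  qed
  have idle: "2 * (n * c) + p < 2 ^ B" "p < 2 ^ B" "0 < (2::nat) ^ B" using p B2 by auto
  show ?thesis
  proof (cases "r.cat p")
    case None
    then show ?thesis unfolding r.match_f_cat[OF size p] using idle by (simp add: item_bound_def)
  next
    case (Some x)
    show ?thesis
    proof (cases x)
      case (Msg w i d l)
      have "(w, i) \<in> r.issued" "d < N" "l < P"
        using r.cat_msg[OF size, of p w i d l] Some Msg r.dst_less[OF size, of "(w, i)"] r.pay by (auto simp: r.issued_def)
      then show ?thesis unfolding r.match_f_cat[OF size p] using idle Some Msg P[of d "index_of r.grp p" l]
        by (auto simp: item_bound_def)
    next
      case (Slot w d j)
      have "d < N" "j < c"
        using r.cat_slot[OF size, of p w d j] Some Slot r.rk by (auto simp: bij_betw_def)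
      then show ?thesis unfolding r.match_f_cat[OF size p] using idle Some Slot S[of d j]
        by (auto simp: item_bound_def)
    qed
  qed
qed

lemma round_result_wires:
  fixes U1
  defines "U1 \<equiv> ustep G L B m round_head U"
  assumes v: "v \<in> {1..n}"
  shows "fold (ustep G L B m) (group_prog @ local_instr mk_match # map (stage_instr m) (op_stages q (\<lambda>p a. a))) U1 v =
    set_cg (r.cg v) (set_wr (map (\<lambda>j. r.res_f ((v - 1) * m + j)) [0..<m]) (U v))"
proof -
  have U1: "U1 v = set_cg (r.cg v) (set_wr (load v (group_at n (r.cg v))) (U v))" if "v \<in> {1..n}" for v
    unfolding U1_def ustep_def round_head_def prod.case mk_cargo_def Let_def cargo_of_eq[OF that] r.cg_def U(1)[OF that] ..
  define f1 where "f1 p = (r.grp p * W + p, p, r.grp p, 0 :: nat)" for p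
  have w1: "wires_are n m U1 f1"
    unfolding f1_def r.grp_def
    by (rule wires_are_load) (use U1 U in simp)
  define U2 where "U2 = fold (ustep G L B m) group_prog U1"
  define f2 where "f2 = run_stages W (op_stages q (group_value W (2 ^ B))) f1"
  have U2: "U2 v = set_wr (map (\<lambda>j. f2 ((v - 1) * m + j)) [0..<m]) (U1 v)" if "v \<in> {1..n}" for v
    unfolding U2_def group_prog_def f2_def
  proof (rule fold_op_instrs[OF refl verts_G' w1 _ _ group_value_less that])
    show "item_bound (2 ^ B) (f1 p)" if "p < W" for p
      unfolding f1_def using item_bound_load[OF that] r.grp_less[OF size] by blast
    show "W \<le> 2 ^ B" using B2 by linarith
  qed
  define U3 where "U3 = ustep G L B m (local_instr mk_match) U2"
  have wire: "((v - 1) * m + j) div m + 1 = v" "((v - 1) * m + j) mod m = j" "(v - 1) * m + j < W"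
    if "j < m" "v \<in> {1..n}" for j v
  proof -
    show "((v - 1) * m + j) div m + 1 = v" "((v - 1) * m + j) mod m = j" using that by auto
    show "(v - 1) * m + j < W" using block_index_less[OF that(1), of "v - 1" n] that(2) by auto
  qed
  have U3: "U3 v = set_wr (map (\<lambda>j. r.match_f ((v - 1) * m + j)) [0..<m]) (U1 v)" if v: "v \<in> {1..n}" for v
  proof -
    have "map (\<lambda>j. match_item n c P W ((v - 1) * m + j) (r.cg v) j (map (\<lambda>j. f2 ((v - 1) * m + j)) [0..<m] ! j)) [0..<m] =
      map (\<lambda>j. r.match_f ((v - 1) * m + j)) [0..<m]"
    proof (rule map_cong)
      fix j assume "j \<in> set [0..<m]"
      then have j: "j < m" by simp
      have "f2 ((v - 1) * m + j) = ((v - 1) * m + j, (v - 1) * m + j,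
          start_of W r.grp ((v - 1) * m + j) + index_of r.grp ((v - 1) * m + j),
          r.grp ((v - 1) * m + j) * W + (W - 1 - start_of W r.grp ((v - 1) * m + j)))"
        unfolding f2_def f1_def by (rule r.group_wires[OF size W B1 wire(3)[OF j v]])
      then show "match_item n c P W ((v - 1) * m + j) (r.cg v) j (map (\<lambda>j. f2 ((v - 1) * m + j)) [0..<m] ! j) =
          r.match_f ((v - 1) * m + j)"
        unfolding r.match_f_def wire(1,2)[OF j v] using j by (simp del: One_nat_def)
    qed simp
    then show ?thesis
      unfolding U3_def ustep_local mk_match_def U2[OF v] using U1[OF v] U(1)[OF v]
      by (simp del: map_eq_conv One_nat_def)
  qed
  have w3: "wires_are n m U3 r.match_f"
    unfolding wires_are_def using U3 U1 U(1) by simp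
  have "fold (ustep G L B m) (map (stage_instr m) (op_stages q (\<lambda>p a. a))) U3 v =
      set_wr (map (\<lambda>j. run_stages W (op_stages q (\<lambda>p a. a)) r.match_f ((v - 1) * m + j)) [0..<m]) (U3 v)"
    by (rule fold_op_instrs[OF refl verts_G' w3 match_f_bound _ _ v]) (use B2 in auto)
  then have "fold (ustep G L B m) (group_prog @ local_instr mk_match # map (stage_instr m) (op_stages q (\<lambda>p a. a))) U1 v =
    set_wr (map (\<lambda>j. r.res_f ((v - 1) * m + j)) [0..<m]) (U3 v)"
    unfolding r.res_f_def by (simp add: U3_def U2_def)
  moreover have "set_wr x (set_cg y (set_wr z u)) = set_cg y (set_wr x u)" for x y z u by (cases u) simp
  ultimately show ?thesis using U3[OF v] U1[OF v] by simp
qed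

text \<open>The slots of \<open>v\<close> lie at helpers within flooding distance, so
  \<open>v\<close> sees what each of them received. Accepted messages for \<open>v\<close> have
  different numbers, so none is lost when they are collected as a set.\<close>

lemma round_tail_result:
  fixes U1
  defines "U1 \<equiv> ustep G L B m round_head U"
  assumes v: "v \<in> {1..n}"
  defines "U2 \<equiv> fold (ustep G L B m) round_tail U1"
  shows "uid (U2 v) = v" "usk (U2 v) = usk (U v)" "urk (U2 v) = urk (U v)" "unn (U2 v) = unn (U v)"
    and "v \<in> M \<Longrightarrow> uac (U2 v) =
      (let inbox = image_mset (\<lambda>(w, i). snd (ms w ! i)) (mset_set {b \<in> r.accepted. r.dst b = rk v})
       in (a_upd (ALG N) (fst (uac (U v))) inbox,
         snd (uac (U v)) |\<union>| Abs_fset (\<Union>x\<in>set_mset inbox. set (snd x))))"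
proof -
  define U3 where "U3 = fold (ustep G L B m) (group_prog @ local_instr mk_match #
    map (stage_instr m) (op_stages q (\<lambda>p a. a))) U1"
  define U4 where "U4 = ustep G L B m (local_instr read_res) U3"
  have U2: "U2 = ustep G L B m (local_instr receive) U4"
    unfolding U2_def round_tail_def U4_def U3_def by simp
  have U3: "U3 w = set_cg (r.cg w) (set_wr (map (\<lambda>j. r.res_f ((w - 1) * m + j)) [0..<m]) (U w))"
    if "w \<in> {1..n}" for w
    unfolding U3_def U1_def by (rule round_result_wires[OF that])
  have U4: "U4 w = set_res (read_slots c P (r.cg w) (map (\<lambda>j. r.res_f ((w - 1) * m + j)) [0..<m])) (U3 w)"
    if "w \<in> {1..n}" for w
    unfolding U4_def ustep_local read_res_def using U3[OF that] by simp
  have ures: "set (ures (U4 w)) = {(r.dst b, r.place b, pay (fst b) (snd b)) | b. b \<in> r.accepted \<and>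
       (\<exists>w'\<in>M. r.dst b = rk w' \<and> r.helper w' (r.place b) = w)}" if "w \<in> {1..n}" for w
    using U4[OF that] r.read_slots_eq[OF size W that] by simp
  have same: "uid (U4 w) = w" "usk (U4 w) = usk (U w)" "urk (U4 w) = urk (U w)" "unn (U4 w) = unn (U w)"
    "uac (U4 w) = uac (U w)" "uout (U4 w) = uout (U w)" if "w \<in> {1..n}" for w
    using U4[OF that] U3[OF that] U(1)[OF that] by simp_all
  show "uid (U2 v) = v" "usk (U2 v) = usk (U v)" "urk (U2 v) = urk (U v)" "unn (U2 v) = unn (U v)"
    unfolding U2 ustep_local receive_def using same[OF v] by (auto simp: Let_def split: option.splits)
  assume vM: "v \<in> M"
  let ?K = "known_ball G L U4 v"
  let ?X = "{b \<in> r.accepted. r.dst b = rk v}"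
  have helper: "r.helper w i \<in> set (hl w)" "r.helper w i \<in> {1..n}" if "w \<in> M" for w i
  proof -
    show "r.helper w i \<in> set (hl w)"
      using r.hl[OF that] unfolding r.helper_def by (meson length_greater_0_conv mod_less_divisor nth_mem)
    then show "r.helper w i \<in> {1..n}" using r.hl[OF that] by blast
  qed
  have S: "{(j, pl). \<exists>s\<in>fset ?K. (urk (U4 v), j, pl) \<in> set (ures s)} =
      (\<lambda>b. (r.place b, pay (fst b) (snd b))) ` ?X"
  proof (intro equalityI subsetI)
    fix x assume "x \<in> {(j, pl). \<exists>s\<in>fset ?K. (urk (U4 v), j, pl) \<in> set (ures s)}"
    then obtain j pl s where "x = (j, pl)" "s \<in> fset ?K" "(urk (U4 v), j, pl) \<in> set (ures s)" by (cases x) auto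
    then obtain w where x: "x = (j, pl)" "w \<in> ball_of G L v" "(urk (U4 v), j, pl) \<in> set (ures (U4 w))"
      unfolding fset_known[OF v] by auto
    have w: "w \<in> {1..n}" using ball_of_subset[OF G v] x(2) by blast
    show "x \<in> (\<lambda>b. (r.place b, pay (fst b) (snd b))) ` ?X"
      using x(1,3) ures[OF w] same(3)[OF v] U(3)[OF vM] by auto
  next
    fix x assume "x \<in> (\<lambda>b. (r.place b, pay (fst b) (snd b))) ` ?X"
    then obtain b where b: "b \<in> r.accepted" "r.dst b = rk v" "x = (r.place b, pay (fst b) (snd b))" by auto
    let ?w = "r.helper v (r.place b)"
    have w: "?w \<in> ball_of G L v" using hb[OF vM helper(1)[OF vM]] by blast
    have "(rk v, r.place b, pay (fst b) (snd b)) \<in> set (ures (U4 ?w))"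
      unfolding ures[OF helper(2)[OF vM]] using b vM by (intro CollectI exI[of _ b]) auto
    then show "x \<in> {(j, pl). \<exists>s\<in>fset ?K. (urk (U4 v), j, pl) \<in> set (ures s)}"
      unfolding fset_known[OF v] using w b(3) same(3)[OF v] U(3)[OF vM] by auto
  qed
  have inj: "inj_on (\<lambda>b. (r.place b, pay (fst b) (snd b))) ?X"
    by (rule inj_onI) (use r.place_inj[OF size] in \<open>auto simp: r.accepted_def\<close>)
  have unpack: "unpack (U4 v) (pay (fst b) (snd b)) = snd (ms (fst b) ! snd b)" if "b \<in> ?X" for b
  proof (cases "N = 1")
    \<comment> \<open>The only skeleton node has sent the message to itself, so the transmitted
      index points into its own list.\<close>
    case True
    have b: "b \<in> r.issued" using that by (auto simp: r.accepted_def)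
    then have "fst b \<in> M" by (auto simp: r.issued_def)
    moreover have "rk x < 1" if "x \<in> M" for x using r.rk True that by (auto simp: bij_betw_def)
    then have "rk (fst b) = rk v" using calculation vM by (metis less_one)
    ultimately have "fst b = v" using r.rk vM by (auto simp: bij_betw_def dest: inj_onD)
    then show ?thesis using True U(3)[OF vM] U(4)[of v "snd b"] b same[OF v]
      by (auto simp: unpack_def payload_def r.issued_def)
  next
    case False
    have b: "fst b \<in> M" "snd b < length (ms (fst b))" using that by (auto simp: r.accepted_def r.issued_def)
    then have "pay (fst b) (snd b) = msg_code (snd (ms (fst b) ! snd b))"
      using False U(3)[of "fst b"] U(4)[of "fst b" "snd b"] by (simp add: payload_def)
    then show ?thesis using False U(3)[OF vM] same[OF v] inj_msg_code by (simp add: unpack_def)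
  qed
  have inbox: "image_mset (\<lambda>(j, pl). unpack (U4 v) pl)
      (mset_set {(j, pl). \<exists>s\<in>fset ?K. (urk (U4 v), j, pl) \<in> set (ures s)}) =
      image_mset (\<lambda>(w, i). snd (ms w ! i)) (mset_set ?X)"
  proof -
    have finX: "finite ?X" using r.finite_issued by (auto simp: r.accepted_def)
    show ?thesis
      unfolding S image_mset_mset_set[OF inj, symmetric] multiset.map_comp
      by (rule image_mset_cong) (use unpack finX in auto)
  qed
  obtain inc inp where "usk (U v) = Some (inc, hl v, inp)" using U(2)[OF v] vM by auto
  then show "uac (U2 v) = (let inbox = image_mset (\<lambda>(w, i). snd (ms w ! i)) (mset_set ?X)
       in (a_upd (ALG N) (fst (uac (U v))) inbox,
         snd (uac (U v)) |\<union>| Abs_fset (\<Union>x\<in>set_mset inbox. set (snd x))))"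
    unfolding U2 ustep_local receive_def inbox using same[OF v] U(3)[OF vM] by (simp add: Let_def)
qed

lemma round_tail_all:
  "\<forall>v\<in>{1..n}. let U2 = fold (ustep G L B m) round_tail (ustep G L B m round_head U) in
    uid (U2 v) = v \<and> usk (U2 v) = usk (U v) \<and> urk (U2 v) = urk (U v) \<and> unn (U2 v) = unn (U v) \<and>
    (v \<in> M \<longrightarrow> uac (U2 v) =
      (let inbox = image_mset (\<lambda>(w, i). snd (ms w ! i))
         (mset_set {b \<in> routing.accepted n a c M hl rk ms pay. routing.dst ms b = rk v})
       in (a_upd (ALG N) (fst (uac (U v))) inbox,
         snd (uac (U v)) |\<union>| Abs_fset (\<Union>x\<in>set_mset inbox. set (snd x)))))"
  unfolding Let_def using round_tail_result[unfolded Let_def] by blast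

end

end

section \<open>Coupling the random choices\<close>

lemma rel_pmf_trans:
  assumes "rel_pmf R p q" "rel_pmf S q r" "\<And>x y z. R x y \<Longrightarrow> S y z \<Longrightarrow> T x z"
  shows "rel_pmf T p r"
proof -
  have "(rel_pmf R OO rel_pmf S) p r" using assms(1,2) by blast
  then have "rel_pmf (R OO S) p r" by (simp only: pmf.rel_compp)
  then show ?thesis by (rule pmf.rel_mono_strong) (use assms(3) in blast)
qed

lemma rel_pmf_Pi_pmf_insert:
  assumes "finite A" "a \<notin> A" "finite B" "b \<notin> B"
    and "rel_pmf R (p a) (q b)" "rel_pmf S (Pi_pmf A d p) (Pi_pmf B d' q)"
    and T: "\<And>x y f g. R x y \<Longrightarrow> S f g \<Longrightarrow> T (f(a := x)) (g(b := y))"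
  shows "rel_pmf T (Pi_pmf (insert a A) d p) (Pi_pmf (insert b B) d' q)"
proof -
  have "rel_pmf (rel_prod R S) (pair_pmf (p a) (Pi_pmf A d p)) (pair_pmf (q b) (Pi_pmf B d' q))"
    by (rule iffD2[OF rel_pmf_rel_prod]) (use assms(5,6) in blast)
  then show ?thesis
    unfolding Pi_pmf_insert[OF assms(1,2)] Pi_pmf_insert[OF assms(3,4)] pmf.rel_map
    by (rule pmf.rel_mono_strong) (use T in auto)
qed

lemma rel_pmf_Pi_pmf_row:
  assumes "finite I" "rel_pmf R p q"
  shows "rel_pmf (\<lambda>g h. \<forall>i\<in>I. R (g i) (h (v, i))) (Pi_pmf I d (\<lambda>_. p)) (Pi_pmf ({v} \<times> I) d' (\<lambda>_. q))"
  using assms(1)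
proof (induction I rule: finite_induct)
  case empty
  then show ?case by (simp add: rel_pmf_return_pmf1)
next
  case (insert i I)
  have "{v} \<times> insert i I = insert (v, i) ({v} \<times> I)" by auto
  moreover have "rel_pmf (\<lambda>g h. \<forall>i\<in>insert i I. R (g i) (h (v, i)))
    (Pi_pmf (insert i I) d (\<lambda>_. p)) (Pi_pmf (insert (v, i) ({v} \<times> I)) d' (\<lambda>_. q))"
    by (rule rel_pmf_Pi_pmf_insert[OF insert(1,2) _ _ assms(2) insert(3)]) (use insert in auto)
  ultimately show ?case by simp
qed

text \<open>Each simulating node draws for its own messages, whereas \<open>ac_step\<close> draws
  for all messages at once. The product over \<open>Sigma M I\<close> factors into one row per
  node.\<close>

lemma rel_pmf_Pi_pmf_Sigma:
  assumes "finite M" "\<And>v. v \<in> M \<Longrightarrow> finite (I v)" "rel_pmf R p q"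
  shows "rel_pmf (\<lambda>g h. \<forall>v\<in>M. \<forall>i\<in>I v. R (g v i) (h (v, i)))
    (Pi_pmf M d (\<lambda>v. Pi_pmf (I v) d1 (\<lambda>_. p))) (Pi_pmf (Sigma M I) d' (\<lambda>_. q))"
  using assms(1,2)
proof (induction M rule: finite_induct)
  case empty
  then show ?case by (simp add: rel_pmf_return_pmf1)
next
  case (insert v M)
  have S: "Sigma (insert v M) I = ({v} \<times> I v) \<union> Sigma M I" by auto
  have d: "finite ({v} \<times> I v)" "finite (Sigma M I)" "({v} \<times> I v) \<inter> Sigma M I = {}"
    using insert by (auto intro: finite_SigmaI)
  have "rel_pmf (rel_prod (\<lambda>g h. \<forall>i\<in>I v. R (g i) (h (v, i))) (\<lambda>g h. \<forall>v\<in>M. \<forall>i\<in>I v. R (g v i) (h (v, i))))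
    (pair_pmf (Pi_pmf (I v) d1 (\<lambda>_. p)) (Pi_pmf M d (\<lambda>v. Pi_pmf (I v) d1 (\<lambda>_. p))))
    (pair_pmf (Pi_pmf ({v} \<times> I v) d' (\<lambda>_. q)) (Pi_pmf (Sigma M I) d' (\<lambda>_. q)))"
    by (rule iffD2[OF rel_pmf_rel_prod])
      (use insert(3)[OF insert(4)] rel_pmf_Pi_pmf_row[OF insert(4) assms(3), of v v d1 d'] in auto)
  then show ?case
    unfolding S Pi_pmf_insert[OF insert(1,2)] Pi_pmf_union[OF d] pmf.rel_map
    by (rule pmf.rel_mono_strong) (use insert(2) in auto)
qed

text \<open>Meant for the nodes outside of the skeleton, which make no random choices.\<close>

lemma rel_pmf_Pi_pmf_return:
  assumes "finite A" "B \<subseteq> A" "\<And>x. x \<in> A - B \<Longrightarrow> p x = return_pmf (c x)"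
  shows "rel_pmf (\<lambda>f g. \<forall>x\<in>A. f x = (if x \<in> B then g x else c x)) (Pi_pmf A d p) (Pi_pmf B d p)"
proof -
  have "f x = (if x \<in> B then (if x \<in> B then f x else d) else c x)" if "f \<in> set_pmf (Pi_pmf A d p)" "x \<in> A" for f x
  proof (cases "x \<in> B")
    case False
    have "f x \<in> set_pmf (p x)" using that set_Pi_pmf[OF assms(1), of d p] by (auto simp: PiE_dflt_def)
    then show ?thesis using False assms(3)[of x] that(2) by simp
  qed simp
  then show ?thesis
    unfolding Pi_pmf_subset[OF assms(1,2)] pmf.rel_map by (intro rel_pmf_reflI) blast
qed

section \<open>The draws of a round\<close>

context simulation
begin

lemma finite_valid [simp]: "finite (valid T out)"
  unfolding valid_def by simp

lemma out_list_cong: "finite I \<Longrightarrow> (\<And>i. i \<in> I \<Longrightarrow> d i = d' i) \<Longrightarrow> out_list I d out = out_list I d' out"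
  unfolding out_list_def by (intro arg_cong[where f = "take c"] map_cong) auto

definition issue_by :: "(nat \<Rightarrow> nat) \<Rightarrow> nat \<Rightarrow> ust \<Rightarrow> ac_act \<Rightarrow> (nat \<Rightarrow> nat) \<Rightarrow> ust" where
  "issue_by rk N u act r = set_out (out_list (valid (fset (snd (uac u))) (snd act))
     (\<lambda>i. dest_rank N (fst (snd act ! i)) (rk (r i))) (snd act)) (set_ac (fst act, snd (uac u)) u)"

text \<open>The program draws ranks and the model draws nodes; \<open>rk\<close> carries the uniform
  distribution on \<open>M\<close> to the uniform distribution on ranks. The actions come from equal
  memories and can be taken equal.\<close>

lemma couple_sample:
  fixes U :: "nat \<Rightarrow> ust"
  assumes M: "M \<subseteq> {1..n}" "M \<noteq> {}" and rk: "bij_betw rk M {..<N}"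
    and U: "\<And>v. v \<in> {1..n} - M \<Longrightarrow> usk (U v) = None"
      "\<And>v. v \<in> M \<Longrightarrow> usk (U v) \<noteq> None \<and> unn (U v) = N \<and> fst (uac (U v)) = mem v \<and> fset (snd (uac (U v))) = T v"
  shows "rel_pmf (\<lambda>U' (acts, rand). \<forall>v\<in>{1..n}. U' v =
      (if v \<in> M then issue_by rk N (U v) (acts v) (\<lambda>i. rand (v, i)) else U v))
    (Pi_pmf {1..n} undefined (\<lambda>v. sample (U v)))
    (bind_pmf (Pi_pmf M undefined (\<lambda>v. a_act (ALG N) (mem v)))
      (\<lambda>acts. map_pmf (Pair acts) (Pi_pmf (Sigma M (\<lambda>v. valid (T v) (snd (acts v)))) undefined (\<lambda>_. pmf_of_set M))))"
proof -
  have finM: "finite M" using M(1) finite_subset by blast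
  define g_of where "g_of v act = (\<lambda>g. set_out (out_list (valid (T v) (snd act))
     (\<lambda>i. dest_rank N (fst (snd act ! i)) (g i)) (snd act)) (set_ac (fst act, snd (uac (U v))) (U v)))" for v act
  have sM: "sample (U v) = bind_pmf (a_act (ALG N) (mem v)) (\<lambda>act.
      map_pmf (g_of v act) (Pi_pmf (valid (T v) (snd act)) undefined (\<lambda>_. pmf_of_set {..<N})))" if "v \<in> M" for v
    using U(2)[OF that] by (auto simp: sample_def g_of_def Let_def)
  have unif: "rel_pmf (\<lambda>r w. r = rk w) (pmf_of_set {..<N}) (pmf_of_set M)"
  proof -
    have "pmf_of_set {..<N} = map_pmf rk (pmf_of_set M)"
      using map_pmf_of_set_bij_betw[OF rk M(2) finM] by simp
    then show ?thesis by (simp add: pmf.rel_map pmf.rel_refl)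
  qed
  have step: "rel_pmf (\<lambda>f (acts', rand). \<forall>v\<in>M. f v = issue_by rk N (U v) (acts' v) (\<lambda>i. rand (v, i)))
     (Pi_pmf M undefined (\<lambda>v. map_pmf (g_of v (acts v))
       (Pi_pmf (valid (T v) (snd (acts v))) undefined (\<lambda>_. pmf_of_set {..<N}))))
     (map_pmf (Pair acts) (Pi_pmf (Sigma M (\<lambda>v. valid (T v) (snd (acts v)))) undefined (\<lambda>_. pmf_of_set M)))"
    for acts :: "nat \<Rightarrow> ac_act"
  proof -
    let ?I = "\<lambda>v. valid (T v) (snd (acts v))"
    have "rel_pmf ((\<lambda>f g. \<forall>v\<in>M. f v = g_of v (acts v) (g v)) OO (\<lambda>g h. \<forall>v\<in>M. \<forall>i\<in>?I v. g v i = rk (h (v, i))))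
     (Pi_pmf M undefined (\<lambda>v. map_pmf (g_of v (acts v)) (Pi_pmf (?I v) undefined (\<lambda>_. pmf_of_set {..<N}))))
     (Pi_pmf (Sigma M ?I) undefined (\<lambda>_. pmf_of_set M))"
      unfolding pmf.rel_compp
    proof (rule relcomppI)
      show "rel_pmf (\<lambda>f g. \<forall>v\<in>M. f v = g_of v (acts v) (g v))
        (Pi_pmf M undefined (\<lambda>v. map_pmf (g_of v (acts v)) (Pi_pmf (?I v) undefined (\<lambda>_. pmf_of_set {..<N}))))
        (Pi_pmf M undefined (\<lambda>v. Pi_pmf (?I v) undefined (\<lambda>_. pmf_of_set {..<N})))"
        by (rule rel_pmf_Pi_pmf[OF finM]) (simp add: pmf.rel_map pmf.rel_refl)
      show "rel_pmf (\<lambda>g h. \<forall>v\<in>M. \<forall>i\<in>?I v. g v i = rk (h (v, i)))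
        (Pi_pmf M undefined (\<lambda>v. Pi_pmf (?I v) undefined (\<lambda>_. pmf_of_set {..<N})))
        (Pi_pmf (Sigma M ?I) undefined (\<lambda>_. pmf_of_set M))"
        by (rule rel_pmf_Pi_pmf_Sigma[OF finM _ unif]) simp
    qed
    then show ?thesis
      unfolding pmf.rel_map
    proof (rule pmf.rel_mono_strong)
      fix f h assume "((\<lambda>f g. \<forall>v\<in>M. f v = g_of v (acts v) (g v)) OO (\<lambda>g h. \<forall>v\<in>M. \<forall>i\<in>?I v. g v i = rk (h (v, i)))) f h"
      then obtain g where g: "\<forall>v\<in>M. f v = g_of v (acts v) (g v)" "\<forall>v\<in>M. \<forall>i\<in>?I v. g v i = rk (h (v, i))" by blast
      have "g_of v (acts v) (g v) = issue_by rk N (U v) (acts v) (\<lambda>i. h (v, i))" if "v \<in> M" for v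
      proof -
        have T: "fset (snd (uac (U v))) = T v" using U(2)[OF that] by blast
        show ?thesis
          unfolding g_of_def issue_by_def T
          by (intro arg_cong2[where f = set_out] out_list_cong refl) (use g(2) that in auto)
      qed
      then show "case (acts, h) of (acts', rand) \<Rightarrow> \<forall>v\<in>M. f v = issue_by rk N (U v) (acts' v) (\<lambda>i. rand (v, i))"
        using g(1) by simp
    qed
  qed
  have F1: "rel_pmf (\<lambda>f (acts, rand). \<forall>v\<in>M. f v = issue_by rk N (U v) (acts v) (\<lambda>i. rand (v, i)))
    (Pi_pmf M undefined (\<lambda>v. sample (U v)))
    (bind_pmf (Pi_pmf M undefined (\<lambda>v. a_act (ALG N) (mem v)))
      (\<lambda>acts. map_pmf (Pair acts) (Pi_pmf (Sigma M (\<lambda>v. valid (T v) (snd (acts v)))) undefined (\<lambda>_. pmf_of_set M))))"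
  proof -
    have "Pi_pmf M undefined (\<lambda>v. sample (U v)) = Pi_pmf M undefined (\<lambda>v. bind_pmf (a_act (ALG N) (mem v)) (\<lambda>act.
      map_pmf (g_of v act) (Pi_pmf (valid (T v) (snd act)) undefined (\<lambda>_. pmf_of_set {..<N}))))"
      by (rule Pi_pmf_cong) (use sM in auto)
    also have "\<dots> = bind_pmf (Pi_pmf M undefined (\<lambda>v. a_act (ALG N) (mem v))) (\<lambda>acts. Pi_pmf M undefined (\<lambda>v. map_pmf (g_of v (acts v))
       (Pi_pmf (valid (T v) (snd (acts v))) undefined (\<lambda>_. pmf_of_set {..<N}))))"
      by (rule Pi_pmf_bind[OF finM])
    finally show ?thesis
      using step by (auto intro!: rel_pmf_bindI[where R = "(=)"] simp: pmf.rel_eq)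
  qed
  have F2: "rel_pmf (\<lambda>f g. \<forall>v\<in>{1..n}. f v = (if v \<in> M then g v else U v))
      (Pi_pmf {1..n} undefined (\<lambda>v. sample (U v))) (Pi_pmf M undefined (\<lambda>v. sample (U v)))"
    by (rule rel_pmf_Pi_pmf_return[OF _ M(1)]) (use U(1) in \<open>auto simp: sample_def\<close>)
  show ?thesis
    by (rule rel_pmf_trans[OF F2 F1]) auto
qed

section \<open>Initialization\<close>

text \<open>Group 1 consists of the wires \<open>(w - 1) * m\<close> with \<open>w\<close> in
  \<open>M\<close>, ordered like the identifiers, so the index in it is \<open>rk\<close>.
  Neighbours in \<open>S\<close> lie within flooding distance, so their ranks, and hence their
  tokens, can be looked up.\<close>

lemma init_result:
  fixes G S :: wgraph and H :: "nat \<Rightarrow> nat set"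
  defines "M \<equiv> verts S"
  defines "rk \<equiv> \<lambda>v. card {w \<in> M. w < v}"
  assumes G: "network n G" and n: "1 \<le> n" and W: "W \<le> 2 ^ q" and B: "(n + 1) * W \<le> 2 ^ B"
    and M: "M \<subseteq> {1..n}" and N: "N = card M"
    and S: "\<And>v u. v \<in> M \<Longrightarrow> u \<in> nbrs S v \<Longrightarrow> u \<in> M \<and> u \<in> ball_of G L v"
    and U0: "\<And>v. U0 v = ini \<lparr>hi_id = v, hi_incident = inc v,
      hi_skeleton = (if v \<in> M then Some (incident S v, H v, inp v) else None)\<rparr>"
    and v: "v \<in> {1..n}"
  shows "uid (fold (ustep G L B m) init_prog U0 v) = v"
    and "usk (fold (ustep G L B m) init_prog U0 v) =
      (if v \<in> M then Some (listing (incident S v), sorted_list_of_set (H v), inp v) else None)"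
    and "v \<in> M \<Longrightarrow> urk (fold (ustep G L B m) init_prog U0 v) = rk v \<and> unn (fold (ustep G L B m) init_prog U0 v) = N \<and>
      fst (uac (fold (ustep G L B m) init_prog U0 v)) = fst (ac_start S (\<lambda>v. Suc (rk v)) (\<lambda>v. tok_of N (rk v)) (nbrs S) inp (ALG N) v) \<and>
      fset (snd (uac (fold (ustep G L B m) init_prog U0 v))) = snd (ac_start S (\<lambda>v. Suc (rk v)) (\<lambda>v. tok_of N (rk v)) (nbrs S) inp (ALG N) v)"
proof -
  define U1 where "U1 = ustep G L B m (local_instr mk_rank) U0"
  define U2 where "U2 = fold (ustep G L B m) group_prog U1"
  define U3 where "U3 = ustep G L B m (local_instr read_rank) U2"
  define U4 where "U4 = ustep G L B m (local_instr ac_init) U3"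
  have U4: "fold (ustep G L B m) init_prog U0 = U4"
    unfolding init_prog_def U4_def U3_def U2_def U1_def by simp
  have verts: "verts G = {1..n}" using G by (simp add: network_def)
  have U0': "uid (U0 v) = v" "usk (U0 v) =
      (if v \<in> M then Some (listing (incident S v), sorted_list_of_set (H v), inp v) else None)" for v
    by (simp_all add: U0 ini_def)
  define g where "g v j = (if v \<in> M \<and> j = 0 then 1 else 0 :: nat)" for v j :: nat
  have U1: "U1 v = set_wr (load v (g v)) (U0 v)" for v
    unfolding U1_def ustep_local mk_rank_def U0' g_def by (auto intro!: arg_cong2[where f = set_wr] arg_cong2[where f = load])
  define \<gamma> where "\<gamma> p = g (p div m + 1) (p mod m)" for p
  define f1 where "f1 p = (\<gamma> p * W + p, p, \<gamma> p, 0 :: nat)" for p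
  have w1: "wires_are n m U1 f1"
    unfolding f1_def \<gamma>_def by (rule wires_are_load) (simp add: U1 U0')
  have \<gamma>1: "\<gamma> p \<le> 1" for p by (simp add: \<gamma>_def g_def)
  have f1b: "item_bound (2 ^ B) (f1 p)" if "p < W" for p
  proof -
    consider "\<gamma> p = 0" | "\<gamma> p = 1" using \<gamma>1[of p] by linarith
    then have "\<gamma> p * W + p < 2 * W" using that by cases auto
    moreover have "2 * W \<le> (n + 1) * W" using n by (intro mult_le_mono1) auto
    then have "2 * W \<le> 2 ^ B" using B by (rule order_trans)
    ultimately have "\<gamma> p * W + p < 2 ^ B" "p < 2 ^ B" "\<gamma> p < 2 ^ B" using that \<gamma>1[of p] by linarith+
    then show ?thesis unfolding f1_def item_bound_def by simp
  qed
  have nW: "W \<le> (n + 1) * W" by simp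
  define f2 where "f2 = run_stages W (op_stages q (group_value W (2 ^ B))) f1"
  have U2: "U2 v = set_wr (map (\<lambda>j. f2 ((v - 1) * m + j)) [0..<m]) (U1 v)" if "v \<in> {1..n}" for v
    unfolding U2_def group_prog_def f2_def
    by (rule fold_op_instrs[OF refl verts w1 f1b _ _ that]) (use B nW in \<open>auto simp: group_value_def\<close>)
  have f2: "f2 p = (p, p, start_of W \<gamma> p + index_of \<gamma> p, \<gamma> p * W + (W - 1 - start_of W \<gamma> p))" if "p < W" for p
    unfolding f2_def
  proof (rule group_op[OF W that])
    show "(\<gamma> p + 1) * W \<le> 2 ^ B" for p
      using \<gamma>1[of p] n B mult_le_mono1[of "\<gamma> p + 1" "n + 1" W] by linarith
  qed (simp add: f1_def)
  have finM: "finite M" using M finite_subset by blast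
  have m0: "0 < m" by simp
  \<comment> \<open>Used for \<open>w = n + 1\<close> to count all skeleton nodes and for
    \<open>w = v\<close> to count those before \<open>v\<close>.\<close>
  have \<gamma>M: "{y. y < (w - 1) * m \<and> \<gamma> y = 1} = (\<lambda>w. (w - 1) * m) ` {x \<in> M. x < w}" if "1 \<le> w" "w \<le> n + 1" for w
  proof (intro equalityI subsetI)
    fix y assume "y \<in> {y. y < (w - 1) * m \<and> \<gamma> y = 1}"
    then have y: "y < (w - 1) * m" "y div m + 1 \<in> M" "y mod m = 0" by (auto simp: \<gamma>_def g_def split: if_splits)
    have "y = (y div m + 1 - 1) * m" using y(3) by (metis add_diff_cancel_right' div_mult_mod_eq add_0_right)
    moreover have "y div m < w - 1" using y(1) by (simp add: div_less_iff_less_mult)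
    ultimately show "y \<in> (\<lambda>w. (w - 1) * m) ` {x \<in> M. x < w}"
      using y(2) by (intro image_eqI[of _ _ "y div m + 1"]) auto
  next
    fix y assume "y \<in> (\<lambda>w. (w - 1) * m) ` {x \<in> M. x < w}"
    then obtain x where x: "x \<in> M" "x < w" "y = (x - 1) * m" by auto
    have "1 \<le> x" using x(1) M by auto
    then have "(x - 1) < (w - 1)" using x(2) by linarith
    then show "y \<in> {y. y < (w - 1) * m \<and> \<gamma> y = 1}"
      using x \<open>1 \<le> x\<close> by (auto simp: \<gamma>_def g_def)
  qed
  have injM: "inj_on (\<lambda>w. (w - 1) * m) {x \<in> M. x < w}" for w
  proof (rule inj_onI)
    fix x y assume xy: "x \<in> {x \<in> M. x < w}" "y \<in> {x \<in> M. x < w}" "(x - 1) * m = (y - 1) * m"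
    then have "1 \<le> x" "1 \<le> y" "x - 1 = y - 1" using M m0 by auto
    then show "x = y" by linarith
  qed
  have st: "W - start_of W \<gamma> p = N" if "\<gamma> p = 1" for p
  proof -
    have "{y. y < W \<and> \<gamma> y = 1} = (\<lambda>w. (w - 1) * m) ` {x \<in> M. x < n + 1}" using \<gamma>M[of "n + 1"] by simp
    moreover have "{x \<in> M. x < n + 1} = M" using M by auto
    ultimately have c1: "card {y. y < W \<and> \<gamma> y = 1} = N"
      using injM[of "n + 1"] N by (simp add: card_image)
    define X where "X = {y \<in> {..<W}. \<gamma> y < 1}"
    have "\<gamma> y = 1 \<longleftrightarrow> \<not> \<gamma> y < 1" for y using \<gamma>1[of y] by linarith
    then have e: "{y. y < W \<and> \<gamma> y = 1} = {..<W} - X" unfolding X_def by auto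
    have "card ({..<W} - X) = card {..<W} - card X"
      by (rule card_Diff_subset) (auto simp: X_def)
    then have "card {y. y < W \<and> \<gamma> y = 1} = W - start_of W \<gamma> p"
      unfolding start_of_def that e X_def[symmetric] by (simp only: card_lessThan)
    then show ?thesis using c1 by simp
  qed
  have ix: "index_of \<gamma> ((v - 1) * m) = rk v" if "v \<in> M" for v
  proof -
    have v: "1 \<le> v" "v \<le> n" using that M by auto
    have "\<gamma> ((v - 1) * m) = 1" using v that by (simp add: \<gamma>_def g_def)
    then have "index_of \<gamma> ((v - 1) * m) = card {y. y < (v - 1) * m \<and> \<gamma> y = 1}"
      unfolding index_of_def by (auto intro!: arg_cong[where f = card])
    also have "\<dots> = rk v" unfolding \<gamma>M[OF v(1) le_SucI[OF v(2), unfolded Suc_eq_plus1]] rk_def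
      using injM[of v] by (simp add: card_image)
    finally show ?thesis .
  qed
  have U3: "uid (U3 v) = v" "usk (U3 v) = usk (U0 v)"
    "v \<in> M \<Longrightarrow> urk (U3 v) = rk v \<and> unn (U3 v) = N" if v: "v \<in> {1..n}" for v
  proof -
    have p: "(v - 1) * m < W" using block_index_less[OF m0, of "v - 1" n] v by auto
    have wr0: "uwr (U2 v) ! 0 = f2 ((v - 1) * m)" unfolding U2[OF v] by simp
    show "uid (U3 v) = v" "usk (U3 v) = usk (U0 v)"
      unfolding U3_def ustep_local read_rank_def using U2[OF v] U1[of v] U0'[of v]
      by (auto simp: Let_def split: prod.splits)
    assume vM: "v \<in> M"
    have g1: "\<gamma> ((v - 1) * m) = 1" using v vM by (simp add: \<gamma>_def g_def)
    have N0: "0 < N" using N finM vM by (auto simp: card_gt_0_iff)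
    let ?st = "start_of W \<gamma> ((v - 1) * m)"
    have sW: "W - ?st = N" by (rule st[OF g1])
    have s2: "W - 1 - (\<gamma> ((v - 1) * m) * W + (W - 1 - ?st)) mod W = ?st"
    proof -
      have "W - 1 - ?st < W" using p by linarith
      then have "(\<gamma> ((v - 1) * m) * W + (W - 1 - ?st)) mod W = W - 1 - ?st"
        by (simp only: mod_mult_self3 mod_less)
      then show ?thesis using sW N0 by linarith
    qed
    show "urk (U3 v) = rk v \<and> unn (U3 v) = N"
      unfolding U3_def ustep_local read_rank_def wr0 f2[OF p] prod.case Let_def s2
      using ix[OF vM] sW by simp
  qed
  have ball: "fset (known_ball G L U3 v) = U3 ` ball_of G L v" if "v \<in> {1..n}" for v
    unfolding known_ball_def using ball_of_subset[OF G that, of L]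
    by (intro Abs_fset_inverse) (auto intro: finite_subset)
  show "uid (fold (ustep G L B m) init_prog U0 v) = v"
    "usk (fold (ustep G L B m) init_prog U0 v) =
      (if v \<in> M then Some (listing (incident S v), sorted_list_of_set (H v), inp v) else None)"
    unfolding U4 U4_def ustep_local ac_init_def using U3[OF v] U0'(2)[of v] by (auto split: option.splits)
  assume vM: "v \<in> M"
  let ?K = "known_ball G L U3 v"
  have rank: "rank_in ?K u = rk u" if u: "u \<in> nbrs S v" for u
  proof -
    have uM: "u \<in> M" "u \<in> ball_of G L v" "u \<in> {1..n}" using S[OF vM u] M by auto
    have "(THE s. s |\<in>| ?K \<and> uid s = u) = U3 u"
    proof (rule the_equality)
      show "U3 u |\<in>| ?K \<and> uid (U3 u) = u" using ball[OF v] uM U3(1)[OF uM(3)] by auto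
    next
      fix s assume s: "s |\<in>| ?K \<and> uid s = u"
      then obtain w where "w \<in> ball_of G L v" "s = U3 w" using ball[OF v] by auto
      moreover have "w \<in> {1..n}" using calculation ball_of_subset[OF G v] by blast
      ultimately show "s = U3 u" using s U3(1)[of w] by simp
    qed
    then show ?thesis unfolding rank_in_def using U3(3)[OF uM(3) uM(1)] by simp
  qed
  have finN: "finite (incident S v)"
    unfolding incident_def using finite_subset[of "nbrs S v" M] S[OF vM] finM by blast
  have inc: "set (listing (incident S v)) = incident S v" "fst ` incident S v = nbrs S v"
    using listing(1)[OF finN] by (auto simp: incident_def image_image)
  have e1: "(\<lambda>(u, w). (Suc (rank_in ?K u), w)) ` incident S v = (\<lambda>(u, w). (Suc (rk u), w)) ` incident S v"
    using rank by (intro image_cong) (auto simp: incident_def)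
  have e2: "(\<lambda>u. (Suc (rank_in ?K u), tok_of N (rank_in ?K u))) ` nbrs S v = (\<lambda>u. (Suc (rk u), tok_of N (rk u))) ` nbrs S v"
    "(\<lambda>u. tok_of N (rank_in ?K u)) ` nbrs S v = (\<lambda>u. tok_of N (rk u)) ` nbrs S v"
    using rank by (auto intro!: image_cong)
  have sk: "usk (U3 v) = Some (listing (incident S v), sorted_list_of_set (H v), inp v)"
    using U3(2)[OF v] U0'(2)[of v] vM by simp
  have finT: "finite ((\<lambda>u. tok_of N (rk u)) ` nbrs S v)" using finN inc(2) by (metis finite_imageI)
  show "urk (fold (ustep G L B m) init_prog U0 v) = rk v \<and> unn (fold (ustep G L B m) init_prog U0 v) = N \<and>
      fst (uac (fold (ustep G L B m) init_prog U0 v)) = fst (ac_start S (\<lambda>v. Suc (rk v)) (\<lambda>v. tok_of N (rk v)) (nbrs S) inp (ALG N) v) \<and>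
      fset (snd (uac (fold (ustep G L B m) init_prog U0 v))) = snd (ac_start S (\<lambda>v. Suc (rk v)) (\<lambda>v. tok_of N (rk v)) (nbrs S) inp (ALG N) v)"
    unfolding U4 U4_def ustep_local ac_init_def sk
    using U3(3)[OF v vM] finT by (simp add: inc e1 e2 ac_start_def Abs_fset_inverse)
qed

end

section \<open>Simulating one round\<close>

text \<open>Node \<open>v\<close> serves at most \<open>Q\<close> skeleton nodes and is dealt at
  most \<open>q1\<close> indices by each. The factor 2 accounts for messages and slots.\<close>

lemma (in routing) card_cargo_for:
  assumes dist: "\<And>w. w \<in> M \<Longrightarrow> distinct (hl w)" and Q: "card {w \<in> M. v \<in> set (hl w)} \<le> Q"
    and q1: "\<And>w. w \<in> M \<Longrightarrow> c div length (hl w) + 1 \<le> q1"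
  shows "card (cargo_for v) \<le> 2 * (Q * q1)"
proof -
  define I where "I w = {i. i < c \<and> helper w i = v}" for w
  define Mv where "Mv = {w \<in> M. v \<in> set (hl w)}"
  have hs: "helper w i \<in> set (hl w)" if "w \<in> M" for w i
    using hl[OF that] unfolding helper_def by (meson length_greater_0_conv mod_less_divisor nth_mem)
  have finMv: "finite Mv" using finite_M by (simp add: Mv_def)
  have I: "finite (I w)" "card (I w) \<le> q1" if w: "w \<in> M" for w
  proof -
    show "finite (I w)" by (simp add: I_def)
    have l0: "0 < length (hl w)" using hl[OF w] by simp
    \<comment> \<open>The helpers are distinct, so indices dealt to the same helper agree modulo the
      number of helpers and differ in their quotients.\<close>
    have "inj_on (\<lambda>i. i div length (hl w)) (I w)"
    proof (rule inj_onI)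
      fix i i' assume i: "i \<in> I w" "i' \<in> I w" "i div length (hl w) = i' div length (hl w)"
      then have "hl w ! (i mod length (hl w)) = hl w ! (i' mod length (hl w))"
        by (simp add: I_def helper_def)
      then have "i mod length (hl w) = i' mod length (hl w)"
        using dist[OF w] l0 by (simp add: nth_eq_iff_index_eq)
      then show "i = i'" using i(3) by (metis div_mult_mod_eq)
    qed
    moreover have "(\<lambda>i. i div length (hl w)) ` I w \<subseteq> {..c div length (hl w)}"
      by (auto simp: I_def intro: div_le_mono)
    ultimately have "card (I w) \<le> card {..c div length (hl w)}" by (intro card_inj_on_le) auto
    then show "card (I w) \<le> q1" using q1[OF w] by simp
  qed
  have "card (Sigma Mv I) = (\<Sum>w\<in>Mv. card (I w))"
    using finMv I(1) by (intro card_SigmaI) (auto simp: Mv_def)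
  also have "\<dots> \<le> (\<Sum>w\<in>Mv. q1)" using I(2) by (intro sum_mono) (auto simp: Mv_def)
  also have "\<dots> \<le> Q * q1" using Q by (simp add: Mv_def)
  finally have Z: "card (Sigma Mv I) \<le> Q * q1" .
  have finZ: "finite (Sigma Mv I)" using finMv I(1) by (intro finite_SigmaI) (auto simp: Mv_def)
  have "cargo_for v \<subseteq> msg_of ` Sigma Mv I \<union> (\<lambda>(w, j). Slot w (rk w) j) ` Sigma Mv I"
  proof
    fix x assume "x \<in> cargo_for v"
    then consider w i where "(w, i) \<in> issued" "helper w i = v" "x = msg_of (w, i)"
      | w j where "w \<in> M" "j < c" "helper w j = v" "x = Slot w (rk w) j"
      unfolding cargo_for_def by auto
    then show "x \<in> msg_of ` Sigma Mv I \<union> (\<lambda>(w, j). Slot w (rk w) j) ` Sigma Mv I"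
    proof cases
      case 1
      then have "(w, i) \<in> Sigma Mv I" using ms(1)[of w] hs[of w i] by (auto simp: issued_def Mv_def I_def)
      then show ?thesis using 1 by blast
    next
      case 2
      then have "(w, j) \<in> Sigma Mv I" using hs[of w j] by (auto simp: Mv_def I_def)
      then show ?thesis using 2 by force
    qed
  qed
  then have "card (cargo_for v) \<le> card (msg_of ` Sigma Mv I \<union> (\<lambda>(w, j). Slot w (rk w) j) ` Sigma Mv I)"
    using finZ by (intro card_mono) auto
  also have "\<dots> \<le> card (Sigma Mv I) + card (Sigma Mv I)"
    by (intro order_trans[OF card_Un_le] add_mono card_image_le finZ)
  finally show ?thesis using Z by linarith
qed

text \<open>An adversary must have an answer for every finite set of messages, also for sets that no
  run produces. A greedy choice by position works at both caps.\<close>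

lemma capped_delivery_exists:
  assumes "finite A"
  shows "\<exists>D. capped_delivery cap A dest D"
proof -
  define B where "B = {x \<in> A. position_in {y \<in> A. fst y = fst x} prod_encode x < cap}"
  define D where "D = {x \<in> B. position_in {y \<in> B. dest y = dest x} prod_encode x < cap}"
  have fin: "finite B" using assms by (simp add: B_def)
  have "{x \<in> B. fst x = u} = {x \<in> {y \<in> A. fst y = u}. position_in {y \<in> A. fst y = u} prod_encode x < cap}" for u
    unfolding B_def by auto
  then have "card {x \<in> B. fst x = u} = min cap (card {x \<in> A. fst x = u})" for u
    using card_first[of "{y \<in> A. fst y = u}" prod_encode cap] assms inj_prod_encode by (auto intro: inj_on_subset)
  moreover have "{x \<in> D. dest x = w} = {x \<in> {y \<in> B. dest y = w}. position_in {y \<in> B. dest y = w} prod_encode x < cap}" for w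
    unfolding D_def by auto
  then have "card {x \<in> D. dest x = w} = min cap (card {x \<in> B. dest x = w})" for w
    using card_first[of "{y \<in> B. dest y = w}" prod_encode cap] fin inj_prod_encode by (auto intro: inj_on_subset)
  moreover have "B \<subseteq> A" "D \<subseteq> B" by (auto simp: B_def D_def)
  ultimately show ?thesis unfolding capped_delivery_def by blast
qed

section \<open>The adversary of the simulated model and the coupling of a round\<close>

context simulation
begin

definition msg_lists :: "(nat \<Rightarrow> nat) \<Rightarrow> slot set \<Rightarrow> (nat \<Rightarrow> ac_act) \<Rightarrow> (slot \<Rightarrow> nat) \<Rightarrow> nat \<Rightarrow> (nat \<times> ac_msg) list" where
  "msg_lists rk A acts dest v = out_list {i. (v, i) \<in> A} (\<lambda>i. rk (dest (v, i))) (snd (acts v))"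

definition pays :: "nat \<Rightarrow> (nat \<Rightarrow> (nat \<times> ac_msg) list) \<Rightarrow> nat \<Rightarrow> nat \<Rightarrow> nat" where
  "pays N ms w i = (if N = 1 then i else msg_code (snd (ms w ! i)))"

text \<open>Translates an index in the truncated list of valid messages into the index under which
  the node issued the message.\<close>

definition nth_slot :: "slot set \<Rightarrow> slot \<Rightarrow> slot" where
  "nth_slot A = (\<lambda>(v, i). (v, sorted_list_of_set {i. (v, i) \<in> A} ! i))"

text \<open>For fixed \<open>M\<close>, \<open>H\<close> and \<open>rk\<close> the outcome of the
  routing depends only on the actions, the issued messages and their destinations, all of which the
  adversary sees before it delivers.\<close>

definition selection :: "nat set \<Rightarrow> (nat \<Rightarrow> nat set) \<Rightarrow> (nat \<Rightarrow> nat) \<Rightarrow> (nat \<Rightarrow> ac_act) \<Rightarrow> slot set \<Rightarrow> (slot \<Rightarrow> nat) \<Rightarrow> slot set" where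
  "selection M H rk acts A dest = nth_slot A ` routing.accepted n a c M (\<lambda>v. sorted_list_of_set (H v)) rk
     (msg_lists rk A acts dest) (pays (card M) (msg_lists rk A acts dest))"

text \<open>The messages that the routing procedure delivers. The second alternative never occurs in a run.\<close>

definition ac_adv :: "nat set \<Rightarrow> (nat \<Rightarrow> nat set) \<Rightarrow> (nat \<Rightarrow> nat) \<Rightarrow> ac_act adversary" where
  "ac_adv M H rk es acts A dest = return_pmf
     (if capped_delivery c A dest (selection M H rk acts A dest) then selection M H rk acts A dest
      else SOME D. capped_delivery c A dest D)"

lemma adversary_ac_adv: "adversary c (ac_adv M H rk)"
  unfolding adversary_def ac_adv_def using someI_ex[OF capped_delivery_exists[of _ c]] by auto

text \<open>The last conjunct confines known tokens to those of skeleton nodes. Hence a token can be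
  inverted to a rank, and with two or more nodes no message conveys an empty token.\<close>

definition related :: "wgraph \<Rightarrow> (nat \<Rightarrow> nat set) \<Rightarrow> (nat \<Rightarrow> bits) \<Rightarrow> (nat \<Rightarrow> nat) \<Rightarrow> (nat \<Rightarrow> ust) \<Rightarrow>
    (nat \<Rightarrow> ac_state) \<Rightarrow> bool" where
  "related S H inp rk U cfg \<longleftrightarrow> (\<forall>v\<in>{1..n}. uid (U v) = v \<and> usk (U v) =
      (if v \<in> verts S then Some (listing (incident S v), sorted_list_of_set (H v), inp v) else None)) \<and>
    (\<forall>v\<in>verts S. urk (U v) = rk v \<and> unn (U v) = card (verts S) \<and> fst (uac (U v)) = fst (cfg v) \<and>
      fset (snd (uac (U v))) = snd (cfg v) \<and> snd (cfg v) \<subseteq> (\<lambda>v. tok_of (card (verts S)) (rk v)) ` verts S)"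

text \<open>Once \<open>couple_sample\<close> has fixed common choices, both sides are
  deterministic. It remains to show that the accepted messages form an admissible delivery; then
  \<open>ac_adv\<close> delivers exactly these, and the inboxes agree.\<close>

lemma round_couple:
  fixes G S :: wgraph and H :: "nat \<Rightarrow> nat set" and inp rk
  defines "M \<equiv> verts S" and "N \<equiv> card (verts S)"
  defines "tok \<equiv> \<lambda>v. tok_of N (rk v)"
  assumes G: "network n G" and W: "W \<le> 2 ^ q" and B1: "(n + 1) * W \<le> 2 ^ B"
    and B2: "2 * (n * c) + W \<le> 2 ^ B" and B3: "(n * c + 1) * P \<le> 2 ^ B"
    and M: "M \<subseteq> {1..n}" "M \<noteq> {}" and rk: "bij_betw rk M {..<N}"
    and H: "\<And>v. v \<in> M \<Longrightarrow> H v \<subseteq> {1..n} \<and> H v \<noteq> {}"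
    and hb: "\<And>w v. w \<in> M \<Longrightarrow> v \<in> H w \<Longrightarrow> w \<in> ball_of G L v \<and> v \<in> ball_of G L w"
    and Q: "\<And>v. v \<in> {1..n} \<Longrightarrow> card {w \<in> M. v \<in> H w} \<le> Q"
    and q1: "\<And>w. w \<in> M \<Longrightarrow> c div card (H w) + 1 \<le> q1" and m: "2 * (Q * q1) \<le> m"
    and P: "c \<le> P" "\<And>mem act tgt msg. act \<in> set_pmf (a_act (ALG N) mem) \<Longrightarrow> (tgt, msg) \<in> set (snd act) \<Longrightarrow>
        [] \<notin> set (snd msg) \<Longrightarrow> msg_code msg < P"
    and rel: "related S H inp rk U cfg"
  shows "rel_pmf (\<lambda>U' (e, cfg'). related S H inp rk (fold (ustep G L B m) round_tail (ustep G L B m round_head U')) cfg')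
    (Pi_pmf {1..n} undefined (\<lambda>v. sample (U v))) (ac_step S tok (ALG N) (ac_adv M H rk) es cfg)"
proof -
  define mem where "mem v = fst (cfg v)" for v
  define T where "T v = snd (cfg v)" for v
  define I where "I v act = valid (T v) (snd act)" for v and act :: ac_act
  define slots where "slots acts = Sigma M (\<lambda>v. I v (acts v))" for acts :: "nat \<Rightarrow> ac_act"
  define dests where "dests acts rand = (\<lambda>(u, i). case fst (snd (acts u) ! i) of
      Token \<tau> \<Rightarrow> the_inv_into M tok \<tau> | Random \<Rightarrow> rand (u, i))" for acts :: "nat \<Rightarrow> ac_act" and rand :: "slot \<Rightarrow> nat"
  define boxes where "boxes acts dest D v = image_mset (\<lambda>(u, i). snd (snd (acts u) ! i)) (mset_set {x \<in> D. dest x = v})"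
    for acts :: "nat \<Rightarrow> ac_act" and dest :: "slot \<Rightarrow> nat" and D v
  define next_cfg where "next_cfg acts dest D v = (a_upd (ALG N) (fst (acts v)) (boxes acts dest D v),
      T v \<union> (\<Union>x\<in>set_mset (boxes acts dest D v). set (snd x)))" for acts dest D v
  have finM: "finite M" using M(1) finite_subset by blast
  have finI: "finite (I v act)" for v act unfolding I_def by simp
  have tokinj: "inj_on tok M"
    using rk inj_tok_of[of N] unfolding tok_def bij_betw_def inj_on_def by blast
  have N1: "1 \<le> N" "N \<le> n"
    using M finM card_mono[OF _ M(1)] unfolding N_def M_def[symmetric] by (auto simp: Suc_le_eq card_gt_0_iff)
  have relM: "urk (U v) = rk v" "unn (U v) = N" "fst (uac (U v)) = mem v" "fset (snd (uac (U v))) = T v"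
    "T v \<subseteq> tok ` M" if "v \<in> M" for v
    using rel that unfolding related_def M_def N_def tok_def mem_def T_def by auto
  have relV: "uid (U v) = v" "usk (U v) =
      (if v \<in> M then Some (listing (incident S v), sorted_list_of_set (H v), inp v) else None)" if "v \<in> {1..n}" for v
    using rel that unfolding related_def M_def by auto
  define acts_pmf where "acts_pmf = Pi_pmf M undefined (\<lambda>v. a_act (ALG N) (mem v))"
  define base where "base = bind_pmf acts_pmf (\<lambda>acts. map_pmf (Pair acts) (Pi_pmf (slots acts) undefined (\<lambda>_. pmf_of_set M)))"
  have A_eq: "{(u, i). u \<in> verts S \<and> i < length (snd (acts u)) \<and> may_send (snd (cfg u)) (snd (acts u) ! i)} = slots acts" for acts
    unfolding slots_def I_def valid_def T_def M_def by auto
  have step: "ac_step S tok (ALG N) (ac_adv M H rk) es cfg = bind_pmf base (\<lambda>(acts, rand).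
      bind_pmf (ac_adv M H rk es acts (slots acts) (dests acts rand)) (\<lambda>D.
        return_pmf ((acts, dests acts rand, D), next_cfg acts (dests acts rand) D)))"
    unfolding ac_step_def Let_def A_eq base_def acts_pmf_def bind_assoc_pmf bind_map_pmf mem_def dests_def
      next_cfg_def boxes_def T_def M_def prod.case ..
  have couple: "rel_pmf (\<lambda>U' (acts, rand). \<forall>v\<in>{1..n}. U' v =
      (if v \<in> M then issue_by rk N (U v) (acts v) (\<lambda>i. rand (v, i)) else U v))
    (Pi_pmf {1..n} undefined (\<lambda>v. sample (U v))) base"
    unfolding base_def acts_pmf_def slots_def I_def
    by (rule couple_sample[OF M rk]) (use relM relV M in auto)
  show ?thesis
    unfolding step
  proof (subst bind_return_pmf'[of "Pi_pmf {1..n} undefined (\<lambda>v. sample (U v))", symmetric],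
      rule rel_pmf_bind_set[OF couple])
    fix U' x
    assume "case x of (acts, rand) \<Rightarrow> \<forall>v\<in>{1..n}. U' v =
      (if v \<in> M then issue_by rk N (U v) (acts v) (\<lambda>i. rand (v, i)) else U v)" and "x \<in> set_pmf base"
    moreover obtain acts rand where x: "x = (acts, rand)" by force
    ultimately have U': "\<And>v. v \<in> {1..n} \<Longrightarrow> U' v =
        (if v \<in> M then issue_by rk N (U v) (acts v) (\<lambda>i. rand (v, i)) else U v)"
      and xs: "acts \<in> set_pmf acts_pmf" "rand \<in> set_pmf (Pi_pmf (slots acts) undefined (\<lambda>_. pmf_of_set M))"
      unfolding base_def by auto
    define A where "A = slots acts"
    define dest where "dest = dests acts rand"
    have finA: "finite A" unfolding A_def slots_def using finM finI by (intro finite_SigmaI) auto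
    have act: "acts v \<in> set_pmf (a_act (ALG N) (mem v))" if "v \<in> M" for v
      using xs(1) that finM unfolding acts_pmf_def set_Pi_pmf[OF finM] by (auto simp: PiE_dflt_def)
    have rand: "rand b \<in> M" if "b \<in> A" for b
      using xs(2) that M(2) finM unfolding set_Pi_pmf[OF finA[unfolded A_def]] A_def
      by (cases b) (auto simp: PiE_dflt_def set_pmf_of_set)
    have AI: "{i. (v, i) \<in> A} = (if v \<in> M then I v (acts v) else {})" for v
      by (auto simp: A_def slots_def)
    have dest_M: "dest (v, i) \<in> M" and dest_rk: "dest_rank N (fst (snd (acts v) ! i)) (rk (rand (v, i))) = rk (dest (v, i))"
      and send: "may_send (T v) (snd (acts v) ! i)" "i < length (snd (acts v))" "v \<in> M"
      if "(v, i) \<in> A" for v i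
    proof -
      show vM: "v \<in> M" and send: "may_send (T v) (snd (acts v) ! i)" "i < length (snd (acts v))"
        using that by (auto simp: A_def slots_def I_def valid_def)
      have "dest (v, i) \<in> M \<and> dest_rank N (fst (snd (acts v) ! i)) (rk (rand (v, i))) = rk (dest (v, i))"
      proof (cases "fst (snd (acts v) ! i)")
        case (Token \<tau>)
        then have "\<tau> \<in> T v" using send by (simp add: may_send_def)
        then obtain w where w: "w \<in> M" "\<tau> = tok w" using relM(5)[OF vM] by auto
        then have "dest (v, i) = w"
          unfolding dest_def dests_def using Token tokinj by (simp add: the_inv_into_f_f)
        moreover have "dest_rank N (Token \<tau>) r = rk w" for r
          unfolding dest_rank_def target.case w(2) tok_def using inj_tok_of[of N] rk w(1)
          by (intro the_inv_into_f_f) (auto simp: bij_betw_def)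
        ultimately show ?thesis using w Token by simp
      next
        case Random
        then show ?thesis using rand[OF that] by (simp add: dest_def dests_def dest_rank_def)
      qed
      then show "dest (v, i) \<in> M" "dest_rank N (fst (snd (acts v) ! i)) (rk (rand (v, i))) = rk (dest (v, i))"
        by auto
    qed
    define ms where "ms = msg_lists rk A acts dest"
    define pay where "pay = pays N ms"
    define hl where "hl v = sorted_list_of_set (H v)" for v
    define vl where "vl v = sorted_list_of_set {i. (v, i) \<in> A}" for v
    have finAv: "finite {i. (v, i) \<in> A}" for v unfolding AI using finI by simp
    have vl: "set (vl v) = {i. (v, i) \<in> A}" "distinct (vl v)" "length (vl v) = card {i. (v, i) \<in> A}" for v
      unfolding vl_def using finAv[of v] by auto
    have len: "length (ms v) = min c (card {i. (v, i) \<in> A})" for v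
      unfolding ms_def msg_lists_def out_list_def using vl(3)[of v] by (simp add: vl_def)
    have nth: "ms v ! i = (rk (dest (v, vl v ! i)), snd (snd (acts v) ! (vl v ! i)))"
      "(v, vl v ! i) \<in> A" if "i < length (ms v)" for v i
    proof -
      have i: "i < length (vl v)" "i < c" using that len[of v] vl(3)[of v] by auto
      show "ms v ! i = (rk (dest (v, vl v ! i)), snd (snd (acts v) ! (vl v ! i)))"
        unfolding ms_def msg_lists_def out_list_def using i by (simp add: vl_def)
      show "(v, vl v ! i) \<in> A" using nth_mem[OF i(1)] vl(1)[of v] by auto
    qed
    have finH: "finite (H v)" if "v \<in> M" for v using H[OF that] finite_subset by blast
    have hl: "set (hl v) = H v" "distinct (hl v)" "length (hl v) = card (H v)" if "v \<in> M" for v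
      unfolding hl_def using finH[OF that] by auto
    have tokens_msg: "[] \<notin> set (snd (snd (ms v ! i)))" if "N \<noteq> 1" "i < length (ms v)" for v i
    proof -
      have "set (snd (snd (ms v ! i))) \<subseteq> T v" "v \<in> M"
        using nth[OF that(2)] send[OF nth(2)[OF that(2)]] by (auto simp: may_send_def)
      then have "set (snd (snd (ms v ! i))) \<subseteq> tok ` M" using relM(5) by blast
      moreover have "[] \<notin> tok ` M" using that(1) by (auto simp: tok_def tok_of_def)
      ultimately show ?thesis by blast
    qed
    \<comment> \<open>A single node transmits indices, which are below \<open>c\<close>. Otherwise
      no conveyed token is empty, and the bound on message codes applies.\<close>
    have payP: "pay w i < P" if "w \<in> M" "i < length (ms w)" for w i
    proof (cases "N = 1")
      case True
      then show ?thesis using that len[of w] P(1) by (simp add: pay_def pays_def)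
    next
      case False
      have "snd (acts w) ! (vl w ! i) \<in> set (snd (acts w))"
        using send(2)[OF nth(2)[OF that(2)]] by simp
      then have "(fst (snd (acts w) ! (vl w ! i)), snd (ms w ! i)) \<in> set (snd (acts w))"
        using nth(1)[OF that(2)] by simp
      then have "msg_code (snd (ms w ! i)) < P"
        by (rule P(2)[OF act[OF that(1)]]) (use tokens_msg[OF False that(2)] in auto)
      then show ?thesis using False by (simp add: pay_def pays_def)
    qed
    have routing: "routing n c N P M hl rk ms pay"
    proof
      show "hl w \<noteq> [] \<and> set (hl w) \<subseteq> {1..n}" if "w \<in> M" for w
        using H[OF that] hl(1)[OF that] by auto
      show "fst (ms w ! i) < N" if "w \<in> M" "i < length (ms w)" for w i
        using nth[OF that(2)] dest_M[of w "vl w ! i"] rk by (auto simp: bij_betw_def)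
      show "length (ms w) \<le> c" for w using len[of w] by simp
    qed (use M N1 rk payP in auto)
    interpret r: routing n a c N B P q M hl rk ms pay by (rule routing)
    have size: "\<forall>v\<in>{1..n}. card (r.cargo_for v) \<le> m"
    proof
      fix v assume v: "v \<in> {1..n}"
      have "card (r.cargo_for v) \<le> 2 * (Q * q1)"
      proof (rule r.card_cargo_for)
        have "{w \<in> M. v \<in> set (hl w)} = {w \<in> M. v \<in> H w}" using hl(1) by auto
        then show "card {w \<in> M. v \<in> set (hl w)} \<le> Q" using Q[OF v] by simp
        show "c div length (hl w) + 1 \<le> q1" if "w \<in> M" for w using q1[OF that] hl(3)[OF that] by simp
      qed (use hl in auto)
      then show "card (r.cargo_for v) \<le> m" using m by linarith
    qed
    have U'M: "usk (U' v) = usk (U v)" "urk (U' v) = rk v" "unn (U' v) = N" "uout (U' v) = ms v"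
      "uac (U' v) = (fst (acts v), snd (uac (U v)))" if v: "v \<in> M" for v
    proof -
      have vn: "v \<in> {1..n}" using v M by blast
      have e: "U' v = issue_by rk N (U v) (acts v) (\<lambda>i. rand (v, i))" using U'[OF vn] v by simp
      show "usk (U' v) = usk (U v)" "urk (U' v) = rk v" "unn (U' v) = N"
        "uac (U' v) = (fst (acts v), snd (uac (U v)))"
        unfolding e issue_by_def using relM[OF v] by simp_all
      have Iv: "valid (T v) (snd (acts v)) = {i. (v, i) \<in> A}" using v unfolding AI I_def by simp
      have "uout (U' v) = out_list {i. (v, i) \<in> A} (\<lambda>i. dest_rank N (fst (snd (acts v) ! i)) (rk (rand (v, i)))) (snd (acts v))"
        unfolding e issue_by_def relM(4)[OF v] Iv by simp
      also have "\<dots> = ms v"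
        unfolding ms_def msg_lists_def by (rule out_list_cong[OF finAv]) (use dest_rk in auto)
      finally show "uout (U' v) = ms v" .
    qed
    have U'n: "uid (U' v) = v" "usk (U' v) = usk (U v)" if "v \<in> {1..n}" for v
      using U'[OF that] relV(1)[OF that] by (auto simp: issue_by_def)
    let ?U2 = "fold (ustep G L B m) round_tail (ustep G L B m round_head U')"
    have res: "\<forall>v\<in>{1..n}. let U2 = ?U2 in
      uid (U2 v) = v \<and> usk (U2 v) = usk (U' v) \<and> urk (U2 v) = urk (U' v) \<and> unn (U2 v) = unn (U' v) \<and>
      (v \<in> M \<longrightarrow> uac (U2 v) =
        (let inbox = image_mset (\<lambda>(w, i). snd (ms w ! i)) (mset_set {b \<in> r.accepted. r.dst b = rk v})
         in (a_upd (ALG N) (fst (uac (U' v))) inbox,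
           snd (uac (U' v)) |\<union>| Abs_fset (\<Union>x\<in>set_mset inbox. set (snd x)))))"
    proof (rule round_tail_all[where hl = hl and pay = pay, OF G W B1 B2 B3])
      show "uid (U' v) = v" if "v \<in> {1..n}" for v using U'n that by simp
      show "if v \<in> M then \<exists>inc inp. usk (U' v) = Some (inc, hl v, inp) else usk (U' v) = None" if "v \<in> {1..n}" for v
        using U'n(2)[OF that] relV(2)[OF that] by (simp add: hl_def)
      show "urk (U' v) = rk v \<and> unn (U' v) = N \<and> uout (U' v) = ms v" if "v \<in> M" for v
        using U'M[OF that] by simp
      show "payload (U' v) i = pay v i" if "v \<in> M" "i < length (ms v)" for v i
        using U'M[OF that(1)] by (simp add: payload_def pay_def pays_def)
      show "w \<in> ball_of G L v \<and> v \<in> ball_of G L w" if "w \<in> M" "v \<in> set (hl w)" for w v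
        using hb[OF that(1)] that(2) hl(1)[OF that(1)] by blast
    qed (fact routing size)+
    define D where "D = nth_slot A ` r.accepted"
    have conv: "nth_slot A b = (fst b, vl (fst b) ! snd b)" for b
      by (cases b) (simp add: nth_slot_def vl_def)
    have convA: "nth_slot A b \<in> A" "r.dst b = rk (dest (nth_slot A b))" if "b \<in> r.issued" for b
    proof -
      have "snd b < length (ms (fst b))" using that by (auto simp: r.issued_def)
      from nth[OF this] show "nth_slot A b \<in> A" "r.dst b = rk (dest (nth_slot A b))"
        unfolding conv by (auto simp: r.dst_def case_prod_unfold)
    qed
    have conv_inj: "inj_on (nth_slot A) r.issued"
    proof (rule inj_onI)
      fix b b' assume b: "b \<in> r.issued" "b' \<in> r.issued" "nth_slot A b = nth_slot A b'"
      then have f: "fst b = fst b'" "vl (fst b) ! snd b = vl (fst b) ! snd b'" unfolding conv by auto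
      have "snd b < length (vl (fst b))" "snd b' < length (vl (fst b))"
        using b(1,2) f(1) len vl(3) by (auto simp: r.issued_def)
      then have "snd b = snd b'" using f(2) vl(2) nth_eq_iff_index_eq by blast
      then show "b = b'" using f(1) by (simp add: prod_eq_iff)
    qed
    have acc: "r.accepted \<subseteq> r.issued" by (auto simp: r.accepted_def)
    have destD: "{x \<in> nth_slot A ` X. dest x = w} = nth_slot A ` {b \<in> X. r.dst b = rk w}" if "X \<subseteq> r.issued" "w \<in> M" for X w
    proof -
      have "dest (nth_slot A b) = w \<longleftrightarrow> r.dst b = rk w" if "b \<in> X" for b
      proof -
        have b: "b \<in> r.issued" using that \<open>X \<subseteq> r.issued\<close> by blast
        have "dest (nth_slot A b) \<in> M" using dest_M convA(1)[OF b] by (cases "nth_slot A b") auto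
        then show ?thesis using convA(2)[OF b] rk \<open>w \<in> M\<close> by (auto simp: bij_betw_def dest: inj_onD)
      qed
      then have "{b \<in> X. dest (nth_slot A b) = w} = {b \<in> X. r.dst b = rk w}" by blast
      moreover have "{x \<in> nth_slot A ` X. dest x = w} = nth_slot A ` {b \<in> X. dest (nth_slot A b) = w}" by blast
      ultimately show ?thesis by simp
    qed
    have destD0: "{x \<in> nth_slot A ` X. dest x = w} = {}" if "X \<subseteq> r.issued" "w \<notin> M" for X w
    proof -
      have "dest (nth_slot A b) \<in> M" if "b \<in> X" for b
        using dest_M convA(1)[of b] that \<open>X \<subseteq> r.issued\<close> by (cases "nth_slot A b") auto
      then show ?thesis using that(2) by auto
    qed
    have capped: "capped_delivery c A dest D"
      unfolding capped_delivery_def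
    proof (intro exI conjI allI)
      \<comment> \<open>The messages let through at the senders are the first \<open>c\<close> valid
        ones of each node; the cap of the recipients then acts on these.\<close>
      show "nth_slot A ` r.issued \<subseteq> A" using convA(1) by blast
      show "D \<subseteq> nth_slot A ` r.issued" using acc by (auto simp: D_def)
      fix w
      show "card {x \<in> nth_slot A ` r.issued. fst x = w} = min c (card {x \<in> A. fst x = w})"
      proof -
        have "fst (nth_slot A b) = fst b" for b unfolding conv by simp
        moreover have "{x \<in> nth_slot A ` r.issued. fst x = w} = nth_slot A ` {b \<in> r.issued. fst (nth_slot A b) = w}"
          by blast
        ultimately have "{x \<in> nth_slot A ` r.issued. fst x = w} = nth_slot A ` {b \<in> r.issued. fst b = w}"
          by simp
        then have "card {x \<in> nth_slot A ` r.issued. fst x = w} = card {b \<in> r.issued. fst b = w}"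
          using conv_inj by (simp add: card_image inj_on_subset)
        also have "{b \<in> r.issued. fst b = w} = (if w \<in> M then Pair w ` {..<length (ms w)} else {})"
          by (auto simp: r.issued_def)
        also have "card \<dots> = length (ms w)"
        proof (cases "w \<in> M")
          case False
          then show ?thesis using len[of w] by (simp add: AI)
        qed (simp add: card_image inj_on_def)
        also have "\<dots> = min c (card (Pair w ` {i. (w, i) \<in> A}))" using len[of w] by (simp add: card_image inj_on_def)
        also have "Pair w ` {i. (w, i) \<in> A} = {x \<in> A. fst x = w}" by auto
        finally show ?thesis .
      qed
      show "card {x \<in> D. dest x = w} = min c (card {x \<in> nth_slot A ` r.issued. dest x = w})"
      proof (cases "w \<in> M")
        case True
        have "card {x \<in> D. dest x = w} = card {b \<in> r.accepted. r.dst b = rk w}"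
          unfolding D_def destD[OF acc True] by (rule card_image) (use conv_inj acc in \<open>auto intro: inj_on_subset\<close>)
        also have "\<dots> = min c (card {b \<in> r.issued. r.dst b = rk w})" by (rule r.card_accepted[OF size])
        also have "card {b \<in> r.issued. r.dst b = rk w} = card {x \<in> nth_slot A ` r.issued. dest x = w}"
          unfolding destD[OF subset_refl True]
          by (rule card_image[symmetric]) (use conv_inj in \<open>auto intro: inj_on_subset\<close>)
        finally show ?thesis .
      next
        case False
        then show ?thesis unfolding D_def destD0[OF acc False] destD0[OF subset_refl False] by simp
      qed
    qed
    have selD: "selection M H rk acts A dest = D"
      unfolding selection_def D_def ms_def pay_def N_def M_def hl_def by simp
    have adv: "ac_adv M H rk es acts A dest = return_pmf D"
      unfolding ac_adv_def selD using capped by simp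
    have box: "boxes acts dest D v = image_mset (\<lambda>(w, i). snd (ms w ! i)) (mset_set {b \<in> r.accepted. r.dst b = rk v})"
      if v: "v \<in> M" for v
    proof -
      let ?X = "{b \<in> r.accepted. r.dst b = rk v}"
      have injX: "inj_on (nth_slot A) ?X" using conv_inj acc by (auto intro: inj_on_subset)
      have finX: "finite ?X" using r.finite_issued acc by (auto intro: finite_subset)
      have "snd (snd (acts (fst b)) ! (vl (fst b) ! snd b)) = snd (ms (fst b) ! snd b)" if "b \<in> ?X" for b
        using nth(1)[of "snd b" "fst b"] that acc by (auto simp: r.issued_def)
      then show ?thesis
        unfolding boxes_def D_def destD[OF acc v] image_mset_mset_set[OF injX, symmetric] multiset.map_comp
        by (intro image_mset_cong) (use finX in \<open>auto simp: conv\<close>)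
    qed
    have "related S H inp rk ?U2 (next_cfg acts dest D)"
      unfolding related_def
    proof (intro conjI ballI)
      fix v assume v: "v \<in> {1..n}"
      show "uid (?U2 v) = v" "usk (?U2 v) =
          (if v \<in> verts S then Some (listing (incident S v), sorted_list_of_set (H v), inp v) else None)"
        using bspec[OF res v, unfolded Let_def] unfolding U'n(2)[OF v] relV(2)[OF v] M_def by blast+
    next
      fix v assume "v \<in> verts S"
      then have v: "v \<in> M" "v \<in> {1..n}" using M by (auto simp: M_def)
      have R: "urk (?U2 v) = urk (U' v)" "unn (?U2 v) = unn (U' v)"
        "uac (?U2 v) = (a_upd (ALG N) (fst (uac (U' v))) (boxes acts dest D v),
           snd (uac (U' v)) |\<union>| Abs_fset (\<Union>x\<in>set_mset (boxes acts dest D v). set (snd x)))"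
        unfolding box[OF v(1)] using bspec[OF res v(2), unfolded Let_def] v(1) by blast+
      let ?box = "boxes acts dest D v"
      have ac: "uac (?U2 v) = (a_upd (ALG N) (fst (acts v)) ?box,
           snd (uac (U v)) |\<union>| Abs_fset (\<Union>x\<in>set_mset ?box. set (snd x)))"
        unfolding R(3) U'M(5)[OF v(1)] by simp
      show "urk (?U2 v) = rk v" "unn (?U2 v) = card (verts S)"
        using R(1,2) U'M[OF v(1)] by (simp_all add: N_def)
      show "fst (uac (?U2 v)) = fst (next_cfg acts dest D v)" unfolding ac next_cfg_def by simp
      have "finite (\<Union>x\<in>set_mset ?box. set (snd x))" by auto
      then show "fset (snd (uac (?U2 v))) = snd (next_cfg acts dest D v)"
        unfolding ac next_cfg_def using relM(4)[OF v(1)] by (simp add: Abs_fset_inverse)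
      show "snd (next_cfg acts dest D v) \<subseteq> (\<lambda>v. tok_of (card (verts S)) (rk v)) ` verts S"
      proof -
        have "set (snd x) \<subseteq> tok ` M" if xb: "x \<in># ?box" for x
        proof -
          have "finite {x \<in> D. dest x = v}" unfolding D_def using r.finite_issued acc by (auto intro: finite_subset)
          then obtain u i where "(u, i) \<in> D" "x = snd (snd (acts u) ! i)"
            using xb unfolding boxes_def by auto
          moreover have "D \<subseteq> A" unfolding D_def using convA(1) acc by blast
          ultimately have "(u, i) \<in> A" "x = snd (snd (acts u) ! i)" by auto
          then show ?thesis using send[of u i] relM(5)[of u] by (auto simp: may_send_def)
        qed
        then show ?thesis unfolding next_cfg_def using relM(5)[OF v(1)] by (auto simp: tok_def N_def M_def)
      qed
    qed
    then show "rel_pmf (\<lambda>U' (e, cfg'). related S H inp rk (fold (ustep G L B m) round_tail (ustep G L B m round_head U')) cfg')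
        (return_pmf U') (case x of (acts, rand) \<Rightarrow>
          bind_pmf (ac_adv M H rk es acts (slots acts) (dests acts rand)) (\<lambda>D.
            return_pmf ((acts, dests acts rand, D), next_cfg acts (dests acts rand) D)))"
      unfolding x prod.case A_def[symmetric] dest_def[symmetric] adv by (simp add: bind_return_pmf rel_pmf_return_pmf1)
  qed
qed

end

section \<open>The whole run\<close>

lemma fst_instr [simp]: "fst (stage_instr k x) = return_pmf" "fst (local_instr f) = return_pmf"
  by (simp_all add: stage_instr_def local_instr_def case_prod_unfold)

section \<open>Positions in the program and simulated times\<close>

context simulation
begin

abbreviation "S0 \<equiv> length init_prog"
abbreviation "S1 \<equiv> Suc (length round_tail)"

lemma init_return: "j < S0 \<Longrightarrow> prog j = init_prog ! j \<and> fst (init_prog ! j) = return_pmf"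
proof -
  assume j: "j < S0"
  have "\<forall>x\<in>set init_prog. fst x = return_pmf"
    unfolding init_prog_def group_prog_def by auto
  then show ?thesis using j nth_mem unfolding prog_def by auto
qed

lemma tail_return:
  assumes "j < length round_tail"
  shows "prog (Suc (S0 + k * S1) + j) = round_tail ! j \<and> fst (round_tail ! j) = return_pmf"
proof -
  have "\<forall>x\<in>set round_tail. fst x = return_pmf"
    unfolding round_tail_def group_prog_def by auto
  moreover have "prog (Suc (S0 + k * S1) + j) = round_tail ! j"
  proof -
    have "Suc (S0 + k * S1) + j - S0 = Suc j + k * S1" by simp
    moreover have "(Suc j + k * S1) mod S1 = Suc j" using assms by (metis Suc_less_eq mod_less mod_mult_self1)
    ultimately show ?thesis unfolding prog_def by (simp only: list.size nth_Cons_Suc) simp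
  qed
  ultimately show ?thesis using assms nth_mem by auto
qed

lemma prog_head: "prog (S0 + k * S1) = round_head"
proof -
  have "S0 + k * S1 - S0 = k * S1" "\<not> S0 + k * S1 < S0" "k * S1 mod S1 = 0"
    by simp_all (rule mod_mult_self2_is_0[of k S1, unfolded mult_Suc_right])
  then show ?thesis unfolding prog_def by (simp only: if_False list.size add_Suc_right add_0_right nth_Cons_0)
qed

definition dec :: "bits \<Rightarrow> ac_state" where
  "dec mem = (case fetch mem :: ust node of (_, _, u, _, _) \<Rightarrow> (fst (uac u), fset (snd (uac u))))"

definition time :: "nat \<Rightarrow> nat" where
  "time i = (S0 + i * S1) * L"

section \<open>Linking the Hybrid run with the simulated run\<close>

context
  assumes n2: "2 \<le> n" and mL: "m \<le> L"
begin

interpretation sr: super_rounds n m B L ini "\<lambda>i. fst (prog i)" "\<lambda>i. fst (snd (prog i))" "\<lambda>i. snd (snd (prog i))" "\<lambda>u j. uwr u ! j"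
proof
  have "0 < m" by simp
  then show "0 < L" using mL by linarith
qed (use n2 mL in auto)

definition the_sim :: hyb_alg where "the_sim = sr.sim"

lemma the_sim_message_bound: "4 * real B \<le> real k * log 2 (real n) \<Longrightarrow> hyb_message_bound k n the_sim"
  unfolding the_sim_def by (rule sr.sim_message_bound)

context
  fixes G S :: wgraph and H :: "nat \<Rightarrow> nat set" and inp :: "nat \<Rightarrow> bits" and adv :: "hyb_act adversary"
    and Q q1 :: nat
  assumes G: "network n G" and adv: "adversary (global_capacity n) adv"
    and W: "W \<le> 2 ^ q" and B1: "(n + 1) * W \<le> 2 ^ B"
    and B2: "2 * (n * c) + W \<le> 2 ^ B" and B3: "(n * c + 1) * P \<le> 2 ^ B"
    and M: "verts S \<subseteq> {1..n}" "verts S \<noteq> {}"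
    and H: "\<And>v. v \<in> verts S \<Longrightarrow> H v \<subseteq> {1..n} \<and> H v \<noteq> {}"
    and hb: "\<And>w v. w \<in> verts S \<Longrightarrow> v \<in> H w \<Longrightarrow> w \<in> ball_of G L v \<and> v \<in> ball_of G L w"
    and nb: "\<And>v u. v \<in> verts S \<Longrightarrow> u \<in> nbrs S v \<Longrightarrow> u \<in> verts S \<and> u \<in> ball_of G L v"
    and Q: "\<And>v. v \<in> {1..n} \<Longrightarrow> card {w \<in> verts S. v \<in> H w} \<le> Q"
    and q1: "\<And>w. w \<in> verts S \<Longrightarrow> c div card (H w) + 1 \<le> q1" and m: "2 * (Q * q1) \<le> m"
    and P: "c \<le> P" "\<And>mem act tgt msg. act \<in> set_pmf (a_act (ALG (card (verts S))) mem) \<Longrightarrow> (tgt, msg) \<in> set (snd act) \<Longrightarrow>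
        [] \<notin> set (snd msg) \<Longrightarrow> msg_code msg < P"
begin

definition rnk :: "nat \<Rightarrow> nat" where "rnk v = card {w \<in> verts S. w < v}"

abbreviation "N \<equiv> card (verts S)"
abbreviation "step \<equiv> hyb_step G the_sim adv"
abbreviation "bdry \<equiv> sr.boundary G"

lemma bij_rnk: "bij_betw rnk (verts S) {..<N}"
proof -
  have "finite (verts S)" using M(1) finite_subset by blast
  from position_in_bij[OF this, of id] show ?thesis
    unfolding position_in_def rnk_def[abs_def] by simp
qed

lemma super_post_ustep: "sr.super_post G i U = ustep G L B m (prog i) U"
  by (rule ext) (simp add: sr.super_post_def[OF G adv] ustep_def known_ball_def sr.partner_def case_prod_unfold)

text \<open>These instructions draw nothing, so the statement holds for every outcome and no
  coupling is involved.\<close>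

lemma run_segment:
  assumes "bdry i U (last cs)" "\<And>j. j < length xs \<Longrightarrow> prog (i + j) = xs ! j \<and> fst (xs ! j) = return_pmf"
  shows "\<forall>(cs', es') \<in> set_pmf (extend_n step (length xs * L) (cs, es)). \<exists>ds. cs' = cs @ ds \<and>
    length ds = length xs * L \<and> bdry (i + length xs) (fold (ustep G L B m) xs U) (last cs')"
  using assms
proof (induction xs arbitrary: i U cs es)
  case Nil
  then show ?case by simp
next
  case (Cons x xs)
  have x: "prog i = x" "fst x = return_pmf" using Cons.prems(2)[of 0] by auto
  have first: "\<forall>(cs', es') \<in> set_pmf (extend_n step L (cs, es)). \<exists>ds. cs' = cs @ ds \<and> length ds = L \<and>
      bdry (Suc i) (ustep G L B m x U) (last cs')"
    using sr.super_round_return[OF G adv Cons.prems(1), of es] x unfolding super_post_ustep the_sim_def by simp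
  have split: "length (x # xs) * L = L + length xs * L" by simp
  show ?case
    unfolding split extend_n_add
  proof (clarsimp)
    fix cs1 es1 cs2 es2
    assume 1: "(cs1, es1) \<in> set_pmf (extend_n step L (cs, es))"
      and 2: "(cs2, es2) \<in> set_pmf (extend_n step (length xs * L) (cs1, es1))"
    obtain ds where ds: "cs1 = cs @ ds" "length ds = L" "bdry (Suc i) (ustep G L B m x U) (last cs1)"
      using first 1 by auto
    have "prog (Suc i + j) = xs ! j \<and> fst (xs ! j) = return_pmf" if "j < length xs" for j
      using Cons.prems(2)[of "Suc j"] that by simp
    from Cons.IH[OF ds(3) this, of es1] 2 obtain ds' where
      "cs2 = cs1 @ ds'" "length ds' = length xs * L" "bdry (Suc i + length xs) (fold (ustep G L B m) xs (ustep G L B m x U)) (last cs2)"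
      by auto
    then show "\<exists>ds. cs2 = cs @ ds \<and> length ds = L + length xs * L \<and>
        bdry (Suc (i + length xs)) (fold (ustep G L B m) xs (ustep G L B m x U)) (last cs2)"
      using ds by (intro exI[of _ "ds @ ds'"]) simp
  qed
qed

abbreviation "rel \<equiv> related S H inp rnk"
abbreviation "astep \<equiv> ac_step S (\<lambda>v. tok_of N (rnk v)) (ALG N) (ac_adv (verts S) H rnk)"
abbreviation "astart \<equiv> ac_start S (\<lambda>v. Suc (rnk v)) (\<lambda>v. tok_of N (rnk v)) (nbrs S) inp (ALG N)"

text \<open>Besides the decoded states of the past, the link carries a boundary state related to the
  current configuration, from which the next round is continued.\<close>

definition linked :: "nat \<Rightarrow> (nat \<Rightarrow> bits) list \<times> hyb_act event list \<Rightarrow> (nat \<Rightarrow> ac_state) list \<times> ac_act event list \<Rightarrow> bool" where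
  "linked k x y \<longleftrightarrow> length (fst x) = Suc (time k) \<and> length (fst y) = Suc k \<and>
    (\<forall>i\<le>k. \<forall>v\<in>verts S. dec ((fst x ! time i) v) = (fst y ! i) v) \<and>
    (\<exists>U. bdry (S0 + k * S1) U (last (fst x)) \<and> rel U (last (fst y)))"

lemma dec_boundary:
  assumes "bdry i U cfg" "rel U acfg" "v \<in> verts S"
  shows "dec (cfg v) = acfg v"
proof -
  have "v \<in> verts G" using assms(3) M(1) sr.verts_G[OF G adv] by blast
  then have "cfg v = store (v, i * L, U v, {||} :: ust fset, [] :: item list)"
    using assms(1) sr.boundary_def[OF G adv] by blast
  moreover have "fst (uac (U v)) = fst (acfg v)" "fset (snd (uac (U v))) = snd (acfg v)"
    using assms(2,3) unfolding related_def by auto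
  ultimately show ?thesis unfolding dec_def by simp
qed

lemma linked_start: "rel_pmf (linked 0) (run step (hyb_start G S H inp the_sim) (time 0)) (run astep astart 0)"
proof -
  let ?c0 = "hyb_start G S H inp the_sim"
  define U0 where "U0 v = ini \<lparr>hi_id = v, hi_incident = incident G v,
    hi_skeleton = (if v \<in> verts S then Some (incident S v, H v, inp v) else None)\<rparr>" for v
  define U where "U = fold (ustep G L B m) init_prog U0"
  have b0: "bdry 0 U0 (last [?c0])"
    using sr.boundary_start[OF G adv, of S H inp] unfolding U0_def[abs_def] the_sim_def by simp
  have r: "run step ?c0 (time 0) = extend_n step (S0 * L) ([?c0], [])"
    using run_add[of step ?c0 0 "S0 * L"] by (simp add: time_def bind_return_pmf)
  have rel: "rel U astart"
    unfolding related_def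
  proof (intro conjI ballI)
    fix v assume v: "v \<in> {1..n}"
    have n1: "1 \<le> n" using n2 by simp
    note I = init_result[OF G n1 W B1 M(1) refl nb U0_def v]
    show "uid (U v) = v" "usk (U v) =
        (if v \<in> verts S then Some (listing (incident S v), sorted_list_of_set (H v), inp v) else None)"
      unfolding U_def by (rule I; assumption)+
  next
    fix v assume vM: "v \<in> verts S"
    then have v: "v \<in> {1..n}" using M(1) by blast
    have n1: "1 \<le> n" using n2 by simp
    have I: "urk (U v) = rnk v \<and> unn (U v) = N \<and> fst (uac (U v)) = fst (astart v) \<and> fset (snd (uac (U v))) = snd (astart v)"
      unfolding U_def rnk_def[abs_def]
      by (rule init_result(3)[OF G n1 W B1 M(1) refl nb U0_def v vM])
    then show "urk (U v) = rnk v" "unn (U v) = N" "fst (uac (U v)) = fst (astart v)" "fset (snd (uac (U v))) = snd (astart v)"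
      by auto
    show "snd (astart v) \<subseteq> (\<lambda>v. tok_of N (rnk v)) ` verts S"
      using nb[OF vM] vM by (auto simp: ac_start_def)
  qed
  have seg: "\<forall>(cs', es') \<in> set_pmf (extend_n step (S0 * L) ([?c0], [])). \<exists>ds. cs' = [?c0] @ ds \<and>
    length ds = S0 * L \<and> bdry (0 + S0) U (last cs')"
    unfolding U_def by (rule run_segment[OF b0]) (use init_return in simp)
  have "linked 0 x ([astart], [])" if x: "x \<in> set_pmf (extend_n step (S0 * L) ([?c0], []))" for x
  proof -
    obtain ds where ds: "fst x = [?c0] @ ds" "length ds = S0 * L" "bdry (0 + S0) U (last (fst x))"
      using bspec[OF seg x] by (auto simp: case_prod_unfold)
    then have len: "length (fst x) = Suc (time 0)" by (simp add: time_def)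
    then have "fst x ! time 0 = last (fst x)" by (subst last_conv_nth) auto
    then have "dec ((fst x ! time 0) v) = astart v" if "v \<in> verts S" for v
      using dec_boundary[OF ds(3) rel that] by simp
    then show ?thesis unfolding linked_def using len ds(3) rel by auto
  qed
  then show ?thesis unfolding r by (simp add: rel_pmf_return_pmf2)
qed

text \<open>The head of the round is coupled with the step of the model and the tail is
  deterministic. Histories are only appended to, so what was decoded at earlier times stays
  valid.\<close>

lemma linked_step:
  assumes "linked k x y"
  shows "rel_pmf (linked (Suc k)) (extend_n step (S1 * L) x) (extend astep y)"
proof -
  obtain cs es as aes where xy: "x = (cs, es)" "y = (as, aes)" by (cases x; cases y)
  obtain U where U: "bdry (S0 + k * S1) U (last cs)" "rel U (last as)"
    and len: "length cs = Suc (time k)" "length as = Suc k"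
    and old: "\<And>i v. i \<le> k \<Longrightarrow> v \<in> verts S \<Longrightarrow> dec ((cs ! time i) v) = (as ! i) v"
    using assms unfolding linked_def xy by auto
  have A: "rel_pmf (\<lambda>(cs', es') U'. \<exists>ds. cs' = cs @ ds \<and> length ds = L \<and>
      bdry (Suc (S0 + k * S1)) (ustep G L B m round_head U') (last cs'))
    (extend_n step L (cs, es)) (Pi_pmf {1..n} undefined (\<lambda>v. sample (U v)))"
  proof -
    have "fst (prog (S0 + k * S1)) = sample" unfolding prog_head round_head_def by simp
    then show ?thesis
      using sr.super_round[OF G adv U(1), of es] unfolding super_post_ustep prog_head the_sim_def
        sr.verts_G[OF G adv] by simp
  qed
  have Bc: "rel_pmf (\<lambda>U' (e, cfg'). rel (fold (ustep G L B m) round_tail (ustep G L B m round_head U')) cfg')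
    (Pi_pmf {1..n} undefined (\<lambda>v. sample (U v))) (astep aes (last as))"
    by (rule round_couple[OF G W B1 B2 B3 M bij_rnk H hb Q q1 m P U(2)]) assumption+
  define mid where "mid = (\<lambda>(cs', es' :: hyb_act event list) (e :: ac_act event, cfg'). \<exists>ds U'. cs' = cs @ ds \<and> length ds = L \<and>
      bdry (Suc (S0 + k * S1)) U' (last cs') \<and> rel (fold (ustep G L B m) round_tail U') cfg')"
  have AB: "rel_pmf mid (extend_n step L (cs, es)) (astep aes (last as))"
    by (rule rel_pmf_trans[OF A Bc]) (auto simp: mid_def)
  have split: "S1 * L = L + length round_tail * L" by simp
  have ext: "extend astep y = bind_pmf (astep aes (last as)) (\<lambda>(e, c). return_pmf (as @ [c], aes @ [e]))"
    unfolding xy extend_def by (simp add: map_pmf_def case_prod_unfold)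
  show ?thesis
    unfolding split extend_n_add ext xy(1)
  proof (rule rel_pmf_bindI[OF AB])
    fix z w assume zw: "mid z w"
    obtain cs1 es1 e cfg' where z: "z = (cs1, es1)" "w = (e, cfg')" by (cases z; cases w)
    obtain ds U' where ds: "cs1 = cs @ ds" "length ds = L" "bdry (Suc (S0 + k * S1)) U' (last cs1)"
      "rel (fold (ustep G L B m) round_tail U') cfg'"
      using zw unfolding mid_def z by auto
    have seg: "\<forall>(cs', es') \<in> set_pmf (extend_n step (length round_tail * L) (cs1, es1)). \<exists>ds'. cs' = cs1 @ ds' \<and>
      length ds' = length round_tail * L \<and>
      bdry (Suc (S0 + k * S1) + length round_tail) (fold (ustep G L B m) round_tail U') (last cs')"
      by (rule run_segment[OF ds(3)]) (rule tail_return)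
    have "linked (Suc k) (cs2, es2) (as @ [cfg'], aes @ [e])"
      if in2: "(cs2, es2) \<in> set_pmf (extend_n step (length round_tail * L) (cs1, es1))" for cs2 es2
    proof -
      obtain ds' where d: "cs2 = cs @ ds @ ds'" "length ds' = length round_tail * L"
        and b: "bdry (S0 + Suc k * S1) (fold (ustep G L B m) round_tail U') (last cs2)"
      proof -
        have e: "Suc (S0 + k * S1) + length round_tail = S0 + Suc k * S1" by simp
        obtain ds' where "cs2 = cs1 @ ds'" "length ds' = length round_tail * L"
          "bdry (S0 + Suc k * S1) (fold (ustep G L B m) round_tail U') (last cs2)"
          using bspec[OF seg in2] unfolding e prod.case by blast
        then show thesis using that ds(1) by simp
      qed
      have l2: "length cs2 = Suc (time (Suc k))"
        using d len ds(2) by (simp add: time_def algebra_simps)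
      have "dec ((cs2 ! time i) v) = ((as @ [cfg']) ! i) v" if iv: "i \<le> Suc k" "v \<in> verts S" for i v
      proof (cases "i = Suc k")
        case True
        have "cs2 ! time i = last cs2" using l2 True by (subst last_conv_nth) auto
        then show ?thesis using dec_boundary[OF b ds(4) iv(2)] True len by (simp add: nth_append)
      next
        case False
        then have ik: "i \<le> k" using iv by simp
        have "time i \<le> time k" unfolding time_def using ik by (intro mult_le_mono1 add_le_mono) auto
        then have "cs2 ! time i = cs ! time i" using len d by (simp add: nth_append)
        then show ?thesis using old[OF ik iv(2)] ik len by (simp add: nth_append)
      qed
      then show ?thesis unfolding linked_def using l2 len b ds(4) by auto
    qed
    then show "rel_pmf (linked (Suc k)) (extend_n step (length round_tail * L) z)
        (case w of (e, c) \<Rightarrow> return_pmf (as @ [c], aes @ [e]))"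
      unfolding z by (auto simp: rel_pmf_return_pmf2)
  qed
qed

lemma linked_run: "rel_pmf (linked k) (run step (hyb_start G S H inp the_sim) (time k)) (run astep astart k)"
proof (induction k)
  case 0
  show ?case by (rule linked_start)
next
  case (Suc k)
  have t: "time (Suc k) = time k + S1 * L" by (simp add: time_def algebra_simps)
  have r: "run astep astart (Suc k) = bind_pmf (run astep astart k) (extend astep)"
    by (simp add: extend_def case_prod_unfold)
  show ?case
    unfolding t run_add r by (rule rel_pmf_bindI[OF Suc]) (rule linked_step)
qed

lemma simulates:
  assumes "p \<le> 1"
  shows "simulates_on p 2 c t (ALG N) (time t) the_sim dec time G S H inp adv"
  unfolding simulates_on_def
proof (intro exI conjI)
  show "identifiers (verts S) (\<lambda>v. Suc (rnk v))"
  proof -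
    have "bij_betw Suc {..<N} {1..N}"
      by (metis bij_betw_def image_Suc_lessThan inj_Suc)
    then show ?thesis
      unfolding identifiers_def using bij_betw_trans[OF bij_rnk, of Suc "{1..N}"] by (simp add: o_def)
  qed
  show "tokens 2 (verts S) (\<lambda>v. tok_of N (rnk v))"
  proof -
    have "inj_on (\<lambda>v. tok_of N (rnk v)) (verts S)"
      using bij_rnk inj_tok_of[of N] unfolding bij_betw_def inj_on_def by blast
    moreover have "rnk v < N" if "v \<in> verts S" for v
      using bij_rnk that by (auto simp: bij_betw_def)
    ultimately show ?thesis unfolding tokens_def using length_tok_of by simp
  qed
  show "adversary c (ac_adv (verts S) H rnk)" by (rule adversary_ac_adv)
  show "coupled p (configs step (hyb_start G S H inp the_sim) (time t)) (configs astep astart t)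
     (\<lambda>hs as. \<forall>i\<le>t. \<forall>v\<in>verts S. dec ((hs ! time i) v) = (as ! i) v)"
  proof (rule coupled_if_rel_pmf[OF _ assms])
    show "rel_pmf (\<lambda>hs as. \<forall>i\<le>t. \<forall>v\<in>verts S. dec ((hs ! time i) v) = (as ! i) v)
      (configs step (hyb_start G S H inp the_sim) (time t)) (configs astep astart t)"
      unfolding configs_def pmf.rel_map
      by (rule pmf.rel_mono_strong[OF linked_run]) (auto simp: linked_def)
  qed
qed

end

end

end

section \<open>Parameters\<close>

lemma ex_power_2:
  fixes y :: nat
  assumes "1 \<le> y"
  shows "\<exists>b. y \<le> 2 ^ b \<and> 2 ^ b \<le> 2 * y"
proof -
  define b where "b = (LEAST b. y \<le> 2 ^ b)"
  have "y \<le> 2 ^ y" by (simp add: less_imp_le)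
  then have b: "y \<le> 2 ^ b" unfolding b_def by (rule LeastI)
  have "2 ^ b \<le> 2 * y"
  proof (cases b)
    case (Suc b')
    have "\<not> y \<le> 2 ^ b'" using not_less_Least[of b' "\<lambda>b. y \<le> 2 ^ b"] Suc unfolding b_def[symmetric] by simp
    then show ?thesis using Suc by simp
  qed (use assms in simp)
  then show ?thesis using b by blast
qed

text \<open>Taking logarithms, \<open>b\<close> is at most \<open>1 + E * (log K + log n)\<close>.
  Here \<open>log K\<close> is at most \<open>K\<close>, hence at most \<open>K * log n\<close>,
  because \<open>log n\<close> is at least 1.\<close>

lemma log_power_bound:
  fixes n K E b :: nat
  assumes n: "2 \<le> n" and K: "1 \<le> K" and b: "2 ^ b \<le> 2 * (K * n) ^ E"
  shows "real b \<le> real (E * (K + 1) + 1) * log 2 (real n)"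
proof -
  have lg: "1 \<le> log 2 (real n)" using n by (simp add: le_log_iff)
  have "real (2 ^ b) \<le> real (2 * (K * n) ^ E)" using b by (simp only: of_nat_le_iff)
  then have "(2::real) ^ b \<le> 2 * (real K * real n) ^ E" by simp
  then have "log 2 (2 ^ b) \<le> log 2 (2 * (real K * real n) ^ E)"
    using n K by (subst log_le_cancel_iff) auto
  also have "log 2 (2 * (real K * real n) ^ E) = 1 + real E * (log 2 (real K) + log 2 (real n))"
    using n K by (simp add: log_mult log_nat_power)
  also have "log 2 (2 ^ b) = real b" by (simp add: log_nat_power)
  finally have 1: "real b \<le> 1 + real E * (log 2 (real K) + log 2 (real n))" .
  have "real K \<le> real (2 ^ K)" unfolding of_nat_le_iff by (simp add: less_imp_le)
  then have "log 2 (real K) \<le> real K" using K by (simp add: log_le_iff powr_realpow)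
  also have "\<dots> \<le> real K * log 2 (real n)" using lg by (simp add: mult_le_cancel_left1)
  finally have "log 2 (real K) + log 2 (real n) \<le> real (K + 1) * log 2 (real n)" by (simp add: algebra_simps)
  then have "real E * (log 2 (real K) + log 2 (real n)) \<le> real E * (real (K + 1) * log 2 (real n))"
    by (intro mult_left_mono) auto
  then have "real b \<le> log 2 (real n) + real E * (real (K + 1) * log 2 (real n))" using 1 lg by linarith
  then show ?thesis by (simp add: algebra_simps)
qed

section \<open>Length of the program and of the run\<close>

context simulation
begin

lemma length_group_prog: "length group_prog \<le> 2 * q ^ 2 + q + 2"
  unfolding group_prog_def using length_op_stages by simp

lemma length_init_prog: "length init_prog \<le> 2 * q ^ 2 + q + 5"
  using length_group_prog by (simp add: init_prog_def)

lemma length_round_tail: "length round_tail \<le> 4 * q ^ 2 + 2 * q + 7"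
  using length_group_prog length_op_stages[of q "\<lambda>p a. a"] by (simp add: round_tail_def)

text \<open>An operation has two sorts of at most \<open>q ^ 2\<close> stages each, \<open>q\<close>
  scan steps and 2 local stages. Initialization takes one operation and 3 local instructions, a
  round takes two operations and 4 other instructions including the head. As \<open>t\<close> is at
  least 1, the former is charged once per round.\<close>

lemma time_upper:
  assumes "1 \<le> t"
  shows "time t \<le> t * (6 * q ^ 2 + 3 * q + 13) * L"
proof -
  have "length init_prog \<le> t * (2 * q ^ 2 + q + 5)"
    using length_init_prog assms by (metis le_trans mult_le_mono1 nat_mult_1)
  moreover have "t * Suc (length round_tail) \<le> t * (4 * q ^ 2 + 2 * q + 8)"
    using length_round_tail by (intro mult_le_mono2) simp
  ultimately have "length init_prog + t * Suc (length round_tail) \<le> t * (6 * q ^ 2 + 3 * q + 13)"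
    by (simp add: algebra_simps)
  then show ?thesis unfolding time_def by (rule mult_le_mono1)
qed

lemma time_lower: "t * L \<le> time t"
  unfolding time_def by (intro mult_le_mono1) simp

lemma mono_time: "mono_on {..t} time"
  unfolding time_def by (intro mono_onI mult_le_mono1 add_le_mono) auto

end

text \<open>The number of wires is at most \<open>(K * n) ^ (2 * K + 9)\<close>, and
  \<open>log_power_bound\<close> turns this exponent into a bound on the sorting depth.\<close>

definition depth_const :: "nat \<Rightarrow> nat" where
  "depth_const K = (2 * K + 9) * (K + 1) + 1"

text \<open>The corresponding exponent for the numbers inside items; \<open>4 * k\<close> stems from
  the message codes.\<close>

definition size_exp :: "nat \<Rightarrow> nat \<Rightarrow> nat" where
  "size_exp K k = 2 * K + 13 + 4 * k"

text \<open>All quantities are measured in powers of \<open>z\<close>. As \<open>z\<close> is at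
  least 2, the factors 4 and 8 are absorbed as \<open>z ^ 2\<close> and
  \<open>z ^ 3\<close>.\<close>

lemma parameter_bounds:
  fixes n K k c Q q1 m W P :: nat
  defines "z \<equiv> K * n"
  assumes n: "2 \<le> n" and K: "1 \<le> K"
    and Q: "Q \<le> K * n ^ K" and q1: "q1 \<le> 2 * (K * n ^ K) * n + 1" and m: "m \<le> 4 * (Q * q1)"
    and c: "c \<le> K * n ^ K * n ^ 2" and P: "P \<le> c + n ^ (4 * k)" and W: "W = n * m"
  shows "W \<le> z ^ (2 * K + 9)"
    and "(n + 1) * W + (2 * (n * c) + W) + (n * c + 1) * P + 1 \<le> z ^ size_exp K k"
proof -
  have z: "2 \<le> z" "K \<le> z" "n \<le> z" unfolding z_def using n K mult_le_mono[of 1 K 2 n] by auto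
  have mul: "u * v \<le> z ^ (i + j)" if "u \<le> z ^ i" "v \<le> z ^ j" for u v i j
    unfolding power_add using that by (rule mult_le_mono)
  have up: "z ^ i \<le> z ^ j" if "i \<le> j" for i j using that z(1) by (intro power_increasing) auto
  have one: "1 \<le> z ^ i" for i using z(1) by simp
  have four: "4 \<le> z ^ 2" using power_mono[OF z(1), of 2] by simp
  have eight: "8 \<le> z ^ 3" using power_mono[OF z(1), of 3] by simp
  have n1: "n \<le> z ^ 1" and two: "2 \<le> z ^ 1" using z by auto
  have kap: "K * n ^ K \<le> z ^ (1 + K)"
    by (rule mul) (use z in \<open>auto intro: power_mono\<close>)
  have "1 \<le> K * n ^ K * n" using K n by simp
  then have "q1 \<le> 4 * (K * n ^ K * n)" using q1 by linarith
  also have "\<dots> \<le> z ^ (2 + (1 + K + 1))" by (rule mul[OF four mul[OF kap n1]])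
  finally have q1z: "q1 \<le> z ^ (2 + (1 + K + 1))" .
  have "Q * q1 \<le> z ^ (1 + K + (2 + (1 + K + 1)))" by (rule mul[OF order_trans[OF Q kap] q1z])
  then have "4 * (Q * q1) \<le> z ^ (2 + (1 + K + (2 + (1 + K + 1))))" by (rule mul[OF four])
  then have "m \<le> z ^ (2 + (1 + K + (2 + (1 + K + 1))))" using m by linarith
  then have Wz: "W \<le> z ^ (1 + (2 + (1 + K + (2 + (1 + K + 1)))))" unfolding W by (intro mul n1)
  then show "W \<le> z ^ (2 * K + 9)" using up[of "1 + (2 + (1 + K + (2 + (1 + K + 1))))" "2 * K + 9"] by linarith
  have "n ^ 2 \<le> z ^ 2" using z by (intro power_mono) auto
  then have cz: "c \<le> z ^ (1 + K + 2)" using mul[OF kap] c by (meson order_trans)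
  have "n ^ (4 * k) \<le> z ^ (4 * k)" using z by (intro power_mono) auto
  then have "P \<le> z ^ (1 + K + 2) + z ^ (4 * k)" using P cz by linarith
  also have "\<dots> \<le> 2 * z ^ (K + 3 + 4 * k)"
    using up[of "1 + K + 2" "K + 3 + 4 * k"] up[of "4 * k" "K + 3 + 4 * k"] by linarith
  also have "\<dots> \<le> z ^ (1 + (K + 3 + 4 * k))" by (intro mul two) simp
  finally have Pz: "P \<le> z ^ (1 + (K + 3 + 4 * k))" .
  have nc: "n * c \<le> z ^ (1 + (1 + K + 2))" by (intro mul n1 cz)
  have "n * c + 1 \<le> 2 * z ^ (1 + (1 + K + 2))" using nc one[of "1 + (1 + K + 2)"] by linarith
  also have "\<dots> \<le> z ^ (1 + (1 + (1 + K + 2)))" by (intro mul two) simp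
  finally have "(n * c + 1) * P \<le> z ^ (1 + (1 + (1 + K + 2)) + (1 + (K + 3 + 4 * k)))" by (intro mul Pz)
  then have t1: "(n * c + 1) * P \<le> z ^ (2 * K + 10 + 4 * k)"
    using up[of "1 + (1 + (1 + K + 2)) + (1 + (K + 3 + 4 * k))" "2 * K + 10 + 4 * k"] by linarith
  have "2 * z \<le> z ^ 2" unfolding power2_eq_square using z(1) by (rule mult_le_mono1)
  then have "n + 1 \<le> z ^ 2" using z(1,3) by linarith
  then have "(n + 1) * W \<le> z ^ (2 + (1 + (2 + (1 + K + (2 + (1 + K + 1))))))" using Wz by (intro mul)
  then have t2: "(n + 1) * W \<le> z ^ (2 * K + 10 + 4 * k)"
    using up[of "2 + (1 + (2 + (1 + K + (2 + (1 + K + 1)))))" "2 * K + 10 + 4 * k"] by linarith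
  have "2 * (n * c) \<le> z ^ (1 + (1 + (1 + K + 2)))" by (rule mul[OF two nc])
  then have t3: "2 * (n * c) \<le> z ^ (2 * K + 10 + 4 * k)"
    using up[of "1 + (1 + (1 + K + 2))" "2 * K + 10 + 4 * k"] by linarith
  have t4: "W \<le> z ^ (2 * K + 10 + 4 * k)"
    using Wz up[of "1 + (2 + (1 + K + (2 + (1 + K + 1))))" "2 * K + 10 + 4 * k"] by linarith
  have "(n + 1) * W + (2 * (n * c) + W) + (n * c + 1) * P + 1 \<le> 8 * z ^ (2 * K + 10 + 4 * k)"
    using t1 t2 t3 t4 one[of "2 * K + 10 + 4 * k"] by linarith
  also have "\<dots> \<le> z ^ (3 + (2 * K + 10 + 4 * k))" by (intro mul eight) simp
  also have "3 + (2 * K + 10 + 4 * k) = size_exp K k" by (simp add: size_exp_def)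
  finally show "(n + 1) * W + (2 * (n * c) + W) + (n * c + 1) * P + 1 \<le> z ^ size_exp K k" .
qed

lemma simulation_exists:
  fixes x :: real and K k n c t :: nat and ALG :: "nat \<Rightarrow> ac_alg"
  assumes x: "x < 1" "0 < x" and n: "2 \<le> n" and t: "1 \<le> t"
    and c: "tilde_Theta K n (real c) (real n powr (2 - 2 * x))"
    and msg: "\<And>N. ac_message_bound k N (ALG N)"
  shows "\<exists>(SIM::hyb_alg) (dec :: bits \<Rightarrow> ac_state) (T::nat) (r :: nat \<Rightarrow> nat).
          hyb_message_bound (4 * (size_exp K k * (K + 1) + 1)) n SIM \<and>
          tilde_Theta (308 * (depth_const K) ^ 2 * K ^ 2 + 2 * K + 2) n (real T) (real t * real n powr (1 - x)) \<and>
          mono_on {..t} r \<and> r t = T \<and>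
          (\<forall>G S H inp adv.
             network n G \<and> skeleton K x G S H \<and> adversary (global_capacity n) adv \<longrightarrow>
             simulates_on (1 - real n powr (- 2)) 2 c t (ALG (card (verts S))) T SIM dec r
               G S H inp adv)"
proof -
  define lg where "lg = log 2 (real n)"
  define s where "s = real n powr (1 - x)"
  define \<kappa> where "\<kappa> = real K * lg ^ K"
  have lg: "1 \<le> lg" "lg \<le> real n"
  proof -
    show "1 \<le> lg" using n by (simp add: lg_def le_log_iff)
    have "real n \<le> 2 ^ n" by (metis less_exp less_imp_le of_nat_le_iff of_nat_numeral of_nat_power)
    then show "lg \<le> real n" using n by (simp add: lg_def log_le_iff powr_realpow)
  qed
  have s: "1 \<le> s" "s \<le> real n"
  proof -
    show "1 \<le> s" using n x by (simp add: s_def ge_one_powr_ge_zero)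
    have "s \<le> real n powr 1" unfolding s_def using n x by (intro powr_mono) auto
    then show "s \<le> real n" using n by simp
  qed
  have s2: "real n powr (2 - 2 * x) = s ^ 2"
    unfolding s_def using n by (simp add: power2_eq_square powr_add[symmetric])
  have cK: "real c \<le> \<kappa> * s ^ 2" "s ^ 2 \<le> \<kappa> * real c"
    using c unfolding tilde_Theta_def tilde_Omega_def tilde_O_def s2 \<kappa>_def lg_def by auto
  \<comment> \<open>For \<open>K = 0\<close> the lower bound on \<open>c\<close> in
    \<open>tilde_Theta\<close> would give \<open>s ^ 2 \<le> 0\<close>.\<close>
  have K: "1 \<le> K"
  proof (rule ccontr)
    assume "\<not> 1 \<le> K"
    then have "\<kappa> = 0" by (simp add: \<kappa>_def)
    then show False using cK(2) s(1) by simp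
  qed
  have lgK: "1 \<le> lg ^ K" "lg ^ K \<le> real n ^ K"
    using lg by (auto intro: power_mono)
  have \<kappa>: "1 \<le> \<kappa>" "\<kappa> \<le> real (K * n ^ K)"
    unfolding \<kappa>_def using lgK K mult_mono[of 1 "real K" 1 "lg ^ K"] by (auto intro: mult_left_mono)
  \<comment> \<open>\<open>Q\<close> bounds how many skeleton nodes share a helper. A helper set has
    at least \<open>s / 2\<close> nodes and \<open>c\<close> is at most
    \<open>\<kappa> * s ^ 2\<close>, so \<open>q1\<close> bounds the indices that one skeleton node
    deals to one helper.\<close>
  define Q where "Q = nat \<lfloor>\<kappa>\<rfloor>"
  define q1 where "q1 = nat \<lfloor>2 * \<kappa> * s\<rfloor> + 1"
  have Qr: "real Q \<le> \<kappa>" "1 \<le> Q" unfolding Q_def using \<kappa>(1) by (auto simp: le_nat_floor)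
  have q1r: "real q1 \<le> 2 * \<kappa> * s + 1" "1 \<le> q1" unfolding q1_def using \<kappa>(1) s(1) by auto
  have Qn: "Q \<le> K * n ^ K" using Qr(1) \<kappa>(2) by linarith
  have q1n: "q1 \<le> 2 * (K * n ^ K) * n + 1"
  proof -
    have "\<kappa> * s \<le> real (K * n ^ K) * real n" using \<kappa> s by (intro mult_mono) auto
    then have "real q1 \<le> 2 * (real (K * n ^ K) * real n) + 1" using q1r(1) by linarith
    also have "\<dots> = real (2 * (K * n ^ K) * n + 1)" by simp
    finally show ?thesis by linarith
  qed
  obtain a where a: "2 * (Q * q1) \<le> 2 ^ a" "2 ^ a \<le> 2 * (2 * (Q * q1))"
    using ex_power_2[of "2 * (Q * q1)"] Qr(2) q1r(2) by auto
  define m where "m = (2::nat) ^ a"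
  define W where "W = n * m"
  \<comment> \<open>\<open>P\<close> covers both kinds of payloads: indices below \<open>c\<close>
    and message codes. The power of 4 is at most \<open>n ^ (4 * k)\<close>.\<close>
  define P where "P = c + 4 ^ (2 * nat \<lfloor>real k * lg\<rfloor>)"
  have ks: "1 \<le> \<kappa> * s" using mult_mono[of 1 \<kappa> 1 s] \<kappa>(1) s(1) by simp
  have kk: "\<kappa> * s \<le> \<kappa> ^ 2 * s"
    unfolding power2_eq_square using \<kappa>(1) s(1) mult_right_mono[of 1 \<kappa> "\<kappa> * s"] by (simp add: algebra_simps)
  have mr: "real m \<le> 12 * \<kappa> ^ 2 * s"
  proof -
    have "m \<le> 4 * (Q * q1)" using a(2) unfolding m_def by simp
    then have "real m \<le> real (4 * (Q * q1))" by (simp only: of_nat_le_iff)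
    then have "real m \<le> 4 * (real Q * real q1)" by simp
    also have "real Q * real q1 \<le> \<kappa> * (3 * \<kappa> * s)"
      using Qr(1) q1r(1) ks \<kappa>(1) by (intro mult_mono) auto
    finally show ?thesis by (simp add: power2_eq_square algebra_simps)
  qed
  \<comment> \<open>Long enough to exchange \<open>m\<close> items and to flood over
    \<open>\<kappa> * s\<close> hops, which reaches helpers and neighbours in the skeleton. The
    second summand also gives \<open>s \<le> L\<close>, hence the lower bound on the time.\<close>
  define L where "L = m + nat \<lceil>\<kappa> * s\<rceil>"
  have L: "m \<le> L" "\<kappa> * s \<le> real L" "real L \<le> 14 * \<kappa> ^ 2 * s"
  proof -
    show "m \<le> L" by (simp add: L_def)
    show "\<kappa> * s \<le> real L" unfolding L_def using ks by linarith
    have "real L \<le> real m + (\<kappa> * s + 1)" unfolding L_def using ks by linarith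
    then show "real L \<le> 14 * \<kappa> ^ 2 * s" using mr kk ks by linarith
  qed
  have cn: "c \<le> K * n ^ K * n ^ 2"
  proof -
    have "real c \<le> real (K * n ^ K) * real n ^ 2"
      using cK(1) \<kappa> s by (elim order_trans) (intro mult_mono power_mono, auto)
    also have "\<dots> = real (K * n ^ K * n ^ 2)" by simp
    finally show ?thesis by linarith
  qed
  have Pn: "P \<le> c + n ^ (4 * k)"
  proof -
    have "real (4 ^ (2 * nat \<lfloor>real k * lg\<rfloor>)) = 2 powr (4 * real (nat \<lfloor>real k * lg\<rfloor>))"
    proof -
      have "(4::real) ^ (2 * j) = 2 powr (4 * real j)" for j
      proof -
        have "(4::real) ^ (2 * j) = 2 ^ (4 * j)" by (simp add: power_mult)
        also have "\<dots> = 2 powr real (4 * j)" by (rule powr_realpow[symmetric]) simp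
        finally show ?thesis by simp
      qed
      then show ?thesis by simp
    qed
    also have "\<dots> \<le> 2 powr (4 * (real k * lg))" using lg by (intro powr_mono) auto
    also have "\<dots> = (2 powr lg) powr (4 * real k)" by (simp add: powr_powr ac_simps)
    also have "\<dots> = real n powr real (4 * k)" using n by (simp add: lg_def)
    also have "\<dots> = real (n ^ (4 * k))" using n by (simp add: powr_realpow del: of_nat_mult)
    finally show ?thesis unfolding P_def by linarith
  qed
  have m4: "m \<le> 4 * (Q * q1)" using a(2) unfolding m_def by simp
  note pb = parameter_bounds[OF n K Qn q1n m4 cn Pn W_def]
  have "1 \<le> W" unfolding W_def m_def using n by simp
  then obtain q where q: "W \<le> 2 ^ q" "2 ^ q \<le> 2 * W" using ex_power_2 by blast
  obtain B where B: "(n + 1) * W + (2 * (n * c) + W) + (n * c + 1) * P + 1 \<le> 2 ^ B"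
    "2 ^ B \<le> 2 * ((n + 1) * W + (2 * (n * c) + W) + (n * c + 1) * P + 1)"
    using ex_power_2[of "(n + 1) * W + (2 * (n * c) + W) + (n * c + 1) * P + 1"] by auto
  have qz: "2 ^ q \<le> 2 * (K * n) ^ (2 * K + 9)" by (rule order_trans[OF q(2) mult_le_mono2[OF pb(1)]])
  have qb: "real q \<le> real (depth_const K) * lg"
    using log_power_bound[OF n K qz] unfolding depth_const_def lg_def .
  have Bz: "2 ^ B \<le> 2 * (K * n) ^ size_exp K k" by (rule order_trans[OF B(2) mult_le_mono2[OF pb(2)]])
  have Bb: "real B \<le> real (size_exp K k * (K + 1) + 1) * lg"
    using log_power_bound[OF n K Bz] unfolding lg_def .
  interpret sim: simulation n a c q B P L ALG .
  have mL: "2 ^ a \<le> L" using L(1) by (simp add: m_def)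
  define d where "d = real (depth_const K) * lg"
  have d1: "1 \<le> d" "d \<le> d ^ 2" "1 \<le> d ^ 2"
  proof -
    show "1 \<le> d" unfolding d_def depth_const_def using lg mult_mono[of 1 "real ((2 * K + 9) * (K + 1) + 1)" 1 lg] by simp
    then show "d \<le> d ^ 2" "1 \<le> d ^ 2"
      using self_le_power[of d 2] one_le_power[of d 2] by simp_all
  qed
  \<comment> \<open>The factor is 308 = 22 * 14: the program length contributes 22 = 6 + 3 + 13 as a
    multiple of \<open>d ^ 2\<close>, and \<open>L\<close> contributes 14. The powers of
    \<open>lg\<close> are 2 from \<open>d ^ 2\<close> and \<open>2 * K\<close> from
    \<open>\<kappa> ^ 2\<close>.\<close>
  define K' where "K' = 308 * (depth_const K) ^ 2 * K ^ 2 + 2 * K + 2"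
  have K': "308 * (depth_const K) ^ 2 * K ^ 2 \<le> K'" "2 * K + 2 \<le> K'" "1 \<le> K'"
    by (simp_all add: K'_def)
  have lgK': "lg ^ (2 * K + 2) \<le> lg ^ K'" "1 \<le> lg ^ K'"
    by (rule power_increasing[OF K'(2) lg(1)], rule one_le_power[OF lg(1)])
  have upper: "real (sim.time t) \<le> real K' * lg ^ K' * (real t * s)"
  proof -
    have "real (6 * q ^ 2 + 3 * q + 13) = 6 * real q ^ 2 + 3 * real q + 13" by simp
    also have "\<dots> \<le> 6 * d ^ 2 + 3 * d + 13"
      using qb unfolding d_def[symmetric] by (intro add_mono mult_left_mono power_mono) auto
    also have "\<dots> \<le> 22 * d ^ 2" using d1 by linarith
    finally have qd: "real (6 * q ^ 2 + 3 * q + 13) \<le> 22 * d ^ 2" .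
    have "real (sim.time t) \<le> real t * real (6 * q ^ 2 + 3 * q + 13) * real L"
      using sim.time_upper[OF t] by (metis of_nat_le_iff of_nat_mult)
    also have "\<dots> \<le> real t * (22 * d ^ 2) * (14 * \<kappa> ^ 2 * s)"
      using qd L(3) by (intro mult_mono mult_left_mono) auto
    also have "\<dots> = real (308 * (depth_const K) ^ 2 * K ^ 2) * lg ^ (2 * K + 2) * (real t * s)"
    proof -
      have "(lg ^ K) ^ 2 = lg ^ (2 * K)" by (simp add: power_mult[symmetric] mult.commute)
      then show ?thesis unfolding d_def \<kappa>_def power_mult_distrib power_add by simp
    qed
    also have "\<dots> \<le> real K' * lg ^ K' * (real t * s)"
    proof (intro mult_right_mono mult_mono)
      show "real (308 * depth_const K ^ 2 * K ^ 2) \<le> real K'" using K'(1) by (simp only: of_nat_le_iff)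
    qed (use lgK' lg s in auto)
    finally show ?thesis .
  qed
  have lower: "real t * s \<le> real K' * lg ^ K' * real (sim.time t)"
  proof -
    have "1 * s \<le> \<kappa> * s" using \<kappa>(1) s(1) by (intro mult_right_mono) auto
    then have "s \<le> real L" using L(2) by linarith
    then have "real t * s \<le> real t * real L" by (intro mult_left_mono) auto
    also have "\<dots> \<le> real (sim.time t)" using sim.time_lower[of t] by (metis of_nat_le_iff of_nat_mult)
    also have "\<dots> \<le> real K' * lg ^ K' * real (sim.time t)"
    proof -
      have "1 * 1 \<le> real K' * lg ^ K'" using K'(3) lgK'(2) by (intro mult_mono) auto
      then have "1 * real (sim.time t) \<le> real K' * lg ^ K' * real (sim.time t)"
        by (intro mult_right_mono) auto
      then show ?thesis by simp
    qed
    finally show ?thesis .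
  qed
  have sims: "simulates_on (1 - real n powr (- 2)) 2 c t (ALG (card (verts S))) (sim.time t) (sim.the_sim) sim.dec sim.time G S H inp adv"
    if G: "network n G" and sk: "skeleton K x G S H" and adv: "adversary (global_capacity n) adv" for G S H inp adv
  proof -
    have vG: "verts G = {1..n}" using G by (simp add: network_def)
    have cG: "card (verts G) = n" unfolding vG by simp
    note sk' = sk[unfolded skeleton_def Let_def cG tilde_Theta_def tilde_Omega_def tilde_O_def,
        folded lg_def s_def, folded \<kappa>_def]
    have gS: "graph S" and MV: "verts S \<subseteq> {1..n}" using sk' vG by auto
    obtain h where h: "real h \<le> \<kappa> * s"
      "\<forall>v\<in>verts S. \<forall>u\<in>verts S. v \<noteq> u \<longrightarrow> ({v, u} \<in> edges S \<longleftrightarrow> (\<exists>p. is_path G v u p \<and> path_hops p \<le> h))"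
      using sk' by blast
    have hL: "h \<le> L" using h(1) L(2) by linarith
    have M0: "verts S \<noteq> {}"
    proof
      assume "verts S = {}"
      then have "real n powr x \<le> 0" using sk' by auto
      then show False using n by simp
    qed
    have finM: "finite (verts S)" using MV finite_subset by blast
    have Hv: "H v \<subseteq> {1..n}" "\<bar>real (card (H v)) - s\<bar> < 1" "\<And>u. u \<in> H v \<Longrightarrow> real (hop_dist G v u) \<le> \<kappa> * s"
      if "v \<in> verts S" for v
      using sk' that vG by auto
    have cardH: "0 < card (H v)" "s / 2 \<le> real (card (H v))" if "v \<in> verts S" for v
    proof -
      show 1: "0 < card (H v)" using Hv(2)[OF that] s(1) by (cases "card (H v) = 0") auto
      \<comment> \<open>The size differs from \<open>s\<close> by less than 1. For
        \<open>s \<le> 2\<close> it suffices that the helper set is nonempty; otherwise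
        \<open>s - 1\<close> is at least \<open>s / 2\<close>.\<close>
      show "s / 2 \<le> real (card (H v))"
        using Hv(2)[OF that] 1 s(1) by (cases "s \<le> 2") auto
    qed
    show ?thesis
    proof (rule sim.simulates[OF n mL G adv, where Q = Q and ?q1.0 = q1])
      show "n * 2 ^ a \<le> 2 ^ q" using q(1) by (simp add: W_def m_def)
      show "(n + 1) * (n * 2 ^ a) \<le> 2 ^ B" "2 * (n * c) + n * 2 ^ a \<le> 2 ^ B" "(n * c + 1) * P \<le> 2 ^ B"
        using B(1) unfolding W_def m_def by linarith+
      show "verts S \<subseteq> {1..n}" "verts S \<noteq> {}" by (fact MV M0)+
      show "H v \<subseteq> {1..n} \<and> H v \<noteq> {}" if "v \<in> verts S" for v
        using Hv(1)[OF that] cardH(1)[OF that] by auto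
      show "w \<in> ball_of G L v \<and> v \<in> ball_of G L w" if "w \<in> verts S" "v \<in> H w" for w v
      proof -
        have "hop_dist G w v \<le> L" using Hv(3)[OF that] L(2) by linarith
        moreover have "w \<in> {1..n}" "v \<in> {1..n}" using that MV Hv(1) by blast+
        ultimately show ?thesis using hop_dist_ball_of[OF G] by blast
      qed
      show "u \<in> verts S \<and> u \<in> ball_of G L v" if vM: "v \<in> verts S" and un: "u \<in> nbrs S v" for v u
      proof -
        have e: "{v, u} \<in> edges S" using un by (simp add: nbrs_def)
        then obtain v' u' where "{v, u} = {v', u'}" "v' \<in> verts S" "u' \<in> verts S" "v' \<noteq> u'"
          using gS unfolding graph_def by blast
        then have u: "u \<in> verts S" "u \<noteq> v" by (auto simp: doubleton_eq_iff)
        have "{u, v} \<in> edges S" using e by (simp add: insert_commute)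
        then obtain p where p: "is_path G u v p" "path_hops p \<le> h"
          using iffD1[OF h(2)[rule_format, OF u(1) vM u(2)]] \<open>{u, v} \<in> edges S\<close> by blast
        show ?thesis using u(1) is_path_ball_of[OF p(1) order_trans[OF p(2) hL]] by blast
      qed
      show "card {w \<in> verts S. v \<in> H w} \<le> Q" if "v \<in> {1..n}" for v
      proof -
        have "real (card {w \<in> verts S. v \<in> H w}) \<le> \<kappa>" using sk' that vG by auto
        then show ?thesis unfolding Q_def by (simp add: le_nat_floor)
      qed
      show "c div card (H w) + 1 \<le> q1" if "w \<in> verts S" for w
      proof -
        have "real (c div card (H w)) \<le> real c / real (card (H w))" by (rule of_nat_div_le_of_nat)
        also have "\<dots> \<le> \<kappa> * s ^ 2 / (s / 2)"
          using cK(1) cardH[OF that] s(1) by (intro frac_le) auto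
        also have "\<dots> = 2 * \<kappa> * s" using s(1) by (simp add: power2_eq_square field_simps)
        finally show ?thesis unfolding q1_def by (simp add: le_nat_floor)
      qed
      show "2 * (Q * q1) \<le> 2 ^ a" by (rule a(1))
      show "c \<le> P" by (simp add: P_def)
      show "msg_code ms < P"
        if "act \<in> set_pmf (a_act (ALG (card (verts S))) mem)" "(tgt, ms) \<in> set (snd act)" "[] \<notin> set (snd ms)"
        for mem act tgt ms
      proof -
        have "real (msg_size ms) \<le> real k * log 2 (real (card (verts S)))"
          using msg[of "card (verts S)"] that(1,2) unfolding ac_message_bound_def by fastforce
        also have "\<dots> \<le> real k * lg"
        proof -
          have "card (verts S) \<le> n" using card_mono[OF _ MV] by simp
          moreover have "0 < card (verts S)" using M0 finM by (simp add: card_gt_0_iff)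
          ultimately have "log 2 (real (card (verts S))) \<le> lg" unfolding lg_def by (subst log_le_cancel_iff) auto
          then show ?thesis by (intro mult_left_mono) auto
        qed
        finally have "msg_size ms \<le> nat \<lfloor>real k * lg\<rfloor>" by (simp add: le_nat_floor)
        then have "(4::nat) ^ (2 * msg_size ms) \<le> 4 ^ (2 * nat \<lfloor>real k * lg\<rfloor>)" by (intro power_increasing) auto
        then show ?thesis using msg_code_less[OF that(3)] unfolding P_def by linarith
      qed
      show "1 - real n powr - 2 \<le> 1" by simp
    qed
  qed
  have mb: "hyb_message_bound (4 * (size_exp K k * (K + 1) + 1)) n sim.the_sim"
  proof (rule sim.the_sim_message_bound[OF n mL])
    \<comment> \<open>An item has four fields of \<open>B\<close> bits.\<close>
    have "4 * real B \<le> 4 * (real (size_exp K k * (K + 1) + 1) * lg)"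
      using Bb by (intro mult_left_mono) auto
    also have "\<dots> = real (4 * (size_exp K k * (K + 1) + 1)) * log 2 (real n)"
      unfolding lg_def by (simp only: of_nat_mult[of 4] of_nat_numeral mult.assoc)
    finally show "4 * real B \<le> real (4 * (size_exp K k * (K + 1) + 1)) * log 2 (real n)" .
  qed
  have theta: "tilde_Theta K' n (real (sim.time t)) (real t * real n powr (1 - x))"
    unfolding tilde_Theta_def tilde_Omega_def tilde_O_def lg_def[symmetric] s_def[symmetric]
    using upper lower by blast
  show ?thesis
    unfolding K'_def[symmetric]
    by (rule exI[of _ sim.the_sim], rule exI[of _ sim.dec], rule exI[of _ "sim.time t"], rule exI[of _ sim.time],
        intro conjI allI impI mb theta sim.mono_time refl)
      (elim conjE, rule sims)
qed

theorem theorem4p2: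
  fixes x :: real and K :: nat
  assumes "2/3 < x" and "x < 1"
  shows "\<exists>kT::nat. \<forall>k::nat. \<exists>(K'::nat) (kH::nat) (c'::real). c' > 1 \<and>
    (\<forall>(n::nat) (c::nat) (t::nat) (ALG :: nat \<Rightarrow> ac_alg).
       n \<ge> 2 \<and> t \<ge> 1 \<and> tilde_Theta K n (real c) (real n powr (2 - 2 * x)) \<and>
       (\<forall>N. ac_message_bound k N (ALG N)) \<longrightarrow>
       (\<exists>(SIM::hyb_alg) (dec :: bits \<Rightarrow> ac_state) (T::nat) (r :: nat \<Rightarrow> nat).
          hyb_message_bound kH n SIM \<and>
          tilde_Theta K' n (real T) (real t * real n powr (1 - x)) \<and>
          mono_on {..t} r \<and> r t = T \<and>
          (\<forall>G S H inp adv.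
             network n G \<and> skeleton K x G S H \<and> adversary (global_capacity n) adv \<longrightarrow>
             simulates_on (1 - real n powr (- c')) kT c t (ALG (card (verts S))) T SIM dec r
               G S H inp adv)))"
proof (rule exI[of _ 2], rule allI)
  \<comment> \<open>The witness 2 is the constant of \<open>length_tok_of\<close>.\<close>
  fix k
  have "0 < x" using assms by simp
  show "\<exists>(K'::nat) (kH::nat) (c'::real). c' > 1 \<and>
    (\<forall>(n::nat) (c::nat) (t::nat) (ALG :: nat \<Rightarrow> ac_alg).
       n \<ge> 2 \<and> t \<ge> 1 \<and> tilde_Theta K n (real c) (real n powr (2 - 2 * x)) \<and>
       (\<forall>N. ac_message_bound k N (ALG N)) \<longrightarrow>
       (\<exists>(SIM::hyb_alg) (dec :: bits \<Rightarrow> ac_state) (T::nat) (r :: nat \<Rightarrow> nat).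
          hyb_message_bound kH n SIM \<and>
          tilde_Theta K' n (real T) (real t * real n powr (1 - x)) \<and>
          mono_on {..t} r \<and> r t = T \<and>
          (\<forall>G S H inp adv.
             network n G \<and> skeleton K x G S H \<and> adversary (global_capacity n) adv \<longrightarrow>
             simulates_on (1 - real n powr (- c')) 2 c t (ALG (card (verts S))) T SIM dec r
               G S H inp adv)))"
  \<comment> \<open>The failure exponent is 2; since the coupling never fails, the required
    probability is below what is achieved.\<close>
  proof (rule exI[of _ "308 * (depth_const K) ^ 2 * K ^ 2 + 2 * K + 2"],
      rule exI[of _ "4 * (size_exp K k * (K + 1) + 1)"], rule exI[of _ "2::real"], rule conjI)
    show "(1::real) < 2" by simp
  qed (intro allI impI, elim conjE, rule simulation_exists[OF assms(2) \<open>0 < x\<close>], simp_all)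
qed

end
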